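(* Let the problem data $(A_0,A_1,b_0,b_1,c_0,c_1)$, the parameters $(\xi,\zeta,\hat\gamma)$ with $\hat\gamma\ge 0$, and $(\epsilon,p)$ satisfy: for both $i\in\{0,1\}$, $A_i\in\mathbb S^n$ has at least one negative eigenvalue and $\|A_i\|,\|b_i\|,|c_i|\le 1$; $N\ge n$, where $N$ is the number of nonzero entries in $A_0$ and $A_1$ combined; $\gamma_+\le\zeta$; $A(\hat\gamma)\succeq\xi I$; $0<\xi\le 1\le\zeta$; and $\epsilon,p\in(0,1)$. Then, with probability at least $1-p$, the algorithm ConstructReform (described in the context) succeeds, i.e. it outputs one of (i) "regular", $\gamma^{(1)},\gamma^{(2)},\tilde\mu$ such that $\gamma^*\in[\gamma^{(1)},\gamma^{(2)}]$ and $\mu(\gamma^{(i)})\ge\tilde\mu\ge\min(\mu^*,\xi)/8$ for $i=1,2$; (ii) "maybe regular", $x$ such that $x$ is an $\epsilon$-approximate optimizer; (iii) "not regular", $x$ such that $x$ is an $\epsilon$-approximate optimizer; and runs in time $$\tilde O\left(\frac{N\sqrt\zeta}{\sqrt\phi}\log\left(\frac1\phi\right)\log\left(\frac np\right)\log\left(\frac{\zeta}{\epsilon\xi}\right)\right),\qquad \phi=\max\left(\min(\mu^*,\xi),\ \epsilon\xi^4/\zeta^4\right).$$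
   Context: **Problem and notation.** $\mathbb S^n$ is the set of real symmetric $n\times n$ matrices; $\|\cdot\|$ is the spectral norm for matrices and the Euclidean norm for vectors. For $i\in\{0,1\}$, $q_i(x)=x^\top A_ix+2b_i^\top x+c_i$ with $A_i\in\mathbb S^n$, $b_i\in\mathbb R^n$, $c_i\in\mathbb R$. The GTRS is $\mathrm{Opt}=\inf_{x\in\mathbb R^n}\{q_0(x): q_1(x)\le 0\}$. A point $x$ is an $\epsilon$-approximate optimizer if $q_0(x)\le\mathrm{Opt}+\epsilon$ and $q_1(x)\le\epsilon$. Put $A(\gamma)=A_0+\gamma A_1$, $b(\gamma)=b_0+\gamma b_1$, $q(\gamma,x)=q_0(x)+\gamma q_1(x)$, $\mu(\gamma)=\lambda_{\min}(A(\gamma))$, $\Gamma=\{\gamma\ge 0: A(\gamma)\succeq 0\}$ (a closed interval) and $\gamma_+=\sup\Gamma$. For $\gamma\in\mathrm{int}(\Gamma)$, $x(\gamma)=-A(\gamma)^{-1}b(\gamma)$ and $\nu(\gamma)=q_1(x(\gamma))$. The dual function is $\mathbf d(\gamma)=\inf_{x}q(\gamma,x)$ for $\gamma\ge0$. If $\mathbf d$ has a unique maximizer over $\mathbb R_+$, $\gamma^*$ is that maximizer; otherwise $\arg\max_{\gamma\ge0}\mathbf d(\gamma)=\Gamma$ (compact) and $\gamma^*$ is the smallest element of $\arg\max_{\gamma\in\Gamma}\mu(\gamma)$. Set $\mu^*=\mu(\gamma^* )$. Running times count elementary arithmetic operations; $\tilde O$ hides $\log\log$-factors. Below, $T$'s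 use base-2 logarithms. **Black-box subroutines (known).** ApproxEig$(A,\rho,\delta,p)$: for $\|A\|\le\rho$, with probability $\ge 1-p$ returns a unit vector $x$ with $x^\top Ax\le\lambda_{\min}(A)+\delta$, in time $O(N_A\sqrt{\rho/\delta}\log(n/p))$ where $N_A$ is the number of nonzeros of $A$ (Lanczos). Conjugate gradient: for $\mu I\preceq A\preceq\rho I$, returns $x$ with $\|x+A^{-1}b\|\le\delta$ in time $O(N_A\sqrt{\rho/\mu}\log(\|b\|/(\mu\delta)))$. **ApproxNu$(\mu,\delta,\gamma)$** (for $A(\gamma)\succeq\mu I$): by conjugate gradient find $\tilde x$ with $\|\tilde x-x(\gamma)\|\le\mu\delta/(10\zeta)$; return $(\tilde x,q_1(\tilde x))$. **ApproxGammaLeft$(\mu,p)$** (for $\mu\in(0,\xi)$): set $\ell_1=0$, $r_1=\hat\gamma$. For $t=1,\dots,T=\lceil\log(5\zeta/\mu)\rceil$: $\gamma_t=(\ell_t+r_t)/2$; $x_t=$ ApproxEig$(A(\gamma_t),2\zeta,\mu/8,p/T)$; $\hat\mu_t=x_t^\top A(\gamma_t)x_t$; if $\hat\mu_t>\mu$ set $(\ell_{t+1},r_{t+1})=(\ell_t,\gamma_t)$; else if $\hat\mu_t<\frac58\mu$ set $(\ell_{t+1},r_{t+1})=(\gamma_t,r_t)$; else output $(\gamma_t,x_t)$. ApproxGammaRight is its mirror image, searching $[\hat\gamma,\zeta]$ (start $\ell_1=\hat\gamma$, $r_1=\zeta$; the two interval updates are interchanged). **ConstructReform.** Set $\gamma_0=\hat\gamma$,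 $\mu_0=\xi$, $(x_0,\nu_0)=$ ApproxNu$(\mu_0,\epsilon/(4\zeta),\gamma_0)$. If $\nu_0+\epsilon/(4\zeta)<0$ run CRLeft; else if $\nu_0-\epsilon/(4\zeta)>0$ run CRRight; else run CRMid. *CRLeft.* Let $T=\lceil\log(3200\zeta^4/(\epsilon\xi^3))\rceil$. For $t=1,\dots,T$: (a) $\mu_t=2^{-t}\xi$; (b) $(\gamma_t,v_t)=$ ApproxGammaLeft$(\mu_t,p/T)$; (c) $(x_t,\nu_t)=$ ApproxNu$(\mu_t/2,\epsilon/(4\zeta),\gamma_t)$; (d) if $\nu_t-\epsilon/(4\zeta)>0$, return "regular", $\gamma_t,\hat\gamma,\mu_t/4$; (e) else if $\nu_t\in[-\epsilon/(4\zeta),\epsilon/(4\zeta)]$: set $\gamma'=\gamma_t-\mu_t/4$, $(x',\nu')=$ ApproxNu$(\mu_t/4,\epsilon/(4\zeta),\gamma')$; if $\nu'-\epsilon/(4\zeta)>0$ return "regular", $\gamma',\hat\gamma,\mu_t/4$; else return "maybe regular", $x_t$. If the loop ends: negate $v_T$ if necessary so that $\langle v_T,A(\gamma_T)x_T+b(\gamma_T)\rangle\le0$, let $\alpha>0$ with $q_1(x_T+\alpha v_T)=0$, and return "not regular", $x_T+\alpha v_T$. *CRRight* is the mirror image of CRLeft: it uses ApproxGammaRight, reverses the sign tests on $\nu_t$ and $\nu'$ (tests $\nu_t+\epsilon/(4\zeta)<0$ and $\nu'+\epsilon/(4\zeta)<0$), uses $\gamma'=\gamma_t+\mu_t/4$,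 and its "regular" outputs are $\hat\gamma,\gamma_t,\mu_t/4$, resp. $\hat\gamma,\gamma',\mu_t/4$. *CRMid.* Let $\gamma'=\gamma_0-\xi/2$, $\gamma''=\gamma_0+\xi/2$; $(x',\nu')=$ ApproxNu$(\xi/2,\epsilon/(4\zeta),\gamma')$; $(x'',\nu'')=$ ApproxNu$(\xi/2,\epsilon/(4\zeta),\gamma'')$. If $\nu'-\epsilon/(4\zeta)>0>\nu''+\epsilon/(4\zeta)$ return "regular", $\gamma',\gamma'',\xi/2$; otherwise return "maybe regular", $x_0$. *)

theory Defs
  imports
    "HOL-Probability.Probability"
    "Jordan_Normal_Form.Spectral_Radius"
    "HOL-Library.Monad_Syntax"
begin

hide_type (open) Finite_Cartesian_Product.vec
hide_const (open) Finite_Cartesian_Product.vec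
no_notation inner (infix "\<bullet>" 70)

text \<open>
  The dimension \<open>n\<close> has to be a term, because the hidden constant of the running time must not
  depend on it; therefore the vectors and matrices of \<open>Jordan_Normal_Form\<close> are used.
\<close>

definition vnorm :: "real vec \<Rightarrow> real" where
  "vnorm x = sqrt (x \<bullet> x)"

definition spectral_norm :: "real mat \<Rightarrow> real" where
  "spectral_norm A = (SUP x\<in>{x \<in> carrier_vec (dim_col A). vnorm x \<le> 1}. vnorm (A *\<^sub>v x))"

definition sym_mat :: "nat \<Rightarrow> real mat \<Rightarrow> bool" where
  "sym_mat n A \<longleftrightarrow> A \<in> carrier_mat n n \<and> transpose_mat A = A"

definition lambda_min :: "real mat \<Rightarrow> real" where
  "lambda_min A = Min (spectrum A)"

definition psd :: "real mat \<Rightarrow> bool" where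
  "psd A \<longleftrightarrow> (\<forall>x \<in> carrier_vec (dim_row A). 0 \<le> x \<bullet> (A *\<^sub>v x))"

definition loewner_le :: "real mat \<Rightarrow> real mat \<Rightarrow> bool" (infix "\<preceq>\<^sub>L" 50) where
  "A \<preceq>\<^sub>L B \<longleftrightarrow> psd (B - A)"

definition nnz :: "real mat \<Rightarrow> nat" where
  "nnz A = card {(i, j). i < dim_row A \<and> j < dim_col A \<and> A $$ (i, j) \<noteq> 0}"

definition mat_inv :: "real mat \<Rightarrow> real mat" where
  "mat_inv A = the (mat_inverse A)"

record gtrs =
  qdim :: nat
  A\<^sub>0 :: "real mat"
  A\<^sub>1 :: "real mat"
  b\<^sub>0 :: "real vec"
  b\<^sub>1 :: "real vec"
  c\<^sub>0 :: real
  c\<^sub>1 :: real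

definition wf_gtrs :: "gtrs \<Rightarrow> bool" where
  "wf_gtrs P \<longleftrightarrow>
     sym_mat (qdim P) (A\<^sub>0 P) \<and> sym_mat (qdim P) (A\<^sub>1 P) \<and>
     b\<^sub>0 P \<in> carrier_vec (qdim P) \<and> b\<^sub>1 P \<in> carrier_vec (qdim P)"

definition q\<^sub>0 :: "gtrs \<Rightarrow> real vec \<Rightarrow> real" where
  "q\<^sub>0 P x = x \<bullet> (A\<^sub>0 P *\<^sub>v x) + 2 * (b\<^sub>0 P \<bullet> x) + c\<^sub>0 P"

definition q\<^sub>1 :: "gtrs \<Rightarrow> real vec \<Rightarrow> real" where
  "q\<^sub>1 P x = x \<bullet> (A\<^sub>1 P *\<^sub>v x) + 2 * (b\<^sub>1 P \<bullet> x) + c\<^sub>1 P"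

definition Opt :: "gtrs \<Rightarrow> ereal" where
  "Opt P = (INF x\<in>{x \<in> carrier_vec (qdim P). q\<^sub>1 P x \<le> 0}. ereal (q\<^sub>0 P x))"

definition approx_optimizer :: "gtrs \<Rightarrow> real \<Rightarrow> real vec \<Rightarrow> bool" where
  "approx_optimizer P \<epsilon> x \<longleftrightarrow>
     x \<in> carrier_vec (qdim P) \<and> ereal (q\<^sub>0 P x) \<le> Opt P + ereal \<epsilon> \<and> q\<^sub>1 P x \<le> \<epsilon>"

definition A_at :: "gtrs \<Rightarrow> real \<Rightarrow> real mat" where
  "A_at P \<gamma> = A\<^sub>0 P + \<gamma> \<cdot>\<^sub>m A\<^sub>1 P"

definition b_at :: "gtrs \<Rightarrow> real \<Rightarrow> real vec" where
  "b_at P \<gamma> = b\<^sub>0 P + \<gamma> \<cdot>\<^sub>v b\<^sub>1 P"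

definition q_at :: "gtrs \<Rightarrow> real \<Rightarrow> real vec \<Rightarrow> real" where
  "q_at P \<gamma> x = q\<^sub>0 P x + \<gamma> * q\<^sub>1 P x"

definition mu_at :: "gtrs \<Rightarrow> real \<Rightarrow> real" where
  "mu_at P \<gamma> = lambda_min (A_at P \<gamma>)"

definition Gam :: "gtrs \<Rightarrow> real set" where
  "Gam P = {\<gamma>. 0 \<le> \<gamma> \<and> 0\<^sub>m (qdim P) (qdim P) \<preceq>\<^sub>L A_at P \<gamma>}"

definition gamma_plus :: "gtrs \<Rightarrow> real" where
  "gamma_plus P = Sup (Gam P)"

definition dual :: "gtrs \<Rightarrow> real \<Rightarrow> ereal" where
  "dual P \<gamma> = (INF x\<in>carrier_vec (qdim P). ereal (q_at P \<gamma> x))"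

definition dual_maximizer :: "gtrs \<Rightarrow> real \<Rightarrow> bool" where
  "dual_maximizer P \<gamma> \<longleftrightarrow> 0 \<le> \<gamma> \<and> (\<forall>\<gamma>'\<ge>0. dual P \<gamma>' \<le> dual P \<gamma>)"

definition gamma_star :: "gtrs \<Rightarrow> real" where
  "gamma_star P =
     (if \<exists>!\<gamma>. dual_maximizer P \<gamma> then THE \<gamma>. dual_maximizer P \<gamma>
      else LEAST \<gamma>. \<gamma> \<in> Gam P \<and> (\<forall>\<gamma>'\<in>Gam P. mu_at P \<gamma>' \<le> mu_at P \<gamma>))"

definition mu_star :: "gtrs \<Rightarrow> real" where
  "mu_star P = mu_at P (gamma_star P)"

text \<open>
  A timed value is a value together with the number of elementary arithmetic operations spent
  on computing it.
\<close>

type_synonym 'a timed = "'a \<times> nat"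

definition cost :: "nat \<Rightarrow> 'a \<Rightarrow> 'a timed" where
  "cost k a = (a, k)"

definition bind_timed :: "'a timed \<Rightarrow> ('a \<Rightarrow> 'b timed) \<Rightarrow> 'b timed" where
  "bind_timed m f = (fst (f (fst m)), snd m + snd (f (fst m)))"

adhoc_overloading Monad_Syntax.bind \<rightleftharpoons> bind_timed

text \<open>
  Logarithms inside \<open>O\<close>-bounds are truncated from below at 1. Taken literally, such a
  bound tends to 0 when the argument tends to 1, which no algorithm can meet.
\<close>

definition lg :: "real \<Rightarrow> real" where
  "lg x = max 1 (log 2 x)"

text \<open>
  ApproxEig takes \<open>A\<close>, \<open>\<rho>\<close>, \<open>\<delta>\<close>, \<open>p\<close> and a random seed; conjugate gradient takes
  \<open>A\<close>, \<open>b\<close>, \<open>\<mu>\<close>, \<open>\<rho>\<close>, \<open>\<delta>\<close>.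
\<close>

type_synonym 's eig_oracle = "real mat \<Rightarrow> real \<Rightarrow> real \<Rightarrow> real \<Rightarrow> 's \<Rightarrow> real vec timed"

type_synonym cg_oracle = "real mat \<Rightarrow> real vec \<Rightarrow> real \<Rightarrow> real \<Rightarrow> real \<Rightarrow> real vec timed"

text \<open>
  The constant \<open>K\<close> is uniform in all inputs, in particular in \<open>n\<close>. The number of
  nonzeros is counted as at least \<open>n\<close>, since a matrix \<open>A(\<gamma>)\<close> can have fewer than \<open>n\<close>
  nonzeros although the output alone has length \<open>n\<close>. \<open>\<delta> \<le> \<rho>\<close> excludes accuracies for which
  \<open>sqrt (\<rho> / \<delta>)\<close> is small.
\<close>

definition approx_eig_spec :: "'s measure \<Rightarrow> 's eig_oracle \<Rightarrow> bool" where
  "approx_eig_spec M eig \<longleftrightarrow> (\<exists>K. \<forall>n A \<rho> \<delta> p.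
     0 < n \<and> sym_mat n A \<and> spectral_norm A \<le> \<rho> \<and> 0 < \<delta> \<and> \<delta> \<le> \<rho> \<and> 0 < p \<and> p < 1 \<longrightarrow>
       (\<forall>\<omega>\<in>space M. fst (eig A \<rho> \<delta> p \<omega>) \<in> carrier_vec n) \<and>
       (\<forall>i<n. (\<lambda>\<omega>. vec_index (fst (eig A \<rho> \<delta> p \<omega>)) i) \<in> borel_measurable M) \<and>
       (\<exists>E\<in>sets M. measure M E \<ge> 1 - p \<and> (\<forall>\<omega>\<in>E.
          let (x, time) = eig A \<rho> \<delta> p \<omega> in
            vnorm x = 1 \<and> x \<bullet> (A *\<^sub>v x) \<le> lambda_min A + \<delta> \<and>
            real time \<le> K * real (max n (nnz A)) * sqrt (\<rho> / \<delta>) * lg (real n / p))))"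

definition conj_grad_spec :: "cg_oracle \<Rightarrow> bool" where
  "conj_grad_spec cg \<longleftrightarrow> (\<exists>K. \<forall>n A b \<mu> \<rho> \<delta>.
     0 < n \<and> sym_mat n A \<and> b \<in> carrier_vec n \<and> 0 < \<mu> \<and> 0 < \<delta> \<and>
     \<mu> \<cdot>\<^sub>m 1\<^sub>m n \<preceq>\<^sub>L A \<and> A \<preceq>\<^sub>L \<rho> \<cdot>\<^sub>m 1\<^sub>m n \<longrightarrow>
       (let (x, time) = cg A b \<mu> \<rho> \<delta> in
          x \<in> carrier_vec n \<and> vnorm (x + mat_inv A *\<^sub>v b) \<le> \<delta> \<and>
          real time \<le> K * real (nnz A) * sqrt (\<rho> / \<mu>) * lg (vnorm b / (\<mu> * \<delta>))))"

definition eval_A :: "gtrs \<Rightarrow> real \<Rightarrow> real mat timed" where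
  "eval_A P \<gamma> = cost (nnz (A\<^sub>0 P) + 2 * nnz (A\<^sub>1 P)) (A_at P \<gamma>)"

definition eval_b :: "gtrs \<Rightarrow> real \<Rightarrow> real vec timed" where
  "eval_b P \<gamma> = cost (2 * qdim P) (b_at P \<gamma>)"

definition eval_q1 :: "gtrs \<Rightarrow> real vec \<Rightarrow> real timed" where
  "eval_q1 P x = cost (2 * nnz (A\<^sub>1 P) + 4 * qdim P + 3) (q\<^sub>1 P x)"

definition eval_mult :: "real mat \<Rightarrow> real vec \<Rightarrow> real vec timed" where
  "eval_mult A x = cost (2 * nnz A + dim_row A) (A *\<^sub>v x)"

definition eval_inner :: "real vec \<Rightarrow> real vec \<Rightarrow> real timed" where
  "eval_inner x y = cost (2 * dim_vec y) (x \<bullet> y)"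

definition eval_add :: "real vec \<Rightarrow> real vec \<Rightarrow> real vec timed" where
  "eval_add x y = cost (dim_vec y) (x + y)"

definition eval_smult :: "real \<Rightarrow> real vec \<Rightarrow> real vec timed" where
  "eval_smult a x = cost (dim_vec x) (a \<cdot>\<^sub>v x)"

definition eval_ceil_log :: "real \<Rightarrow> nat timed" where
  "eval_ceil_log y = (let T = nat \<lceil>log 2 y\<rceil> in cost (T + 1) T)" \<comment> \<open>repeated doubling\<close>

datatype side = LeftSide | RightSide

text \<open>Reversal of the sign tests and of the shift of \<open>\<gamma>'\<close> in the mirror image.\<close>

fun side_sign :: "side \<Rightarrow> real" where
  "side_sign LeftSide = 1"
| "side_sign RightSide = -1"

datatype cr_output =
    Regular real real real
  | MaybeRegular "real vec"
  | NotRegular "real vec"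
  | Failure \<comment> \<open>ApproxGammaLeft or ApproxGammaRight exhausted its loop without an output\<close>

text \<open>
  \<open>\<omega>\<close> is the table of random seeds: ApproxEig, called in iteration \<open>s\<close> of the search within
  iteration \<open>t\<close> of CRLeft or CRRight, uses the seed \<open>\<omega> (t, s)\<close>, so no seed is used twice.
\<close>

context
  fixes eig :: "'s eig_oracle" and cg :: cg_oracle and P :: gtrs
    and \<xi> \<zeta> \<gamma>h \<epsilon> p :: real and \<omega> :: "nat \<times> nat \<Rightarrow> 's"
begin

definition approx_nu :: "real \<Rightarrow> real \<Rightarrow> real \<Rightarrow> (real vec \<times> real) timed" where
  "approx_nu \<mu> \<delta> \<gamma> = do {
     A \<leftarrow> eval_A P \<gamma>;
     b \<leftarrow> eval_b P \<gamma>;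
     \<rho> \<leftarrow> cost 1 (2 * \<zeta>);
     d \<leftarrow> cost 3 (\<mu> * \<delta> / (10 * \<zeta>));
     x \<leftarrow> cg A b \<mu> \<rho> d;
     \<nu> \<leftarrow> eval_q1 P x;
     cost 0 (x, \<nu>)
   }"

text \<open>
  \<open>gamma_loop S \<mu> p' t T k s l r\<close>: iterations \<open>s, \<dots>, s + k - 1\<close> (so up to \<open>T\<close>, when started
  with \<open>k = T\<close>, \<open>s = 1\<close>) of the search on side \<open>S\<close> in the \<open>t\<close>-th iteration of the caller.
\<close>

primrec gamma_loop ::
  "side \<Rightarrow> real \<Rightarrow> real \<Rightarrow> nat \<Rightarrow> nat \<Rightarrow> nat \<Rightarrow> nat \<Rightarrow> real \<Rightarrow> real \<Rightarrow> (real \<times> real vec) option timed"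
where
  "gamma_loop S \<mu> p' t T 0 s l r = cost 0 None"
| "gamma_loop S \<mu> p' t T (Suc k) s l r = do {
     \<gamma> \<leftarrow> cost 2 ((l + r) / 2);
     A \<leftarrow> eval_A P \<gamma>;
     \<rho> \<leftarrow> cost 1 (2 * \<zeta>);
     \<delta> \<leftarrow> cost 1 (\<mu> / 8);
     p'' \<leftarrow> cost 1 (p' / real T);
     x \<leftarrow> eig A \<rho> \<delta> p'' (\<omega> (t, s));
     Ax \<leftarrow> eval_mult A x;
     m \<leftarrow> eval_inner x Ax;
     above \<leftarrow> cost 1 (m > \<mu>);
     below \<leftarrow> cost 2 (m < 5 / 8 * \<mu>);
     if above then
       (case S of
          LeftSide \<Rightarrow> gamma_loop S \<mu> p' t T k (Suc s) l \<gamma>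
        | RightSide \<Rightarrow> gamma_loop S \<mu> p' t T k (Suc s) \<gamma> r)
     else if below then
       (case S of
          LeftSide \<Rightarrow> gamma_loop S \<mu> p' t T k (Suc s) \<gamma> r
        | RightSide \<Rightarrow> gamma_loop S \<mu> p' t T k (Suc s) l \<gamma>)
     else cost 0 (Some (\<gamma>, x))
   }"

definition approx_gamma :: "side \<Rightarrow> real \<Rightarrow> real \<Rightarrow> nat \<Rightarrow> (real \<times> real vec) option timed" where
  "approx_gamma S \<mu> p' t = do {
     y \<leftarrow> cost 2 (5 * \<zeta> / \<mu>);
     T \<leftarrow> eval_ceil_log y;
     case S of
       LeftSide \<Rightarrow> gamma_loop S \<mu> p' t T T 1 0 \<gamma>h
     | RightSide \<Rightarrow> gamma_loop S \<mu> p' t T T 1 \<gamma>h \<zeta>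
   }"

definition regular_output :: "side \<Rightarrow> real \<Rightarrow> real \<Rightarrow> cr_output" where
  "regular_output S \<gamma> m = (case S of LeftSide \<Rightarrow> Regular \<gamma> \<gamma>h m | RightSide \<Rightarrow> Regular \<gamma>h \<gamma> m)"

text \<open>
  The code after the loop. The unique positive root \<open>\<alpha>\<close> is found by the quadratic formula from the
  coefficients \<open>a2\<close>, \<open>a1\<close>, \<open>a0\<close>, which is what the 10 operations (one of them a square root) pay for;
  if the black box has failed, there may be no such root and \<open>\<alpha>\<close> is unspecified.
\<close>

definition cr_end :: "real \<Rightarrow> real vec \<Rightarrow> real vec \<Rightarrow> cr_output timed" where
  "cr_end \<gamma> v x = do {
     A \<leftarrow> eval_A P \<gamma>;
     b \<leftarrow> eval_b P \<gamma>;
     Ax \<leftarrow> eval_mult A x;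
     g \<leftarrow> eval_add Ax b;
     h \<leftarrow> eval_inner v g;
     w \<leftarrow> (if h \<le> 0 then cost 1 v else cost (1 + dim_vec v) (- v));
     A1w \<leftarrow> eval_mult (A\<^sub>1 P) w;
     a2 \<leftarrow> eval_inner w A1w;
     A1x \<leftarrow> eval_mult (A\<^sub>1 P) x;
     g1 \<leftarrow> eval_add A1x (b\<^sub>1 P);
     a1 \<leftarrow> eval_inner w g1;
     a0 \<leftarrow> eval_q1 P x;
     \<alpha> \<leftarrow> cost 10 (SOME \<alpha>. 0 < \<alpha> \<and> q\<^sub>1 P (x + \<alpha> \<cdot>\<^sub>v w) = 0);
     z \<leftarrow> eval_smult \<alpha> w;
     y \<leftarrow> eval_add x z;
     cost 0 (NotRegular y)
   }"

text \<open>
  \<open>cr_loop S \<tau> T k t \<gamma> v x\<close>: iterations \<open>t, \<dots>, t + k - 1\<close> of CRLeft or CRRight followed by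
  \<open>cr_end\<close>, where \<open>\<gamma>\<close>, \<open>v\<close>, \<open>x\<close> are the values from iteration \<open>t - 1\<close> and \<open>\<tau> = \<epsilon> / (4 \<zeta>)\<close>.
  Computing \<open>\<xi> / 2 ^ t\<close> takes two operations, since \<open>2 ^ (t - 1)\<close> is known from iteration \<open>t - 1\<close>.
\<close>

primrec cr_loop ::
  "side \<Rightarrow> real \<Rightarrow> nat \<Rightarrow> nat \<Rightarrow> nat \<Rightarrow> real \<Rightarrow> real vec \<Rightarrow> real vec \<Rightarrow> cr_output timed"
where
  "cr_loop S \<tau> T 0 t \<gamma> v x = cr_end \<gamma> v x"
| "cr_loop S \<tau> T (Suc k) t \<gamma> v x = do {
     \<mu> \<leftarrow> cost 2 (\<xi> / 2 ^ t);
     pT \<leftarrow> cost 1 (p / real T);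
     gv \<leftarrow> approx_gamma S \<mu> pT t;
     (case gv of
        None \<Rightarrow> cost 0 Failure
      | Some (\<gamma>t, vt) \<Rightarrow> do {
          (xt, \<nu>t) \<leftarrow> approx_nu (\<mu> / 2) \<tau> \<gamma>t;
          beyond \<leftarrow> cost 3 (side_sign S * \<nu>t - \<tau> > 0);
          near \<leftarrow> cost 3 (- \<tau> \<le> \<nu>t \<and> \<nu>t \<le> \<tau>);
          if beyond then cost 1 (regular_output S \<gamma>t (\<mu> / 4))
          else if near then do {
            \<gamma>' \<leftarrow> cost 3 (\<gamma>t - side_sign S * (\<mu> / 4));
            (x', \<nu>') \<leftarrow> approx_nu (\<mu> / 4) \<tau> \<gamma>';
            beyond' \<leftarrow> cost 3 (side_sign S * \<nu>' - \<tau> > 0);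
            if beyond' then cost 1 (regular_output S \<gamma>' (\<mu> / 4))
            else cost 0 (MaybeRegular xt)
          }
          else cr_loop S \<tau> T k (Suc t) \<gamma>t vt xt
        })
   }"

text \<open>The triple passed to the loop is a dummy: \<open>T\<close> is positive when \<open>\<epsilon>, \<xi> \<le> 1 \<le> \<zeta>\<close>.\<close>

definition cr_side :: "side \<Rightarrow> real \<Rightarrow> cr_output timed" where
  "cr_side S \<tau> = do {
     y \<leftarrow> cost 9 (3200 * \<zeta> ^ 4 / (\<epsilon> * \<xi> ^ 3));
     T \<leftarrow> eval_ceil_log y;
     cr_loop S \<tau> T T 1 \<gamma>h (0\<^sub>v (qdim P)) (0\<^sub>v (qdim P))
   }"

definition cr_mid :: "real \<Rightarrow> real vec \<Rightarrow> cr_output timed" where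
  "cr_mid \<tau> x0 = do {
     \<gamma>' \<leftarrow> cost 2 (\<gamma>h - \<xi> / 2);
     \<gamma>'' \<leftarrow> cost 2 (\<gamma>h + \<xi> / 2);
     (x', \<nu>') \<leftarrow> approx_nu (\<xi> / 2) \<tau> \<gamma>';
     (x'', \<nu>'') \<leftarrow> approx_nu (\<xi> / 2) \<tau> \<gamma>'';
     crossing \<leftarrow> cost 4 (\<nu>' - \<tau> > 0 \<and> 0 > \<nu>'' + \<tau>);
     if crossing then cost 1 (Regular \<gamma>' \<gamma>'' (\<xi> / 2))
     else cost 0 (MaybeRegular x0)
   }"

definition construct_reform :: "cr_output timed" where
  "construct_reform = do {
     \<tau> \<leftarrow> cost 2 (\<epsilon> / (4 * \<zeta>));
     (x0, \<nu>0) \<leftarrow> approx_nu \<xi> \<tau> \<gamma>h;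
     neg \<leftarrow> cost 2 (\<nu>0 + \<tau> < 0);
     pos \<leftarrow> cost 2 (\<nu>0 - \<tau> > 0);
     if neg then cr_side LeftSide \<tau>
     else if pos then cr_side RightSide \<tau>
     else cr_mid \<tau> x0
   }"

end

definition seeds :: "'s measure \<Rightarrow> (nat \<times> nat \<Rightarrow> 's) measure" where
  "seeds M = (\<Pi>\<^sub>M i\<in>UNIV. M)"

fun succeeds :: "gtrs \<Rightarrow> real \<Rightarrow> real \<Rightarrow> cr_output \<Rightarrow> bool" where
  "succeeds P \<xi> \<epsilon> (Regular \<gamma>1 \<gamma>2 m) \<longleftrightarrow>
     gamma_star P \<in> {\<gamma>1..\<gamma>2} \<and> mu_at P \<gamma>1 \<ge> m \<and> mu_at P \<gamma>2 \<ge> m \<and> m \<ge> min (mu_star P) \<xi> / 8"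
| "succeeds P \<xi> \<epsilon> (MaybeRegular x) \<longleftrightarrow> approx_optimizer P \<epsilon> x"
| "succeeds P \<xi> \<epsilon> (NotRegular x) \<longleftrightarrow> approx_optimizer P \<epsilon> x"
| "succeeds P \<xi> \<epsilon> Failure \<longleftrightarrow> False"

end

theory Submission
  imports Defs
begin

text \<open>
  Correctness. For \<open>\<mu>(\<gamma>) > 0\<close> the point \<open>x(\<gamma>)\<close> minimizes \<open>q(\<gamma>, \<cdot>)\<close>, so \<open>\<nu>(\<gamma>)\<close> is a supergradient of the
  dual function and its sign tells on which side of \<open>\<gamma>\<close> the maximizer \<open>\<gamma>*\<close> lies; as \<open>\<mu>\<close> is concave,
  \<open>\<gamma>*\<close> lying beyond \<open>\<gamma>\<^sub>t\<close> forces \<open>\<mu>* \<le> \<mu>\<^sub>t\<close>. If \<open>\<bar>\<nu>(\<gamma>)\<bar>\<close> is tiny, \<open>x(\<gamma>)\<close> is nearly optimal by weak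
  duality. If the loop ends, the last \<open>x\<^sub>T\<close> is bounded by \<open>O(\<zeta>/\<xi>)\<close>, whence moving along \<open>v\<^sub>T\<close> to
  the boundary \<open>q\<^sub>1 = 0\<close> costs at most \<open>\<alpha>\<^sup>2 \<mu>\<^sub>T \<le> \<epsilon>/2\<close>.

  Probability. The seeds of a search are independent, and the matrix queried in a step depends only
  on the seeds of the earlier steps of the same search; so conditioning step by step, each call of
  ApproxEig fails with at most its nominal probability. The side on which the search takes place is
  determined before any randomness is used.

  Time. Every executed iteration has \<open>\<mu>\<^sub>t \<ge> \<phi>/6400\<close>, and since iteration \<open>t\<close> costs
  \<open>1 / sqrt \<mu>\<^sub>t\<close> up to logarithms, the total is a geometric sum dominated by its last term.
\<close>

text \<open>The predicates \<open>eig_good\<close> and \<open>loop_good\<close> record what the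
  executed calls must deliver; given them, the run is analysed deterministically. The obstacle on
  the random side is measurability: an oracle only promises some measurable event of good seeds for
  each query, and the time of a call need not be a measurable function of the seed. So no event is
  formed from the run itself; \<open>seed_event\<close> asks only for a measurable set inside it. On
  the analytic side, \<open>gamma_star\<close> is defined by cases, but the analysis uses of it only
  that it maximizes the dual function. As \<open>lambda_min\<close> is a minimum over the real
  spectrum, the existence of a real eigenvalue has to be shown first; it is found as the best lower
  bound of the quadratic form. The constant 6400 is twice the 3200 in the number of iterations,
  because that number is rounded up. The iterated logarithms enter only through the division of p
  among the calls of ApproxEig.\<close>

no_notation Finite_Cartesian_Product.vec.vec_nth (infixl "$" 90)

section \<open>Real vectors and symmetric matrices\<close>

lemma vnorm_eq_L2_set: "vnorm x = L2_set (($) x) {0..<dim_vec x}"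
  by (simp add: vnorm_def L2_set_def scalar_prod_def power2_eq_square)

lemma vnorm_nonneg [simp]: "0 \<le> vnorm x"
  by (simp add: vnorm_eq_L2_set)

lemma scalar_prod_self_nonneg: "0 \<le> x \<bullet> (x :: real vec)"
  by (simp add: scalar_prod_def sum_nonneg)

lemma vnorm_power2: "(vnorm x)\<^sup>2 = x \<bullet> x"
  by (simp add: vnorm_def scalar_prod_self_nonneg)

lemma vnorm_eq_0_iff: "x \<in> carrier_vec n \<Longrightarrow> vnorm x = 0 \<longleftrightarrow> x = 0\<^sub>v n"
  by (auto simp: vnorm_eq_L2_set L2_set_eq_0_iff intro!: eq_vecI)

lemma vnorm_zero [simp]: "vnorm (0\<^sub>v n) = 0"
  by (simp add: vnorm_eq_L2_set L2_set_eq_0_iff)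

lemma abs_scalar_prod_le:
  assumes "x \<in> carrier_vec n" "y \<in> carrier_vec n"
  shows "\<bar>x \<bullet> y\<bar> \<le> vnorm x * vnorm y"
proof -
  have "\<bar>x \<bullet> y\<bar> \<le> (\<Sum>i\<in>{0..<n}. \<bar>x $ i\<bar> * \<bar>y $ i\<bar>)"
    using assms by (auto simp: scalar_prod_def abs_mult[symmetric] intro: sum_abs)
  also have "\<dots> \<le> vnorm x * vnorm y"
    using assms L2_set_mult_ineq[of "($) x" "($) y" "{0..<n}"] by (simp add: vnorm_eq_L2_set)
  finally show ?thesis .
qed

lemma vnorm_triangle:
  assumes "x \<in> carrier_vec n" "y \<in> carrier_vec n"
  shows "vnorm (x + y) \<le> vnorm x + vnorm y"
proof -
  have "vnorm (x + y) = L2_set (\<lambda>i. x $ i + y $ i) {0..<n}"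
    using assms by (auto simp: vnorm_eq_L2_set intro!: L2_set_cong)
  then show ?thesis
    using assms L2_set_triangle_ineq[of "($) x" "($) y" "{0..<n}"] by (simp add: vnorm_eq_L2_set)
qed

lemma vnorm_smult: "vnorm (a \<cdot>\<^sub>v x) = \<bar>a\<bar> * vnorm x"
  by (simp add: vnorm_def real_sqrt_mult power2_eq_square[symmetric] mult.assoc[symmetric])

lemma smult_mat_mult_vec:
  fixes A :: "'a :: comm_ring_1 mat"
  assumes "A \<in> carrier_mat m n" "x \<in> carrier_vec n"
  shows "(a \<cdot>\<^sub>m A) *\<^sub>v x = a \<cdot>\<^sub>v (A *\<^sub>v x)"
  using assms by (intro eq_vecI) auto

text \<open>\<open>spectral_norm\<close> is a supremum and bounds nothing before its set is known to
  be bounded; this crude bound by the norms of the rows breaks the circle. The summand 1 keeps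
  \<open>C\<close> positive for the zero matrix.\<close>

lemma mult_mat_vec_bounded:
  assumes A: "A \<in> carrier_mat m n"
  obtains C where "0 < C" "\<And>x. x \<in> carrier_vec n \<Longrightarrow> vnorm (A *\<^sub>v x) \<le> C * vnorm x"
proof
  let ?C = "(\<Sum>i\<in>{0..<m}. vnorm (row A i)) + 1"
  show "0 < ?C" by (intro add_nonneg_pos sum_nonneg) auto
  show "vnorm (A *\<^sub>v x) \<le> ?C * vnorm x" if x: "x \<in> carrier_vec n" for x
  proof -
    have "vnorm (A *\<^sub>v x) \<le> (\<Sum>i\<in>{0..<m}. \<bar>(A *\<^sub>v x) $ i\<bar>)"
      using A L2_set_le_sum_abs[of "($) (A *\<^sub>v x)" "{0..<m}"] by (simp add: vnorm_eq_L2_set)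
    also have "\<dots> \<le> (\<Sum>i\<in>{0..<m}. vnorm (row A i) * vnorm x)"
      using A x by (intro sum_mono) (auto intro!: abs_scalar_prod_le[of _ n])
    also have "\<dots> \<le> ?C * vnorm x"
      by (simp add: sum_distrib_right distrib_right)
    finally show ?thesis .
  qed
qed

lemma vnorm_mult_mat_vec_le:
  assumes A: "A \<in> carrier_mat m n" and x: "x \<in> carrier_vec n"
  shows "vnorm (A *\<^sub>v x) \<le> spectral_norm A * vnorm x"
proof (cases "vnorm x = 0")
  case True
  then have "x = 0\<^sub>v n" using x by (simp add: vnorm_eq_0_iff)
  then have "A *\<^sub>v x = 0\<^sub>v m" using A by (auto intro!: eq_vecI)
  then show ?thesis using True by simp
next
  case False
  then have pos: "0 < vnorm x" by (simp add: less_le)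
  obtain C where C: "0 < C" "\<And>x. x \<in> carrier_vec n \<Longrightarrow> vnorm (A *\<^sub>v x) \<le> C * vnorm x"
    using mult_mat_vec_bounded[OF A] by blast
  have bdd: "bdd_above ((\<lambda>x. vnorm (A *\<^sub>v x)) ` {x \<in> carrier_vec n. vnorm x \<le> 1})"
  proof (rule bdd_aboveI2)
    fix y assume "y \<in> {x \<in> carrier_vec n. vnorm x \<le> 1}"
    then show "vnorm (A *\<^sub>v y) \<le> C"
      using C(2)[of y] mult_left_mono[of "vnorm y" 1 C] C(1) A by (auto intro: order_trans)
  qed
  let ?y = "(1 / vnorm x) \<cdot>\<^sub>v x"
  have "vnorm (A *\<^sub>v ?y) \<le> spectral_norm A"
    unfolding spectral_norm_def using A x pos bdd by (intro cSUP_upper) (auto simp: vnorm_smult)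
  moreover have "vnorm (A *\<^sub>v ?y) = vnorm (A *\<^sub>v x) / vnorm x"
    using A x pos by (simp add: mult_mat_vec vnorm_smult)
  ultimately show ?thesis using pos by (simp add: field_simps)
qed

lemma spectral_norm_le:
  assumes A: "A \<in> carrier_mat m n" and r: "0 \<le> r"
    and le: "\<And>x. x \<in> carrier_vec n \<Longrightarrow> vnorm (A *\<^sub>v x) \<le> r * vnorm x"
  shows "spectral_norm A \<le> r"
  unfolding spectral_norm_def
proof (rule cSUP_least)
  show "{x \<in> carrier_vec (dim_col A). vnorm x \<le> 1} \<noteq> {}"
    by (auto intro!: exI[of _ "0\<^sub>v (dim_col A)"])
  fix x assume "x \<in> {x \<in> carrier_vec (dim_col A). vnorm x \<le> 1}"
  then show "vnorm (A *\<^sub>v x) \<le> r"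
    using A le[of x] mult_left_mono[of "vnorm x" 1 r] r by auto
qed

section \<open>Quadratic forms of symmetric matrices and the Loewner order\<close>

lemma sym_mat_scalar_prod:
  assumes "sym_mat n A" "x \<in> carrier_vec n" "y \<in> carrier_vec n"
  shows "x \<bullet> (A *\<^sub>v y) = y \<bullet> (A *\<^sub>v x)"
proof -
  have "x \<bullet> (A *\<^sub>v y) = (transpose_mat A *\<^sub>v x) \<bullet> y"
    using assms by (subst transpose_vec_mult_scalar) (auto simp: sym_mat_def)
  also have "\<dots> = y \<bullet> (A *\<^sub>v x)"
    using assms by (subst comm_scalar_prod[of _ n]) (auto simp: sym_mat_def)
  finally show ?thesis .
qed

lemma sym_mat_carrier: "sym_mat n A \<Longrightarrow> A \<in> carrier_mat n n"
  by (simp add: sym_mat_def)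

lemma sym_mat_add: "sym_mat n A \<Longrightarrow> sym_mat n B \<Longrightarrow> sym_mat n (A + B)"
  by (auto simp: sym_mat_def transpose_add)

lemma sym_mat_minus: "sym_mat n A \<Longrightarrow> sym_mat n B \<Longrightarrow> sym_mat n (A - B)"
  by (auto simp: sym_mat_def transpose_minus)

lemma sym_mat_smult: "sym_mat n A \<Longrightarrow> sym_mat n (a \<cdot>\<^sub>m A)"
  by (auto simp: sym_mat_def intro!: eq_matI elim!: equalityE) (metis index_transpose_mat(1) carrier_matD)

lemma sym_mat_one: "sym_mat n (1\<^sub>m n)"
  by (simp add: sym_mat_def)

lemma quad_form_add:
  assumes "sym_mat n A" "x \<in> carrier_vec n" "e \<in> carrier_vec n"
  shows "(x + e) \<bullet> (A *\<^sub>v (x + e)) = x \<bullet> (A *\<^sub>v x) + 2 * (e \<bullet> (A *\<^sub>v x)) + e \<bullet> (A *\<^sub>v e)"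
proof -
  note A = sym_mat_carrier[OF assms(1)]
  have "(x + e) \<bullet> (A *\<^sub>v (x + e)) = x \<bullet> (A *\<^sub>v x) + x \<bullet> (A *\<^sub>v e) + (e \<bullet> (A *\<^sub>v x) + e \<bullet> (A *\<^sub>v e))"
    using A assms by (simp add: mult_add_distrib_mat_vec add_scalar_prod_distrib[of _ n] scalar_prod_add_distrib[of _ n])
  then show ?thesis using sym_mat_scalar_prod[OF assms] by simp
qed

lemma quad_form_smult:
  assumes "(A :: real mat) \<in> carrier_mat n n" "x \<in> carrier_vec n"
  shows "(a \<cdot>\<^sub>v x) \<bullet> (A *\<^sub>v (a \<cdot>\<^sub>v x)) = a\<^sup>2 * (x \<bullet> (A *\<^sub>v x))"
  using assms by (simp add: mult_mat_vec power2_eq_square)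

lemma loewner_le_iff:
  assumes "A \<in> carrier_mat n n" "B \<in> carrier_mat n n"
  shows "A \<preceq>\<^sub>L B \<longleftrightarrow> (\<forall>x\<in>carrier_vec n. x \<bullet> (A *\<^sub>v x) \<le> x \<bullet> (B *\<^sub>v x))"
  using assms by (auto simp: loewner_le_def psd_def minus_mult_distrib_mat_vec scalar_prod_minus_distrib[of _ n])

lemma scalar_mat_quad_form:
  assumes "x \<in> carrier_vec n"
  shows "x \<bullet> ((a \<cdot>\<^sub>m 1\<^sub>m n) *\<^sub>v x) = a * (x \<bullet> (x :: real vec))"
  using assms by (simp add: smult_mat_mult_vec[of _ n n])

section \<open>Semidefinite forms and the least eigenvalue\<close>

lemma nonneg_quadratic_discriminant:
  fixes a b c :: real
  assumes "\<And>t. 0 \<le> a + 2 * b * t + c * t\<^sup>2"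
  shows "b\<^sup>2 \<le> a * c"
proof (cases "c = 0")
  case True
  have "b = 0"
  proof (rule ccontr)
    assume "b \<noteq> 0"
    \<comment> \<open>This argument makes the affine function \<open>a + 2 * b * t\<close> equal to
      -1.\<close>
    then show False using assms[of "- (a + 1) / (2 * b)"] True by (simp add: field_simps)
  qed
  then show ?thesis using True by simp
next
  case False
  have "0 < c"
  proof (rule ccontr)
    assume "\<not> 0 < c"
    then have c: "c < 0" using False by simp
    \<comment> \<open>Chosen so that \<open>- c * t\<close> is at least
      \<open>\<bar>a\<bar> + 2 * \<bar>b\<bar> + 1\<close> and \<open>1 \<le> t\<close>; the
      quadratic is then at most \<open>- t\<close>.\<close>
    define t where "t = (\<bar>a\<bar> + 2 * \<bar>b\<bar> + 1) / (- c) + 1"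
    have t1: "1 \<le> t" using c by (simp add: t_def divide_nonneg_neg)
    have ct: "- c * t \<ge> \<bar>a\<bar> + 2 * \<bar>b\<bar> + 1" using c by (simp add: t_def field_simps)
    have "c * t\<^sup>2 \<le> - (\<bar>a\<bar> + 2 * \<bar>b\<bar> + 1) * t"
      using mult_right_mono[OF ct, of t] t1 by (simp add: power2_eq_square algebra_simps)
    moreover have "2 * b * t \<le> 2 * \<bar>b\<bar> * t" using t1 by (intro mult_right_mono) auto
    moreover have "\<bar>a\<bar> \<le> \<bar>a\<bar> * t" using t1 mult_left_mono[of 1 t "\<bar>a\<bar>"] by simp
    ultimately have "a + 2 * b * t + c * t\<^sup>2 \<le> - t" by (simp add: algebra_simps)
    then show False using assms[of t] t1 by linarith
  qed
  then show ?thesis using assms[of "- b / c"] by (simp add: field_simps power2_eq_square)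
qed

lemma psd_cauchy_schwarz:
  assumes A: "sym_mat n A" and psd: "\<And>x. x \<in> carrier_vec n \<Longrightarrow> 0 \<le> x \<bullet> (A *\<^sub>v x)"
    and x: "x \<in> carrier_vec n" and y: "y \<in> carrier_vec n"
  shows "(y \<bullet> (A *\<^sub>v x))\<^sup>2 \<le> (x \<bullet> (A *\<^sub>v x)) * (y \<bullet> (A *\<^sub>v y))"
proof (rule nonneg_quadratic_discriminant)
  fix t :: real
  have "0 \<le> (x + t \<cdot>\<^sub>v y) \<bullet> (A *\<^sub>v (x + t \<cdot>\<^sub>v y))"
    using x y by (intro psd) auto
  also have "\<dots> = x \<bullet> (A *\<^sub>v x) + 2 * (y \<bullet> (A *\<^sub>v x)) * t + (y \<bullet> (A *\<^sub>v y)) * t\<^sup>2"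
    using sym_mat_carrier[OF A] x y by (subst quad_form_add[OF A]) (auto simp: mult_mat_vec power2_eq_square)
  finally show "0 \<le> x \<bullet> (A *\<^sub>v x) + 2 * (y \<bullet> (A *\<^sub>v x)) * t + (y \<bullet> (A *\<^sub>v y)) * t\<^sup>2" .
qed

lemma mat_inv_if_injective:
  assumes A: "A \<in> carrier_mat n n" and inj: "\<And>x. x \<in> carrier_vec n \<Longrightarrow> A *\<^sub>v x = 0\<^sub>v n \<Longrightarrow> x = 0\<^sub>v n"
  shows "mat_inv A \<in> carrier_mat n n" "A * mat_inv A = 1\<^sub>m n" "mat_inv A * A = 1\<^sub>m n"
proof -
  have "det A \<noteq> 0" using inj by (auto simp: det_0_iff_vec_prod_zero[OF A])
  then have "A \<in> Units (ring_mat TYPE(real) n ())" by (rule det_non_zero_imp_unit[OF A])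
  then obtain B where "mat_inverse A = Some B"
    using mat_inverse(1)[OF A, where b = "()"] by (cases "mat_inverse A") auto
  with mat_inverse(2)[OF A this] show "mat_inv A \<in> carrier_mat n n" "A * mat_inv A = 1\<^sub>m n" "mat_inv A * A = 1\<^sub>m n"
    by (auto simp: mat_inv_def)
qed

text \<open>With \<open>y = A x\<close>, Cauchy-Schwarz for the form gives \<open>|y|\<^sup>4 \<le> (x\<^sup>T A x) (y\<^sup>T A y)\<close>, and \<open>|y|\<close> is bounded
  below by a multiple of \<open>|x|\<close>. This replaces compactness of the unit sphere.\<close>

lemma psd_injective_margin:
  assumes A: "sym_mat n A" and psd: "\<And>x. x \<in> carrier_vec n \<Longrightarrow> 0 \<le> x \<bullet> (A *\<^sub>v x)"
    and inj: "\<And>x. x \<in> carrier_vec n \<Longrightarrow> A *\<^sub>v x = 0\<^sub>v n \<Longrightarrow> x = 0\<^sub>v n"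
  obtains m where "0 < m" "\<And>x. x \<in> carrier_vec n \<Longrightarrow> m * (x \<bullet> x) \<le> x \<bullet> (A *\<^sub>v x)"
proof -
  note Ac = sym_mat_carrier[OF A]
  note B = mat_inv_if_injective[OF Ac inj]
  obtain C where C: "0 < C" "\<And>x. x \<in> carrier_vec n \<Longrightarrow> vnorm (A *\<^sub>v x) \<le> C * vnorm x"
    using mult_mat_vec_bounded[OF Ac] by blast
  obtain D where D: "0 < D" "\<And>x. x \<in> carrier_vec n \<Longrightarrow> vnorm (mat_inv A *\<^sub>v x) \<le> D * vnorm x"
    using mult_mat_vec_bounded[OF B(1)] by blast
  show thesis
  proof
    show "0 < 1 / (D\<^sup>2 * C)" using C D by simp
    fix x :: "real vec" assume x: "x \<in> carrier_vec n"
    define y where "y = A *\<^sub>v x"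
    have y: "y \<in> carrier_vec n" using x Ac by (auto simp: y_def)
    define Q where "Q = x \<bullet> (A *\<^sub>v x)"
    have Q0: "0 \<le> Q" using psd[OF x] by (simp add: Q_def)
    have "(y \<bullet> y)\<^sup>2 \<le> Q * (y \<bullet> (A *\<^sub>v y))"
      using psd_cauchy_schwarz[OF A psd x y] by (simp add: y_def Q_def)
    also have "\<dots> \<le> Q * (vnorm y * (C * vnorm y))"
      using Q0 abs_scalar_prod_le[of y n "A *\<^sub>v y"] y Ac C(2)[OF y] mult_left_mono[OF C(2)[OF y], of "vnorm y"]
      by (intro mult_left_mono) auto
    finally have "((vnorm y)\<^sup>2)\<^sup>2 \<le> Q * (C * (vnorm y)\<^sup>2)"
      by (simp only: vnorm_power2[symmetric]) (simp add: power2_eq_square algebra_simps)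
    then have le: "(vnorm y)\<^sup>2 * (vnorm y)\<^sup>2 \<le> Q * C * (vnorm y)\<^sup>2"
      by (simp only: power2_eq_square mult.assoc)
    have yy: "(vnorm y)\<^sup>2 \<le> Q * C"
    proof (cases "vnorm y = 0")
      case True
      then show ?thesis using Q0 C(1) by simp
    next
      case False
      then show ?thesis using mult_right_le_imp_le[OF le] by simp
    qed
    have "vnorm x \<le> D * vnorm y"
      using D(2)[OF y] B x Ac by (simp add: y_def assoc_mult_mat_vec[symmetric, of _ n n _ n])
    then have "(vnorm x)\<^sup>2 \<le> D\<^sup>2 * (vnorm y)\<^sup>2"
      using power_mono[of "vnorm x" "D * vnorm y" 2] by (simp add: power_mult_distrib)
    also have "\<dots> \<le> D\<^sup>2 * (Q * C)" using yy by (intro mult_left_mono) auto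
    finally show "1 / (D\<^sup>2 * C) * (x \<bullet> x) \<le> x \<bullet> (A *\<^sub>v x)"
      using C D by (simp add: vnorm_power2 Q_def field_simps)
  qed
qed

lemma eigenvalue_ge_if_form_ge:
  assumes A: "sym_mat n A" and ge: "\<And>x. x \<in> carrier_vec n \<Longrightarrow> m * (x \<bullet> x) \<le> x \<bullet> (A *\<^sub>v x)"
    and ev: "eigenvalue A k"
  shows "m \<le> k"
proof -
  obtain v where v: "v \<in> carrier_vec n" "v \<noteq> 0\<^sub>v n" "A *\<^sub>v v = k \<cdot>\<^sub>v v"
    using ev sym_mat_carrier[OF A] by (auto simp: eigenvalue_def eigenvector_def)
  have "0 < (vnorm v)\<^sup>2" using v by (simp add: vnorm_eq_0_iff)
  moreover have "m * (vnorm v)\<^sup>2 \<le> k * (vnorm v)\<^sup>2"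
    using ge[OF v(1)] v by (simp add: vnorm_power2)
  ultimately show ?thesis by simp
qed

text \<open>Let \<open>m\<close> be the best constant with m |x|^2 \<le> x^T A x for all x. If A - m
  I were injective, it would be semidefinite with a positive margin \<open>d\<close>, and m + d
  would still be such a constant. Hence \<open>m\<close> is an eigenvalue, and no eigenvalue lies
  below a lower bound of the form. So the existence of a real eigenvalue and the variational bound
  come from one argument.\<close>

lemma lambda_min_exists:
  assumes A: "sym_mat n A" and n: "0 < n"
  obtains v where "v \<in> carrier_vec n" "vnorm v = 1" "A *\<^sub>v v = lambda_min A \<cdot>\<^sub>v v"
    "\<And>x. x \<in> carrier_vec n \<Longrightarrow> lambda_min A * (x \<bullet> x) \<le> x \<bullet> (A *\<^sub>v x)"
proof -
  note Ac = sym_mat_carrier[OF A]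
  obtain C where C: "0 < C" "\<And>x. x \<in> carrier_vec n \<Longrightarrow> vnorm (A *\<^sub>v x) \<le> C * vnorm x"
    using mult_mat_vec_bounded[OF Ac] by blast
  have form: "\<bar>x \<bullet> (A *\<^sub>v x)\<bar> \<le> C * (x \<bullet> x)" if "x \<in> carrier_vec n" for x
    using abs_scalar_prod_le[of x n "A *\<^sub>v x"] mult_left_mono[OF C(2)[OF that], of "vnorm x"] that Ac
    by (simp add: vnorm_power2[symmetric] power2_eq_square algebra_simps)
  define S where "S = {t. \<forall>x\<in>carrier_vec n. t * (x \<bullet> x) \<le> x \<bullet> (A *\<^sub>v x)}"
  define u :: "real vec" where "u = unit_vec n 0"
  have u: "u \<in> carrier_vec n" "u \<bullet> u = 1" using n by (auto simp: u_def)
  have "- C \<in> S" using form by (fastforce simp: S_def)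
  then have ne: "S \<noteq> {}" by auto
  have "t \<le> C" if "t \<in> S" for t
    using that form[OF u(1)] u by (auto simp: S_def)
  then have bdd: "bdd_above S" by (auto simp: bdd_above_def)
  define m where "m = Sup S"
  have m: "m * (x \<bullet> x) \<le> x \<bullet> (A *\<^sub>v x)" if x: "x \<in> carrier_vec n" for x
  proof (cases "x \<bullet> x = 0")
    case True
    then show ?thesis using form[OF x] by simp
  next
    case False
    then have pos: "0 < x \<bullet> x" using scalar_prod_self_nonneg[of x] by simp
    have "m \<le> (x \<bullet> (A *\<^sub>v x)) / (x \<bullet> x)"
      unfolding m_def using ne x pos by (intro cSup_least) (auto simp: S_def field_simps)
    then show ?thesis using pos by (simp add: field_simps)
  qed
  have ev: "eigenvalue A m"
  proof (rule ccontr)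
    assume no: "\<not> eigenvalue A m"
    let ?B = "A - m \<cdot>\<^sub>m 1\<^sub>m n"
    have B: "sym_mat n ?B" using A by (intro sym_mat_minus sym_mat_smult sym_mat_one)
    have Bx: "x \<bullet> (?B *\<^sub>v x) = x \<bullet> (A *\<^sub>v x) - m * (x \<bullet> x)" if "x \<in> carrier_vec n" for x
      using that Ac by (simp add: minus_mult_distrib_mat_vec[of _ n n] scalar_prod_minus_distrib[of _ n] smult_mat_mult_vec[of _ n n])
    have inj: "x = 0\<^sub>v n" if x: "x \<in> carrier_vec n" and 0: "?B *\<^sub>v x = 0\<^sub>v n" for x
    proof (rule ccontr)
      assume ne: "x \<noteq> 0\<^sub>v n"
      have "A *\<^sub>v x - m \<cdot>\<^sub>v x = 0\<^sub>v n"
        using 0 x Ac by (simp add: minus_mult_distrib_mat_vec[of _ n n] smult_mat_mult_vec[of _ n n])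
      then have "A *\<^sub>v x = m \<cdot>\<^sub>v x"
        using x Ac by (auto simp: vec_eq_iff)
      then show False using no x ne Ac by (auto simp: eigenvalue_def eigenvector_def)
    qed
    obtain d where d: "0 < d" "\<And>x. x \<in> carrier_vec n \<Longrightarrow> d * (x \<bullet> x) \<le> x \<bullet> (?B *\<^sub>v x)"
      using psd_injective_margin[OF B _ inj] Bx m by (metis diff_ge_0_iff_ge)
    have "m + d \<in> S" using d Bx by (force simp: S_def algebra_simps)
    then have "m + d \<le> m" unfolding m_def by (rule cSup_upper) (rule bdd)
    then show False using d by simp
  qed
  have lm: "lambda_min A = m"
    unfolding lambda_min_def
  proof (rule Min_eqI)
    show "finite (spectrum A)" by (rule card_finite_spectrum[OF Ac])
    show "m \<in> spectrum A" using ev by (simp add: spectrum_def)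
    show "m \<le> k" if "k \<in> spectrum A" for k
      using that eigenvalue_ge_if_form_ge[OF A m] by (simp add: spectrum_def)
  qed
  obtain v where v: "v \<in> carrier_vec n" "v \<noteq> 0\<^sub>v n" "A *\<^sub>v v = m \<cdot>\<^sub>v v"
    using ev Ac by (auto simp: eigenvalue_def eigenvector_def)
  have pos: "0 < vnorm v" using v vnorm_eq_0_iff[OF v(1)] by (simp add: less_le)
  show thesis
  proof
    show "(1 / vnorm v) \<cdot>\<^sub>v v \<in> carrier_vec n" using v by simp
    show "vnorm ((1 / vnorm v) \<cdot>\<^sub>v v) = 1" using pos by (simp add: vnorm_smult)
    show "A *\<^sub>v ((1 / vnorm v) \<cdot>\<^sub>v v) = lambda_min A \<cdot>\<^sub>v ((1 / vnorm v) \<cdot>\<^sub>v v)"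
      using v Ac by (simp add: mult_mat_vec lm smult_smult_assoc mult.commute)
  qed (use lm m in auto)
qed

lemma lambda_min_form_le:
  assumes "sym_mat n A" "x \<in> carrier_vec n"
  shows "lambda_min A * (x \<bullet> x) \<le> x \<bullet> (A *\<^sub>v x)"
proof (cases "n = 0")
  case True
  then show ?thesis using assms by (simp add: scalar_prod_def)
next
  case False
  then show ?thesis using lambda_min_exists[OF assms(1)] assms(2) by (metis neq0_conv)
qed

text \<open>Turns lower bounds on a least eigenvalue into inequalities between forms. The form of
  A(\<gamma>) is affine in \<gamma>, and the regularity of \<mu> below is read off from
  that.\<close>

lemma le_lambda_min_iff:
  assumes A: "sym_mat n A" and n: "0 < n"
  shows "m \<le> lambda_min A \<longleftrightarrow> (\<forall>x\<in>carrier_vec n. m * (x \<bullet> x) \<le> x \<bullet> (A *\<^sub>v x))"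
proof
  assume "m \<le> lambda_min A"
  then show "\<forall>x\<in>carrier_vec n. m * (x \<bullet> x) \<le> x \<bullet> (A *\<^sub>v x)"
    using lambda_min_form_le[OF A] mult_right_mono scalar_prod_self_nonneg by (meson order_trans)
next
  assume m: "\<forall>x\<in>carrier_vec n. m * (x \<bullet> x) \<le> x \<bullet> (A *\<^sub>v x)"
  obtain v where v: "v \<in> carrier_vec n" "vnorm v = 1" "A *\<^sub>v v = lambda_min A \<cdot>\<^sub>v v"
    using lambda_min_exists[OF A n] by metis
  have "v \<bullet> v = 1" using v vnorm_power2[of v] by simp
  then show "m \<le> lambda_min A" using m v by auto
qed

lemma lambda_min_le_unit:
  assumes "sym_mat n A" "v \<in> carrier_vec n" "vnorm v = 1"
  shows "lambda_min A \<le> v \<bullet> (A *\<^sub>v v)"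
  using lambda_min_form_le[OF assms(1,2)] vnorm_power2[of v] assms(3) by simp

lemma loewner_le_lambda_min:
  assumes "sym_mat n A" "0 < n"
  shows "m \<cdot>\<^sub>m 1\<^sub>m n \<preceq>\<^sub>L A \<longleftrightarrow> m \<le> lambda_min A"
  using assms by (simp add: le_lambda_min_iff loewner_le_iff[of _ n] sym_mat_carrier scalar_mat_quad_form)

section \<open>Quadratic functions and the dual function\<close>

text \<open>Common shape of \<open>q\<^sub>1\<close> and of q(\<gamma>, x), so that one expansion
  around a point serves both.\<close>

definition quad :: "real mat \<Rightarrow> real vec \<Rightarrow> real \<Rightarrow> real vec \<Rightarrow> real" where
  "quad A b c x = x \<bullet> (A *\<^sub>v x) + 2 * (b \<bullet> x) + c"

lemma quad_add:
  assumes "sym_mat n A" "b \<in> carrier_vec n" "x \<in> carrier_vec n" "e \<in> carrier_vec n"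
  shows "quad A b c (x + e) = quad A b c x + 2 * (e \<bullet> (A *\<^sub>v x + b)) + e \<bullet> (A *\<^sub>v e)"
  using assms sym_mat_carrier[OF assms(1)]
  by (simp add: quad_def quad_form_add[of n] scalar_prod_add_distrib[of _ n] comm_scalar_prod[of b n e])

lemma quad_add_smult:
  assumes "sym_mat n A" "b \<in> carrier_vec n" "x \<in> carrier_vec n" "v \<in> carrier_vec n"
  shows "quad A b c (x + t \<cdot>\<^sub>v v) =
    quad A b c x + 2 * t * (v \<bullet> (A *\<^sub>v x + b)) + t\<^sup>2 * (v \<bullet> (A *\<^sub>v v))"
  using assms sym_mat_carrier[OF assms(1)]
  by (subst quad_add[of n]) (auto simp: mult_mat_vec[of _ n n] power2_eq_square)

lemma quad_stationary_le:
  assumes "sym_mat n A" "b \<in> carrier_vec n" "x \<in> carrier_vec n" "y \<in> carrier_vec n"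
    and psd: "\<And>x. x \<in> carrier_vec n \<Longrightarrow> 0 \<le> x \<bullet> (A *\<^sub>v x)"
    and "A *\<^sub>v x + b = 0\<^sub>v n"
  shows "quad A b c x \<le> quad A b c y"
proof -
  have "y = x + (y - x)" using assms by (intro eq_vecI) auto
  then have "quad A b c y = quad A b c x + (y - x) \<bullet> (A *\<^sub>v (y - x))"
    using assms quad_add[of n A b x "y - x" c] by simp
  then show ?thesis using psd[of "y - x"] assms by simp
qed

text \<open>A move by t along the vector g = A x + b changes the value by 2 t |g|^2 + t^2 g^T A g.
  If this is nonnegative for every t, the discriminant inequality with constant term 0 forces g =
  0.\<close>

lemma quad_minimizer_stationary:
  assumes A: "sym_mat n A" and b: "b \<in> carrier_vec n" and x: "x \<in> carrier_vec n"
    and min: "\<And>y. y \<in> carrier_vec n \<Longrightarrow> quad A b c x \<le> quad A b c y"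
  shows "A *\<^sub>v x + b = 0\<^sub>v n"
proof -
  define g where "g = A *\<^sub>v x + b"
  have g: "g \<in> carrier_vec n" using sym_mat_carrier[OF A] b x by (auto simp: g_def)
  have "(g \<bullet> g)\<^sup>2 \<le> 0 * (g \<bullet> (A *\<^sub>v g))"
  proof (rule nonneg_quadratic_discriminant)
    fix t :: real
    have "quad A b c x \<le> quad A b c (x + t \<cdot>\<^sub>v g)" using g x by (intro min) auto
    then show "0 \<le> 0 + 2 * (g \<bullet> g) * t + g \<bullet> (A *\<^sub>v g) * t\<^sup>2"
      using quad_add_smult[OF A b x g, of c t] by (simp add: g_def algebra_simps)
  qed
  then have "vnorm g = 0" by (simp add: vnorm_power2[symmetric])
  then show ?thesis using g by (simp add: vnorm_eq_0_iff g_def)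
qed

lemma mult_mat_vec_uminus:
  assumes "(A :: real mat) \<in> carrier_mat m n" "x \<in> carrier_vec n"
  shows "A *\<^sub>v (- x) = - (A *\<^sub>v x)"
  using assms by (intro eq_vecI) (auto simp: scalar_prod_uminus_right)

lemma add_smult_add:
  fixes u v w z :: "real vec"
  assumes "u \<in> carrier_vec n" "v \<in> carrier_vec n" "w \<in> carrier_vec n" "z \<in> carrier_vec n"
  shows "u + t \<cdot>\<^sub>v v + (w + t \<cdot>\<^sub>v z) = u + w + t \<cdot>\<^sub>v (v + z)"
  using assms by (intro eq_vecI) (auto simp: algebra_simps)

text \<open>The negative eigenvalue of \<open>A\<^sub>0 P\<close> makes \<mu> negative at 0; that of
  \<open>A\<^sub>1 P\<close> bounds \<Gamma>, so that \<open>gp\<close> yields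
  \<open>\<mu> \<zeta> \<le> 0\<close>. Thus \<mu> falls from at least \<xi> at
  \<open>\<gamma>h\<close> to at most 0 at either end of [0, \<zeta>], and both searches have a
  level to find.\<close>

locale gtrs_instance =
  fixes P :: gtrs and \<xi> \<zeta> \<gamma>h :: real
  assumes wf: "wf_gtrs P"
    and neg0: "\<exists>l<0. eigenvalue (A\<^sub>0 P) l" and neg1: "\<exists>l<0. eigenvalue (A\<^sub>1 P) l"
    and nA0: "spectral_norm (A\<^sub>0 P) \<le> 1" and nb0: "vnorm (b\<^sub>0 P) \<le> 1" and nc0: "\<bar>c\<^sub>0 P\<bar> \<le> 1"
    and nA1: "spectral_norm (A\<^sub>1 P) \<le> 1" and nb1: "vnorm (b\<^sub>1 P) \<le> 1" and nc1: "\<bar>c\<^sub>1 P\<bar> \<le> 1"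
    and gh0: "0 \<le> \<gamma>h" and gp: "gamma_plus P \<le> \<zeta>"
    and gh_pd: "\<xi> \<cdot>\<^sub>m 1\<^sub>m (qdim P) \<preceq>\<^sub>L A_at P \<gamma>h"
    and xi0: "0 < \<xi>" and xi1: "\<xi> \<le> 1" and zeta1: "1 \<le> \<zeta>"
begin

abbreviation n where "n \<equiv> qdim P"
abbreviation \<mu> where "\<mu> \<equiv> mu_at P"

lemma sym0: "sym_mat n (A\<^sub>0 P)" and sym1: "sym_mat n (A\<^sub>1 P)"
  and b0_carrier [simp]: "b\<^sub>0 P \<in> carrier_vec n" and b1_carrier [simp]: "b\<^sub>1 P \<in> carrier_vec n"
  using wf by (auto simp: wf_gtrs_def)

lemma A0_carrier [simp]: "A\<^sub>0 P \<in> carrier_mat n n" and A1_carrier [simp]: "A\<^sub>1 P \<in> carrier_mat n n"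
  using sym0 sym1 by (auto simp: sym_mat_def)

lemma symA: "sym_mat n (A_at P g)"
  unfolding A_at_def by (intro sym_mat_add sym_mat_smult sym0 sym1)

lemma A_carrier [simp]: "A_at P g \<in> carrier_mat n n"
  using symA by (simp add: sym_mat_def)

lemma b_carrier [simp]: "b_at P g \<in> carrier_vec n"
  by (simp add: b_at_def)

lemma mult_carrier [simp]:
  "x \<in> carrier_vec n \<Longrightarrow> A\<^sub>0 P *\<^sub>v x \<in> carrier_vec n"
  "x \<in> carrier_vec n \<Longrightarrow> A\<^sub>1 P *\<^sub>v x \<in> carrier_vec n"
  "x \<in> carrier_vec n \<Longrightarrow> A_at P g *\<^sub>v x \<in> carrier_vec n"
  by (simp_all add: mult_mat_vec_carrier[of _ n n])

lemma n_pos: "0 < n"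
proof (rule ccontr)
  assume "\<not> 0 < n"
  then have n: "n = 0" by simp
  obtain v :: "real vec" where v: "v \<in> carrier_vec n" "v \<noteq> 0\<^sub>v n"
    using neg0 A0_carrier by (auto simp: eigenvalue_def eigenvector_def)
  have "v = 0\<^sub>v n" by (rule eq_vecI) (use v(1) n in simp_all)
  then show False using v(2) by simp
qed

lemma A_at_mult: "x \<in> carrier_vec n \<Longrightarrow> A_at P g *\<^sub>v x = A\<^sub>0 P *\<^sub>v x + g \<cdot>\<^sub>v (A\<^sub>1 P *\<^sub>v x)"
  by (simp add: A_at_def add_mult_distrib_mat_vec[of _ n n] smult_mat_mult_vec[of _ n n])

lemma A_at_form:
  "x \<in> carrier_vec n \<Longrightarrow> y \<in> carrier_vec n \<Longrightarrow>
    x \<bullet> (A_at P g *\<^sub>v y) = x \<bullet> (A\<^sub>0 P *\<^sub>v y) + g * (x \<bullet> (A\<^sub>1 P *\<^sub>v y))"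
  by (simp add: A_at_mult scalar_prod_add_distrib[of _ n])

lemma q1_quad: "q\<^sub>1 P = quad (A\<^sub>1 P) (b\<^sub>1 P) (c\<^sub>1 P)"
  by (simp add: q\<^sub>1_def quad_def fun_eq_iff)

lemma q_at_quad:
  "x \<in> carrier_vec n \<Longrightarrow> q_at P g x = quad (A_at P g) (b_at P g) (c\<^sub>0 P + g * c\<^sub>1 P) x"
  by (simp add: q_at_def q\<^sub>0_def q\<^sub>1_def quad_def A_at_form b_at_def add_scalar_prod_distrib[of _ n] algebra_simps)

lemma q_at_diff: "q_at P g x = q_at P g' x + (g - g') * q\<^sub>1 P x"
  by (simp add: q_at_def algebra_simps)

lemma A_vnorm_le:
  assumes "x \<in> carrier_vec n"
  shows "vnorm (A\<^sub>0 P *\<^sub>v x) \<le> vnorm x" "vnorm (A\<^sub>1 P *\<^sub>v x) \<le> vnorm x"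
  using vnorm_mult_mat_vec_le[OF A0_carrier assms] vnorm_mult_mat_vec_le[OF A1_carrier assms]
    mult_right_mono[OF nA0 vnorm_nonneg[of x]] mult_right_mono[OF nA1 vnorm_nonneg[of x]] by auto

lemma A1_form_le:
  assumes "x \<in> carrier_vec n" "y \<in> carrier_vec n"
  shows "\<bar>x \<bullet> (A\<^sub>1 P *\<^sub>v y)\<bar> \<le> vnorm x * vnorm y"
  using abs_scalar_prod_le[of x n "A\<^sub>1 P *\<^sub>v y"] mult_left_mono[OF A_vnorm_le(2)[OF assms(2)], of "vnorm x"] assms
  by auto

section \<open>Regularity of \<mu> as a function of the multiplier\<close>

lemma le_mu_iff: "m \<le> \<mu> g \<longleftrightarrow> (\<forall>x\<in>carrier_vec n. m * (x \<bullet> x) \<le> x \<bullet> (A_at P g *\<^sub>v x))"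
  unfolding mu_at_def by (rule le_lambda_min_iff[OF symA n_pos])

lemma mu_form_le: "x \<in> carrier_vec n \<Longrightarrow> \<mu> g * (x \<bullet> x) \<le> x \<bullet> (A_at P g *\<^sub>v x)"
  unfolding mu_at_def by (rule lambda_min_form_le[OF symA])

lemma mu_le_unit: "v \<in> carrier_vec n \<Longrightarrow> vnorm v = 1 \<Longrightarrow> \<mu> g \<le> v \<bullet> (A_at P g *\<^sub>v v)"
  unfolding mu_at_def by (rule lambda_min_le_unit[OF symA])

text \<open>As the norm of \<open>A\<^sub>1 P\<close> is at most 1, a shift of \<gamma> by h moves
  the form by at most |h| |x|^2. This Lipschitz constant 1 is what makes the shifts by m / 4 in the
  algorithm safe.\<close>

lemma mu_lower: "\<mu> g - \<bar>g - g'\<bar> \<le> \<mu> g'"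
  unfolding le_mu_iff
proof
  fix x :: "real vec" assume x: "x \<in> carrier_vec n"
  have "\<bar>(g' - g) * (x \<bullet> (A\<^sub>1 P *\<^sub>v x))\<bar> \<le> \<bar>g' - g\<bar> * (x \<bullet> x)"
    using A1_form_le[OF x x] by (simp add: abs_mult vnorm_power2[symmetric] power2_eq_square mult_left_mono)
  then show "(\<mu> g - \<bar>g - g'\<bar>) * (x \<bullet> x) \<le> x \<bullet> (A_at P g' *\<^sub>v x)"
    using mu_form_le[OF x, of g] x by (simp add: A_at_form algebra_simps abs_minus_commute)
qed

lemma mu_lipschitz: "\<bar>\<mu> g - \<mu> g'\<bar> \<le> \<bar>g - g'\<bar>"
  using mu_lower[of g g'] mu_lower[of g' g] by (simp add: abs_le_iff abs_minus_commute)

lemma mu_continuous: "continuous_on S \<mu>"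
  by (rule lipschitz_on_continuous_on[of 1]) (auto intro!: lipschitz_onI simp: dist_real_def mu_lipschitz)

text \<open>A minimum of functions affine in \<gamma>, one for each unit vector, is concave.\<close>

lemma mu_concave:
  assumes "0 \<le> u" "0 \<le> v" "u + v = 1"
  shows "u * \<mu> a + v * \<mu> b \<le> \<mu> (u * a + v * b)"
  unfolding le_mu_iff
proof
  fix x :: "real vec" assume x: "x \<in> carrier_vec n"
  have "u * (\<mu> a * (x \<bullet> x)) + v * (\<mu> b * (x \<bullet> x)) \<le> u * (x \<bullet> (A_at P a *\<^sub>v x)) + v * (x \<bullet> (A_at P b *\<^sub>v x))"
    using mu_form_le[OF x] assms by (intro add_mono mult_left_mono) auto
  also have "\<dots> = (u + v) * (x \<bullet> (A\<^sub>0 P *\<^sub>v x)) + (u * a + v * b) * (x \<bullet> (A\<^sub>1 P *\<^sub>v x))"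
    using x by (simp add: A_at_form algebra_simps)
  finally show "(u * \<mu> a + v * \<mu> b) * (x \<bullet> x) \<le> x \<bullet> (A_at P (u * a + v * b) *\<^sub>v x)"
    using x assms by (simp add: A_at_form algebra_simps)
qed

text \<open>Both weights are strictly positive, so that positivity of \<mu> at one end and
  nonnegativity at the other give positivity inside.\<close>

lemma mu_between:
  assumes "a < g" "g < b"
  obtains u v where "0 < u" "0 < v" "u + v = 1" "u * \<mu> a + v * \<mu> b \<le> \<mu> g"
proof
  let ?u = "(b - g) / (b - a)" and ?v = "(g - a) / (b - a)"
  show "0 < ?u" "0 < ?v" using assms by auto
  show 1: "?u + ?v = 1" using assms by (simp add: field_simps add_divide_distrib[symmetric])
  have "?u * a + ?v * b = ((b - g) * a + (g - a) * b) / (b - a)"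
    by (simp add: add_divide_distrib)
  also have "(b - g) * a + (g - a) * b = g * (b - a)" by (simp add: algebra_simps)
  also have "g * (b - a) / (b - a) = g" using assms by simp
  finally show "?u * \<mu> a + ?v * \<mu> b \<le> \<mu> g"
    using mu_concave[of ?u ?v a b] 1 assms by simp
qed

lemma mu_quasiconcave:
  assumes "a \<le> g" "g \<le> b" shows "min (\<mu> a) (\<mu> b) \<le> \<mu> g"
proof (cases "a = g \<or> g = b")
  case False
  then obtain u v where uv: "0 < u" "0 < v" "u + v = 1" "u * \<mu> a + v * \<mu> b \<le> \<mu> g"
    using mu_between[of a g b] assms by (metis less_le)
  have "u * min (\<mu> a) (\<mu> b) + v * min (\<mu> a) (\<mu> b) \<le> u * \<mu> a + v * \<mu> b"
    using uv by (intro add_mono mult_left_mono) auto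
  then show ?thesis using uv by (simp add: distrib_right[symmetric])
qed auto

section \<open>The range of the multipliers\<close>

lemma negative_direction:
  assumes "\<exists>l<0. eigenvalue A l" "A \<in> carrier_mat n n"
  obtains v l where "v \<in> carrier_vec n" "vnorm v = 1" "l < 0" "v \<bullet> (A *\<^sub>v v) = l"
proof -
  obtain l v where l: "l < 0" and v: "v \<in> carrier_vec n" "v \<noteq> 0\<^sub>v n" "A *\<^sub>v v = l \<cdot>\<^sub>v v"
    using assms by (auto simp: eigenvalue_def eigenvector_def)
  have pos: "0 < vnorm v" using v vnorm_eq_0_iff[OF v(1)] by (simp add: less_le)
  let ?v = "(1 / vnorm v) \<cdot>\<^sub>v v"
  have 1: "?v \<bullet> (A *\<^sub>v ?v) = l"
    using quad_form_smult[OF assms(2) v(1)] v pos by (simp add: vnorm_power2[symmetric] field_simps)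
  show thesis
    by (rule that[of ?v l]) (use v pos l 1 in \<open>auto simp: vnorm_smult\<close>)
qed

lemma mu_0_neg: "\<mu> 0 < 0"
proof -
  obtain v l where "v \<in> carrier_vec n" "vnorm v = 1" "l < 0" "v \<bullet> (A\<^sub>0 P *\<^sub>v v) = l"
    using negative_direction[OF neg0 A0_carrier] by blast
  then show ?thesis using mu_le_unit[of v 0] by (simp add: A_at_form)
qed

lemma Gam_eq: "Gam P = {g. 0 \<le> g \<and> 0 \<le> \<mu> g}"
proof -
  have "x \<bullet> (0\<^sub>m n n *\<^sub>v x) = 0" if "x \<in> carrier_vec n" for x :: "real vec"
  proof -
    have "0\<^sub>m n n *\<^sub>v x = 0\<^sub>v n" using that by (intro eq_vecI) auto
    then show ?thesis using that by simp
  qed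
  then show ?thesis
    by (auto simp: Gam_def loewner_le_iff[of _ n] le_mu_iff)
qed

text \<open>Along a direction in which \<open>A\<^sub>1 P\<close> is negative, the form of
  A(\<gamma>) becomes negative for large \<gamma>. The bound gives \<open>gamma_plus\<close> its
  meaning: a real \<open>Sup\<close> is an upper bound of a set that is bounded above.\<close>

lemma Gam_bdd: "bdd_above (Gam P)"
proof -
  obtain v l where v: "v \<in> carrier_vec n" "vnorm v = 1" and l: "l < 0" "v \<bullet> (A\<^sub>1 P *\<^sub>v v) = l"
    using negative_direction[OF neg1 A1_carrier] by blast
  have "g \<le> (v \<bullet> (A\<^sub>0 P *\<^sub>v v)) / (- l)" if "0 \<le> \<mu> g" for g
    using mu_le_unit[OF v, of g] that l v by (simp add: A_at_form field_simps)
  then show ?thesis by (auto simp: bdd_above_def Gam_eq)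
qed

lemma le_zeta: "0 \<le> g \<Longrightarrow> 0 \<le> \<mu> g \<Longrightarrow> g \<le> \<zeta>"
  using cSup_upper[OF _ Gam_bdd, of g] gp by (auto simp: Gam_eq gamma_plus_def)

text \<open>If h = \<open>\<mu> \<zeta>\<close> were positive, the Lipschitz bound would keep \<mu>
  nonnegative up to \<zeta> + h, beyond \<open>gamma_plus\<close>.\<close>

lemma mu_zeta: "\<mu> \<zeta> \<le> 0"
proof (rule ccontr)
  assume "\<not> \<mu> \<zeta> \<le> 0"
  moreover define h where "h = \<mu> \<zeta>"
  ultimately have h: "0 < h" by simp
  then have "0 \<le> \<mu> (\<zeta> + h)" using mu_lower[of \<zeta> "\<zeta> + h"] by (simp add: h_def[symmetric])
  then show False using le_zeta[of "\<zeta> + h"] h zeta1 by linarith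
qed

lemma mu_gh: "\<xi> \<le> \<mu> \<gamma>h"
  using gh_pd unfolding loewner_le_lambda_min[OF symA n_pos] mu_at_def .

lemma gh_le_zeta: "\<gamma>h \<le> \<zeta>"
  using le_zeta[OF gh0] mu_gh xi0 by simp

text \<open>The Lipschitz bound between \<open>\<gamma>h\<close> and 0, where \<mu> is negative,
  gives \<open>\<xi> < \<gamma>h\<close>; so the shifts made by CRMid stay among the nonnegative
  multipliers.\<close>

lemma mu_pos_range:
  assumes "0 \<le> \<mu> g" "\<bar>g - \<gamma>h\<bar> \<le> \<xi>" shows "0 \<le> g" "g \<le> \<zeta>"
proof -
  have "\<xi> < \<gamma>h" using mu_lower[of \<gamma>h 0] mu_0_neg mu_gh gh0 by simp
  then show "0 \<le> g" using assms by simp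
  then show "g \<le> \<zeta>" using le_zeta assms by simp
qed

lemma
  assumes "0 \<le> g" "g \<le> \<zeta>" "x \<in> carrier_vec n"
  shows A_at_vnorm_le: "vnorm (A_at P g *\<^sub>v x) \<le> 2 * \<zeta> * vnorm x"
    and A_at_form_le: "x \<bullet> (A_at P g *\<^sub>v x) \<le> 2 * \<zeta> * (x \<bullet> x)"
proof -
  have "vnorm (A_at P g *\<^sub>v x) \<le> vnorm (A\<^sub>0 P *\<^sub>v x) + g * vnorm (A\<^sub>1 P *\<^sub>v x)"
    using vnorm_triangle[of "A\<^sub>0 P *\<^sub>v x" n "g \<cdot>\<^sub>v (A\<^sub>1 P *\<^sub>v x)"] assms by (simp add: A_at_mult vnorm_smult)
  also have "\<dots> \<le> vnorm x + \<zeta> * vnorm x"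
    using A_vnorm_le[OF assms(3)] assms by (intro add_mono mult_mono) auto
  also have "\<dots> \<le> 2 * \<zeta> * vnorm x"
    using mult_right_mono[OF zeta1, of "vnorm x"] by simp
  finally show 1: "vnorm (A_at P g *\<^sub>v x) \<le> 2 * \<zeta> * vnorm x" .
  have "x \<bullet> (A_at P g *\<^sub>v x) \<le> vnorm x * vnorm (A_at P g *\<^sub>v x)"
    using abs_scalar_prod_le[of x n "A_at P g *\<^sub>v x"] assms by simp
  also have "\<dots> \<le> vnorm x * (2 * \<zeta> * vnorm x)"
    using 1 by (intro mult_left_mono) auto
  finally show "x \<bullet> (A_at P g *\<^sub>v x) \<le> 2 * \<zeta> * (x \<bullet> x)"
    by (simp add: vnorm_power2[symmetric] power2_eq_square algebra_simps)
qed

lemma spectral_norm_A_at: "0 \<le> g \<Longrightarrow> g \<le> \<zeta> \<Longrightarrow> spectral_norm (A_at P g) \<le> 2 * \<zeta>"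
  using zeta1 by (intro spectral_norm_le[OF A_carrier] A_at_vnorm_le) auto

lemma b_at_vnorm_le: "0 \<le> g \<Longrightarrow> g \<le> \<zeta> \<Longrightarrow> vnorm (b_at P g) \<le> 2 * \<zeta>"
  using vnorm_triangle[of "b\<^sub>0 P" n "g \<cdot>\<^sub>v b\<^sub>1 P"] nb0 mult_mono[of g \<zeta> "vnorm (b\<^sub>1 P)" 1] nb1 zeta1
  by (simp add: b_at_def vnorm_smult)

lemma A_at_le_scalar: "0 \<le> g \<Longrightarrow> g \<le> \<zeta> \<Longrightarrow> A_at P g \<preceq>\<^sub>L (2 * \<zeta>) \<cdot>\<^sub>m 1\<^sub>m n"
  by (simp add: loewner_le_iff[of _ n] scalar_mat_quad_form A_at_form_le)

lemma scalar_le_A_at: "m \<le> \<mu> g \<longleftrightarrow> m \<cdot>\<^sub>m 1\<^sub>m n \<preceq>\<^sub>L A_at P g"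
  unfolding loewner_le_lambda_min[OF symA n_pos] mu_at_def ..

section \<open>Minimizers of q(\<gamma>, .) where \<mu> is positive\<close>

definition xsol :: "real \<Rightarrow> real vec" where
  "xsol g = - (mat_inv (A_at P g) *\<^sub>v b_at P g)"

lemma
  assumes "0 < \<mu> g"
  shows xsol_carrier: "xsol g \<in> carrier_vec n"
    and xsol_stationary: "A_at P g *\<^sub>v xsol g + b_at P g = 0\<^sub>v n"
    and mat_inv_mult_carrier: "mat_inv (A_at P g) *\<^sub>v b_at P g \<in> carrier_vec n"
proof -
  have inj: "x = 0\<^sub>v n" if "x \<in> carrier_vec n" "A_at P g *\<^sub>v x = 0\<^sub>v n" for x
  proof -
    have "\<mu> g * (x \<bullet> x) \<le> 0" using mu_form_le[OF that(1), of g] that by simp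
    then have "vnorm x = 0"
      using assms by (simp add: vnorm_power2[symmetric] mult_le_0_iff)
    then show ?thesis using that by (simp add: vnorm_eq_0_iff)
  qed
  note B = mat_inv_if_injective[OF A_carrier inj]
  show c: "mat_inv (A_at P g) *\<^sub>v b_at P g \<in> carrier_vec n"
    using B by (simp add: mult_mat_vec_carrier[of _ n n])
  then show "xsol g \<in> carrier_vec n" by (simp add: xsol_def)
  have "A_at P g *\<^sub>v (mat_inv (A_at P g) *\<^sub>v b_at P g) = b_at P g"
    using B by (simp add: assoc_mult_mat_vec[symmetric, of _ n n _ n])
  moreover have "A_at P g *\<^sub>v (- (mat_inv (A_at P g) *\<^sub>v b_at P g)) = - (A_at P g *\<^sub>v (mat_inv (A_at P g) *\<^sub>v b_at P g))"
    by (rule mult_mat_vec_uminus[OF A_carrier c])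
  ultimately show "A_at P g *\<^sub>v xsol g + b_at P g = 0\<^sub>v n"
    by (simp add: xsol_def)
qed

lemma mu_nonneg_form: "0 \<le> \<mu> g \<Longrightarrow> x \<in> carrier_vec n \<Longrightarrow> 0 \<le> x \<bullet> (A_at P g *\<^sub>v x)"
  using le_mu_iff[of 0 g] by simp

lemma q_at_xsol_add:
  assumes "0 < \<mu> g" "e \<in> carrier_vec n"
  shows "q_at P g (xsol g + e) = q_at P g (xsol g) + e \<bullet> (A_at P g *\<^sub>v e)"
  using quad_add[OF symA b_carrier xsol_carrier[OF assms(1)] assms(2), of g]
    xsol_carrier[OF assms(1)] assms by (simp add: q_at_quad xsol_stationary)

lemma q_at_xsol_le:
  assumes "0 < \<mu> g" "x \<in> carrier_vec n"
  shows "q_at P g (xsol g) \<le> q_at P g x"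
  using assms xsol_carrier[OF assms(1)] mu_nonneg_form[of g]
  by (simp add: q_at_quad quad_stationary_le[OF symA] xsol_stationary)

text \<open>Testing the stationarity equation against x = x(g) itself gives m |x|^2 \<le> - x
  \<bullet> b(g) \<le> 2 \<zeta> |x|.\<close>

lemma xsol_vnorm_le:
  assumes "0 < m" "m \<le> \<mu> g" "0 \<le> g" "g \<le> \<zeta>"
  shows "vnorm (xsol g) \<le> 2 * \<zeta> / m"
proof -
  let ?x = "xsol g"
  have pos: "0 < \<mu> g" using assms by simp
  note x = xsol_carrier[OF pos]
  have "m * (vnorm ?x)\<^sup>2 \<le> \<mu> g * (vnorm ?x)\<^sup>2" using assms by (intro mult_right_mono) auto
  also have "\<dots> \<le> ?x \<bullet> (A_at P g *\<^sub>v ?x)" using mu_form_le[OF x, of g] by (simp add: vnorm_power2)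
  also have "\<dots> = - (?x \<bullet> b_at P g)"
  proof -
    have "?x \<bullet> (A_at P g *\<^sub>v ?x + b_at P g) = 0" using x pos by (simp add: xsol_stationary)
    then show ?thesis using x by (simp add: scalar_prod_add_distrib[of _ n])
  qed
  also have "\<dots> \<le> vnorm ?x * vnorm (b_at P g)"
    using abs_scalar_prod_le[OF x b_carrier, of g] by simp
  also have "\<dots> \<le> vnorm ?x * (2 * \<zeta>)"
    using b_at_vnorm_le assms by (intro mult_left_mono) auto
  finally have "vnorm ?x * (m * vnorm ?x) \<le> vnorm ?x * (2 * \<zeta>)"
    by (simp add: power2_eq_square algebra_simps)
  then have "m * vnorm ?x \<le> 2 * \<zeta>"
    using zeta1 assms by (cases "vnorm ?x = 0") (auto simp: less_le mult_le_cancel_left)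
  then show ?thesis using assms by (simp add: field_simps)
qed

section \<open>The dual function and its maximizers\<close>

definition nu :: "real \<Rightarrow> real" where "nu g = q\<^sub>1 P (xsol g)"

lemma dual_le: "x \<in> carrier_vec n \<Longrightarrow> dual P g \<le> ereal (q_at P g x)"
  unfolding dual_def by (rule INF_lower)

lemma le_dual_iff: "ereal c \<le> dual P g \<longleftrightarrow> (\<forall>x\<in>carrier_vec n. c \<le> q_at P g x)"
  unfolding dual_def by (simp add: le_INF_iff)

lemma dual_eq_minimizer:
  assumes "x \<in> carrier_vec n" "\<And>y. y \<in> carrier_vec n \<Longrightarrow> q_at P g x \<le> q_at P g y"
  shows "dual P g = ereal (q_at P g x)"
  using dual_le[OF assms(1)] assms(2) by (intro antisym) (auto simp: le_dual_iff)

lemma dual_eq_xsol: "0 < \<mu> g \<Longrightarrow> dual P g = ereal (q_at P g (xsol g))"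
  by (intro dual_eq_minimizer xsol_carrier q_at_xsol_le)

text \<open>Along an eigenvector for a negative \<open>\<mu> g\<close> the function q(g, .) tends to
  minus infinity, so it has no finite lower bound.\<close>

lemma dual_finite_imp_mu_nonneg:
  assumes "ereal c \<le> dual P g"
  shows "0 \<le> \<mu> g"
proof (rule ccontr)
  assume "\<not> 0 \<le> \<mu> g"
  then have neg: "\<mu> g < 0" by simp
  obtain v where v: "v \<in> carrier_vec n" "vnorm v = 1" "A_at P g *\<^sub>v v = \<mu> g \<cdot>\<^sub>v v"
    using lambda_min_exists[OF symA n_pos] unfolding mu_at_def by metis
  have vv: "v \<bullet> v = 1" using v(2) vnorm_power2[of v] by simp
  define c' where "c' = c\<^sub>0 P + g * c\<^sub>1 P"
  have "c \<le> q_at P g (t \<cdot>\<^sub>v v)" for t using assms v by (simp add: le_dual_iff)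
  then have ge: "c \<le> t\<^sup>2 * \<mu> g + 2 * t * (b_at P g \<bullet> v) + c'" for t
    using v vv by (simp add: q_at_quad quad_def mult_mat_vec[of _ n n] power2_eq_square c'_def mult.assoc mult.left_commute mult.commute[of "\<mu> g"])
  \<comment> \<open>The quadratic term becomes \<open>- (\<bar>c' - c\<bar> + 1)\<close>; using both
    \<open>t\<close> and \<open>- t\<close> cancels the linear term.\<close>
  define t where "t = sqrt ((\<bar>c' - c\<bar> + 1) / (- \<mu> g))"
  have "t\<^sup>2 = (\<bar>c' - c\<bar> + 1) / (- \<mu> g)" using neg by (simp add: t_def divide_nonneg_neg)
  then have "t\<^sup>2 * \<mu> g = - (\<bar>c' - c\<bar> + 1)" using neg by (simp add: field_simps)
  then show False using ge[of t] ge[of "- t"] by simp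
qed

lemma dual_maximizer_mu_nonneg:
  assumes "dual_maximizer P g" shows "0 \<le> \<mu> g"
proof (rule dual_finite_imp_mu_nonneg)
  have "0 < \<mu> \<gamma>h" using mu_gh xi0 by simp
  then show "ereal (q_at P \<gamma>h (xsol \<gamma>h)) \<le> dual P g"
    using assms gh0 dual_eq_xsol[of \<gamma>h] by (metis dual_maximizer_def)
qed

text \<open>For fixed x, q(\<gamma>, x) is affine in \<gamma>, so a lower bound along a convergent
  sequence of multipliers passes to the limit for each x separately. This is upper semicontinuity of
  the dual function. Maximizing sequences stay in the compact interval [0, \<zeta>], because finite
  dual values require \<mu> \<ge> 0.\<close>

lemma dual_maximizer_exists: "\<exists>g. dual_maximizer P g"
proof -
  define S where "S = {c. \<exists>g\<ge>0. ereal c \<le> dual P g}"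
  have "0 < \<mu> \<gamma>h" using mu_gh xi0 by simp
  then have "q_at P \<gamma>h (xsol \<gamma>h) \<in> S" using gh0 by (auto simp: S_def dual_eq_xsol)
  then have ne: "S \<noteq> {}" by auto
  \<comment> \<open>Testing with x = 0 bounds all finite dual values, so their supremum is a real
    number.\<close>
  have c0: "c \<le> 1 + \<zeta>" if g: "0 \<le> g" and c: "ereal c \<le> dual P g" for g c
  proof -
    have z: "g \<le> \<zeta>" using le_zeta g dual_finite_imp_mu_nonneg[OF c] by simp
    have "c \<le> q_at P g (0\<^sub>v n)" using c by (simp add: le_dual_iff)
    also have "\<dots> = c\<^sub>0 P + g * c\<^sub>1 P" by (simp add: q_at_quad quad_def)
    also have "\<dots> \<le> 1 + \<zeta> * 1" using nc0 nc1 g z zeta1 mult_mono[of g \<zeta> "\<bar>c\<^sub>1 P\<bar>" 1]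
      mult_left_mono[OF abs_ge_self[of "c\<^sub>1 P"], of g] by linarith
    finally show ?thesis by simp
  qed
  then have bdd: "bdd_above S" by (auto simp: bdd_above_def S_def)
  define r where "r = Sup S"
  have "\<exists>g. 0 \<le> g \<and> ereal (r - 1 / real (Suc k)) \<le> dual P g" for k
  proof -
    obtain c where "c \<in> S" "r - 1 / real (Suc k) < c"
      using less_cSupD[OF ne, of "r - 1 / real (Suc k)"] by (auto simp: r_def)
    then obtain g where "0 \<le> g" "ereal c \<le> dual P g" by (auto simp: S_def)
    moreover have "ereal (r - 1 / real (Suc k)) \<le> ereal c" using \<open>r - 1 / real (Suc k) < c\<close> by simp
    ultimately show ?thesis using order_trans by blast
  qed
  then obtain gs where gs: "\<And>k. 0 \<le> gs k" "\<And>k. ereal (r - 1 / real (Suc k)) \<le> dual P (gs k)"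
    by metis
  have "\<forall>k. gs k \<in> {0..\<zeta>}"
    using gs dual_finite_imp_mu_nonneg le_zeta by (metis atLeastAtMost_iff)
  moreover have "seq_compact {0..\<zeta>}" by (simp add: compact_imp_seq_compact)
  ultimately obtain l \<sigma> where l: "l \<in> {0..\<zeta>}" "strict_mono \<sigma>" "(gs \<circ> \<sigma>) \<longlonglongrightarrow> l"
    using seq_compactE by metis
  have "r \<le> q_at P l x" if x: "x \<in> carrier_vec n" for x
  proof (rule LIMSEQ_le)
    have "(\<lambda>k. r - 1 / real (Suc k)) \<longlonglongrightarrow> r - 0"
      by (intro tendsto_intros LIMSEQ_Suc lim_const_over_n)
    then show "(\<lambda>k. r - 1 / real (Suc (\<sigma> k))) \<longlonglongrightarrow> r"
      using LIMSEQ_subseq_LIMSEQ[OF _ l(2)] by (fastforce simp: o_def)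
    show "(\<lambda>k. q_at P (gs (\<sigma> k)) x) \<longlonglongrightarrow> q_at P l x"
      using l(3) unfolding q_at_def o_def by (intro tendsto_intros)
    show "\<exists>N. \<forall>k\<ge>N. r - 1 / real (Suc (\<sigma> k)) \<le> q_at P (gs (\<sigma> k)) x"
      using gs(2) x by (auto simp: le_dual_iff)
  qed
  then have rl: "ereal r \<le> dual P l" by (simp add: le_dual_iff)
  have "dual P g \<le> dual P l" if g: "0 \<le> g" for g
  proof (cases "dual P g")
    case (real c)
    then have "c \<in> S" using g by (auto simp: S_def)
    then have "c \<le> r" unfolding r_def by (rule cSup_upper[OF _ bdd])
    then show ?thesis using real rl by (metis ereal_less_eq(3) order_trans)
  next
    case PInf
    then show ?thesis using dual_le[of "0\<^sub>v n" g] by simp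
  qed simp
  then show ?thesis using l by (auto simp: dual_maximizer_def)
qed

text \<open>Two maximizers force the minimizer \<open>x\<close> at their midpoint to be stationary for \<open>q\<^sub>0\<close> and for
  \<open>q\<^sub>1\<close> with \<open>q\<^sub>1 x = 0\<close>, so that the dual function is constant on \<open>\<Gamma>\<close>.\<close>

lemma two_dual_maximizers:
  assumes g1: "dual_maximizer P g1" and g2: "dual_maximizer P g2" and lt: "g1 < g2"
    and g: "0 \<le> g" "0 \<le> \<mu> g"
  shows "dual_maximizer P g"
proof -
  define m where "m = (g1 + g2) / 2"
  have m: "g1 < m" "m < g2" "0 \<le> m" using lt g1 by (auto simp: m_def dual_maximizer_def)
  have mu12: "0 \<le> \<mu> g1" "0 \<le> \<mu> g2" using g1 g2 dual_maximizer_mu_nonneg by auto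
  have gh: "0 < \<mu> \<gamma>h" using mu_gh xi0 by simp
  \<comment> \<open>Unless \<open>m\<close> equals \<open>\<gamma>h\<close>, it lies strictly
    between \<open>\<gamma>h\<close> and one of the two maximizers, and concavity gives
    \<open>\<mu> \<gamma>h\<close> a positive weight.\<close>
  have mu: "0 < \<mu> m"
  proof (cases m \<gamma>h rule: linorder_cases)
    case equal then show ?thesis using gh by simp
  next
    case less
    obtain u v where "0 < u" "0 < v" "u * \<mu> g1 + v * \<mu> \<gamma>h \<le> \<mu> m"
      using mu_between[OF m(1) less] by metis
    then show ?thesis using gh mu12 by (smt (verit) mult_nonneg_nonneg mult_pos_pos)
  next
    case greater
    obtain u v where "0 < u" "0 < v" "u * \<mu> \<gamma>h + v * \<mu> g2 \<le> \<mu> m"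
      using mu_between[OF greater m(2)] by metis
    then show ?thesis using gh mu12 by (smt (verit) mult_nonneg_nonneg mult_pos_pos)
  qed
  let ?x = "xsol m"
  note x = xsol_carrier[OF mu]
  define D where "D = q_at P m ?x"
  have Dm: "dual P m = ereal D" using dual_eq_xsol[OF mu] by (simp add: D_def)
  have eq12: "dual P g1 = dual P g2" using g1 g2 by (auto simp: dual_maximizer_def intro: antisym)
  have ge: "ereal D \<le> dual P g1" using g1 m Dm by (metis dual_maximizer_def)
  obtain E where E: "dual P g1 = ereal E"
    using ge dual_le[OF x, of g1] by (cases "dual P g1") auto
  have E1: "E \<le> q_at P g1 y" and E2: "E \<le> q_at P g2 y" if "y \<in> carrier_vec n" for y
    using dual_le[OF that] E eq12 by (metis ereal_less_eq(3))+
  have DE: "D \<le> E" using ge E by simp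
  \<comment> \<open>The function is affine in the multiplier and \<open>m\<close> is the midpoint,
    so the two end values average to \<open>D\<close>. Each is at least \<open>E\<close>, and
    \<open>D \<le> E\<close>; hence all of them coincide.\<close>
  have avg: "q_at P g1 ?x + q_at P g2 ?x = 2 * D"
    by (simp add: D_def q_at_def m_def algebra_simps)
  have q12: "q_at P g1 ?x = E" "q_at P g2 ?x = E" "D = E"
    using avg DE E1[OF x] E2[OF x] by auto
  have q1: "q\<^sub>1 P ?x = 0"
    using q_at_diff[of g1 ?x g2] q12 lt by simp
  have st: "A_at P g' *\<^sub>v ?x + b_at P g' = 0\<^sub>v n" if "g' = g1 \<or> g' = g2" for g'
  proof (rule quad_minimizer_stationary[OF symA b_carrier x])
    fix y :: "real vec" assume y: "y \<in> carrier_vec n"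
    have "q_at P g' ?x \<le> q_at P g' y" using that q12 E1[OF y] E2[OF y] by auto
    then show "quad (A_at P g') (b_at P g') (c\<^sub>0 P + g' * c\<^sub>1 P) ?x
        \<le> quad (A_at P g') (b_at P g') (c\<^sub>0 P + g' * c\<^sub>1 P) y"
      using x y by (simp add: q_at_quad)
  qed
  define a where "a = A\<^sub>0 P *\<^sub>v ?x + b\<^sub>0 P"
  define b where "b = A\<^sub>1 P *\<^sub>v ?x + b\<^sub>1 P"
  have ab: "a \<in> carrier_vec n" "b \<in> carrier_vec n" using x by (auto simp: a_def b_def)
  have lin: "A_at P g' *\<^sub>v ?x + b_at P g' = a + g' \<cdot>\<^sub>v b" for g'
    unfolding A_at_mult[OF x] b_at_def a_def b_def by (rule add_smult_add[of _ n]) (use x in simp_all)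
  \<comment> \<open>Stationarity at two different multipliers separates the gradients of
    \<open>q\<^sub>0\<close> and \<open>q\<^sub>1\<close>.\<close>
  have "a $ i = 0 \<and> b $ i = 0" if i: "i < n" for i
  proof -
    have "(a + g' \<cdot>\<^sub>v b) $ i = 0" if "g' = g1 \<or> g' = g2" for g'
      using st[OF that] lin[of g'] i by simp
    then have e: "a $ i + g1 * b $ i = 0" "a $ i + g2 * b $ i = 0" using ab i by auto
    then have "(g2 - g1) * b $ i = 0" unfolding left_diff_distrib by linarith
    then show ?thesis using e lt by simp
  qed
  then have "a = 0\<^sub>v n" "b = 0\<^sub>v n" using ab by (auto intro!: eq_vecI)
  then have "A_at P g *\<^sub>v ?x + b_at P g = g \<cdot>\<^sub>v 0\<^sub>v n" using lin[of g] by simp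
  then have stg: "A_at P g *\<^sub>v ?x + b_at P g = 0\<^sub>v n" by auto
  have "dual P g = ereal (q_at P g ?x)"
    using x mu_nonneg_form[OF g(2)] stg
    by (intro dual_eq_minimizer) (auto simp: q_at_quad intro!: quad_stationary_le[OF symA])
  also have "q_at P g ?x = E" using q_at_diff[of g ?x g1] q1 q12 by simp
  finally show ?thesis using g1 E g by (simp add: dual_maximizer_def)
qed

text \<open>With several maximizers the dual function is maximal on all of \<Gamma>, which contains
  the point chosen by the definition. That \<open>LEAST\<close> names an actual point follows from
  compactness: \<Gamma> is compact and \<mu> continuous, so the maximizers of \<mu> on \<Gamma> form
  a compact set with a least element.\<close>

lemma gamma_star_maximizer: "dual_maximizer P (gamma_star P)"
proof (cases "\<exists>!g. dual_maximizer P g")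
  case True
  then show ?thesis using theI'[OF True] by (simp add: gamma_star_def)
next
  case False
  then obtain g1 g2 where g12: "dual_maximizer P g1" "dual_maximizer P g2" "g1 < g2"
    using dual_maximizer_exists by (metis linorder_neqE_linordered_idom)
  have Gam: "Gam P = {0..\<zeta>} \<inter> {g. 0 \<le> \<mu> g}" using le_zeta by (auto simp: Gam_eq)
  have cmp: "compact ({0..\<zeta>} \<inter> {g. c \<le> \<mu> g})" for c
    by (intro compact_Int_closed closed_Collect_le continuous_intros mu_continuous) auto
  have "\<gamma>h \<in> Gam P" using gh0 mu_gh xi0 by (simp add: Gam_eq)
  then obtain a where a: "a \<in> Gam P" "\<forall>g\<in>Gam P. \<mu> g \<le> \<mu> a"
    using continuous_attains_sup[of "Gam P" \<mu>] cmp[of 0] mu_continuous unfolding Gam by blast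
  have "\<exists>s\<in>{0..\<zeta>} \<inter> {g. \<mu> a \<le> \<mu> g}. \<forall>t\<in>{0..\<zeta>} \<inter> {g. \<mu> a \<le> \<mu> g}. s \<le> t"
    using a Gam by (intro compact_attains_inf cmp) auto
  then obtain s where s: "s \<in> {0..\<zeta>}" "\<mu> a \<le> \<mu> s"
    "\<And>t. t \<in> {0..\<zeta>} \<Longrightarrow> \<mu> a \<le> \<mu> t \<Longrightarrow> s \<le> t" by auto
  have sG: "s \<in> Gam P" using s a Gam by auto
  have "gamma_star P = s"
    unfolding gamma_star_def if_not_P[OF False]
  proof (rule Least_equality)
    show "s \<in> Gam P \<and> (\<forall>g'\<in>Gam P. \<mu> g' \<le> \<mu> s)" using sG a s by force
    show "s \<le> y" if "y \<in> Gam P \<and> (\<forall>g'\<in>Gam P. \<mu> g' \<le> \<mu> y)" for y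
      using that a s(3)[of y] Gam by auto
  qed
  then show ?thesis using two_dual_maximizers[OF g12] sG by (simp add: Gam_eq)
qed

text \<open>The two ends of the chain q(g, x(g)) = d(g) \<le> d(\<open>gamma_star P\<close>) \<le>
  q(\<open>gamma_star P\<close>, x(g)) differ by exactly this product.\<close>

lemma gamma_star_side:
  assumes g: "0 \<le> g" "0 < \<mu> g" shows "0 \<le> (gamma_star P - g) * nu g"
proof -
  have "ereal (q_at P g (xsol g)) \<le> dual P (gamma_star P)"
    using gamma_star_maximizer g dual_eq_xsol[OF g(2)] by (metis dual_maximizer_def)
  also have "\<dots> \<le> ereal (q_at P (gamma_star P) (xsol g))"
    by (rule dual_le[OF xsol_carrier[OF g(2)]])
  finally show ?thesis using q_at_diff[of "gamma_star P" "xsol g" g] by (simp add: nu_def)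
qed

end

section \<open>Approximate optimizers\<close>

lemma quadratic_pos_root:
  fixes a b c :: real
  assumes "0 < a" "c < 0"
  obtains r where "0 < r" "a * r\<^sup>2 + 2 * b * r + c = 0"
proof
  define s where "s = sqrt (b\<^sup>2 - a * c)"
  have ac: "0 < - (a * c)" using assms by (simp add: mult_less_0_iff)
  have s2: "s\<^sup>2 = b\<^sup>2 - a * c" using ac zero_le_power2[of b] unfolding s_def by (intro real_sqrt_pow2) linarith
  have "\<bar>b\<bar> < s" unfolding s_def using ac by (intro real_less_rsqrt) simp
  then show "0 < (s - b) / a" using assms by simp
  have "a * ((s - b) / a)\<^sup>2 + 2 * b * ((s - b) / a) + c = ((s - b)\<^sup>2 + 2 * b * (s - b) + a * c) / a"
    using assms by (simp add: field_simps power2_eq_square)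
  also have "(s - b)\<^sup>2 + 2 * b * (s - b) + a * c = 0"
    using s2 by (simp add: power2_eq_square algebra_simps)
  finally show "a * ((s - b) / a)\<^sup>2 + 2 * b * ((s - b) / a) + c = 0" by simp
qed

text \<open>For z = a r the equation gives z^2 \<le> 2 y z + y^2, hence z \<le> (1 + sqrt 2) y, and
  5/2 is a rational bound for the factor. The product a r is bounded rather than r, because a may be
  small; its lower bound is supplied by the caller.\<close>

lemma quadratic_root_le:
  fixes a b c r y :: real
  assumes a: "0 < a" "a \<le> 1" and r: "0 < r" "a * r\<^sup>2 + 2 * b * r + c = 0"
    and y: "0 < y" "\<bar>b\<bar> \<le> y" "\<bar>c\<bar> \<le> y\<^sup>2"
  shows "a * r \<le> 5 / 2 * y"
proof (rule ccontr)
  assume "\<not> a * r \<le> 5 / 2 * y"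
  then have z: "5 / 2 * y < a * r" by simp
  have "(a * r)\<^sup>2 = a * (a * r\<^sup>2)" by (simp add: power2_eq_square)
  also have "a * r\<^sup>2 = - 2 * b * r - c" using r by simp
  also have "a * (- 2 * b * r - c) = 2 * (- b) * (a * r) + a * (- c)" by (simp add: algebra_simps)
  also have "\<dots> \<le> 2 * y * (a * r) + 1 * y\<^sup>2"
  proof (intro add_mono)
    show "2 * (- b) * (a * r) \<le> 2 * y * (a * r)" using a r y by (intro mult_right_mono) auto
    have "a * (- c) \<le> a * \<bar>c\<bar>" using a by (intro mult_left_mono) auto
    also have "\<dots> \<le> 1 * y\<^sup>2" using a y by (intro mult_mono) auto
    finally show "a * (- c) \<le> 1 * y\<^sup>2" .
  qed
  finally have "(a * r) * (a * r - 2 * y) \<le> y * y" by (simp add: power2_eq_square algebra_simps)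
  moreover have "(5 / 2 * y) * (1 / 2 * y) < (a * r) * (a * r - 2 * y)"
    by (rule mult_strict_mono[of "5 / 2 * y" "a * r" "1 / 2 * y" "a * r - 2 * y"]) (use z y in auto)
  moreover have "y * y \<le> (5 / 2 * y) * (1 / 2 * y)" by simp
  ultimately show False by linarith
qed

locale gtrs_accuracy = gtrs_instance +
  fixes \<epsilon> :: real
  assumes eps0: "0 < \<epsilon>" and eps1: "\<epsilon> < 1"
begin

definition \<tau> where "\<tau> = \<epsilon> / (4 * \<zeta>)"

text \<open>Contract of a call of ApproxNu with accuracy \<tau> at level m, together with the range
  of g. The approximation arguments see the oracle only through it.\<close>

definition near_sol :: "real \<Rightarrow> real \<Rightarrow> real vec \<Rightarrow> bool" where
  "near_sol m g x \<longleftrightarrow> 0 < m \<and> m \<le> 1 \<and> m \<le> \<mu> g \<and> 0 \<le> g \<and> g \<le> \<zeta> \<and> x \<in> carrier_vec n \<and>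
     vnorm (x + mat_inv (A_at P g) *\<^sub>v b_at P g) \<le> m * \<tau> / (10 * \<zeta>)"

lemma tau_bounds: "0 < \<tau>" "\<tau> \<le> 1 / 4" "\<tau> \<le> \<epsilon> / 4" "\<zeta> * \<tau> = \<epsilon> / 4"
proof -
  show "0 < \<tau>" "\<zeta> * \<tau> = \<epsilon> / 4" using eps0 zeta1 by (auto simp: \<tau>_def)
  have "\<tau> \<le> \<epsilon> / (4 * 1)" unfolding \<tau>_def using eps0 zeta1 by (intro divide_left_mono) auto
  then show "\<tau> \<le> \<epsilon> / 4" "\<tau> \<le> 1 / 4" using eps1 by auto
qed

text \<open>The sharp bound on the error is meant for products with x(g), whose norm may reach 2
  \<zeta> / m; the coarse one suffices elsewhere.\<close>

lemma near_solE:
  assumes "near_sol m g x"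
  obtains e where "e \<in> carrier_vec n" "x = xsol g + e" "vnorm e \<le> m * \<tau> / (10 * \<zeta>)" "vnorm e \<le> \<tau> / 10"
proof
  let ?y = "mat_inv (A_at P g) *\<^sub>v b_at P g"
  have m: "0 < m" "m \<le> 1" "m \<le> \<mu> g" and x: "x \<in> carrier_vec n" using assms by (auto simp: near_sol_def)
  have y: "?y \<in> carrier_vec n" using m by (intro mat_inv_mult_carrier) auto
  show "x + ?y \<in> carrier_vec n" using x y by simp
  have "x = - y + (x + y)" if "y \<in> carrier_vec n" for y using x that by (intro eq_vecI) auto
  from this[OF y] show "x = xsol g + (x + ?y)" by (simp only: xsol_def)
  show le: "vnorm (x + ?y) \<le> m * \<tau> / (10 * \<zeta>)" using assms by (simp add: near_sol_def)
  have "m * \<tau> / (10 * \<zeta>) \<le> 1 * \<tau> / (10 * 1)"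
    using m zeta1 tau_bounds by (intro frac_le mult_mono) auto
  then show "vnorm (x + ?y) \<le> \<tau> / 10" using le by linarith
qed

text \<open>The factor m / (10 \<zeta>) in the accuracy compensates |x(g)| \<le> 2 \<zeta> / m in
  the linear error term; together with the quadratic term the error is at most 7/10 \<tau>.\<close>

lemma near_sol_q1:
  assumes "near_sol m g x" shows "\<bar>q\<^sub>1 P x - nu g\<bar> \<le> \<tau>"
proof -
  obtain e where e: "e \<in> carrier_vec n" "x = xsol g + e" and ve: "vnorm e \<le> m * \<tau> / (10 * \<zeta>)" "vnorm e \<le> \<tau> / 10"
    by (rule near_solE[OF assms])
  have m: "0 < m" "m \<le> 1" "m \<le> \<mu> g" "0 \<le> g" "g \<le> \<zeta>" using assms by (auto simp: near_sol_def)
  have xs: "xsol g \<in> carrier_vec n" using m by (intro xsol_carrier) auto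
  let ?h = "A\<^sub>1 P *\<^sub>v xsol g + b\<^sub>1 P"
  have h: "vnorm ?h \<le> 2 * \<zeta> / m + 1"
    using vnorm_triangle[of "A\<^sub>1 P *\<^sub>v xsol g" n "b\<^sub>1 P"] xs nb1 A_vnorm_le(2)[OF xs] xsol_vnorm_le[of m g] m by simp
  have "\<bar>e \<bullet> ?h\<bar> \<le> vnorm e * vnorm ?h" using e xs by (intro abs_scalar_prod_le[of _ n]) auto
  also have "\<dots> \<le> (m * \<tau> / (10 * \<zeta>)) * (2 * \<zeta> / m + 1)"
    using ve h m tau_bounds zeta1 by (intro mult_mono) auto
  also have "\<dots> = \<tau> / 5 + m * \<tau> / (10 * \<zeta>)" using m zeta1 by (simp add: field_simps)
  also have "\<dots> \<le> \<tau> / 5 + 1 * \<tau> / (10 * 1)"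
    using m zeta1 tau_bounds by (intro add_left_mono frac_le mult_mono) auto
  finally have 1: "\<bar>e \<bullet> ?h\<bar> \<le> 3 / 10 * \<tau>" by simp
  have "\<bar>e \<bullet> (A\<^sub>1 P *\<^sub>v e)\<bar> \<le> vnorm e * vnorm e" using A1_form_le[of e e] e by simp
  also have "\<dots> \<le> (\<tau> / 10) * 1" using ve tau_bounds by (intro mult_mono) auto
  finally have 2: "\<bar>e \<bullet> (A\<^sub>1 P *\<^sub>v e)\<bar> \<le> \<tau> / 10" by simp
  have "q\<^sub>1 P x - nu g = 2 * (e \<bullet> ?h) + e \<bullet> (A\<^sub>1 P *\<^sub>v e)"
    using quad_add[OF sym1 b1_carrier xs e(1)] by (simp add: q1_quad nu_def e)
  then show ?thesis using 1 2 tau_bounds by (auto simp: abs_le_iff)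
qed

text \<open>The gradient vanishes at the exact minimizer, so the error enters only
  quadratically.\<close>

lemma near_sol_q_at:
  assumes "near_sol m g x" "y \<in> carrier_vec n"
  shows "q_at P g x \<le> q_at P g y + \<epsilon> / 100"
proof -
  obtain e where e: "e \<in> carrier_vec n" "x = xsol g + e" and ve: "vnorm e \<le> m * \<tau> / (10 * \<zeta>)" "vnorm e \<le> \<tau> / 10"
    by (rule near_solE[OF assms(1)])
  have m: "0 < m" "m \<le> 1" "m \<le> \<mu> g" "0 \<le> g" "g \<le> \<zeta>" using assms by (auto simp: near_sol_def)
  have q: "q_at P g x = q_at P g (xsol g) + e \<bullet> (A_at P g *\<^sub>v e)"
    unfolding e using m e by (intro q_at_xsol_add) auto
  have y: "q_at P g (xsol g) \<le> q_at P g y" using m assms by (intro q_at_xsol_le) auto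
  have "e \<bullet> (A_at P g *\<^sub>v e) \<le> 2 * \<zeta> * (vnorm e * vnorm e)"
    using A_at_form_le[OF m(4,5) e(1)] by (simp add: vnorm_power2[symmetric] power2_eq_square)
  \<comment> \<open>One factor uses the sharp bound, which cancels \<zeta>; the other only
    \<open>\<tau> / 10\<close> with \<tau> \<le> 1/4.\<close>
  also have "\<dots> \<le> 2 * \<zeta> * ((m * \<tau> / (10 * \<zeta>)) * (1 / 40))"
    using ve m tau_bounds zeta1 by (intro mult_left_mono mult_mono) auto
  also have "\<dots> = m * \<tau> / 200" using zeta1 by simp
  also have "\<dots> \<le> 1 * \<tau> / 200" using m tau_bounds by (intro divide_right_mono mult_right_mono) auto
  also have "\<dots> \<le> \<epsilon> / 100" using tau_bounds eps0 by simp
  finally show ?thesis using q y by simp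
qed

lemma approx_optimizerI:
  assumes "x \<in> carrier_vec n" "q\<^sub>1 P x \<le> \<epsilon>"
    and "\<And>y. y \<in> carrier_vec n \<Longrightarrow> q\<^sub>1 P y \<le> 0 \<Longrightarrow> q\<^sub>0 P x \<le> q\<^sub>0 P y + \<epsilon>"
  shows "approx_optimizer P \<epsilon> x"
proof -
  have "ereal (q\<^sub>0 P x - \<epsilon>) \<le> Opt P"
    unfolding Opt_def using assms(3) by (auto intro!: INF_greatest simp: algebra_simps)
  then have "ereal (q\<^sub>0 P x - \<epsilon>) + ereal \<epsilon> \<le> Opt P + ereal \<epsilon>" by (rule add_right_mono)
  then show ?thesis using assms by (simp add: approx_optimizer_def)
qed

text \<open>Weak duality: the term g q1(y) is nonpositive for feasible y, so apart from the slack
  \<epsilon> / 100 only g |q1(x)| \<le> \<zeta> \<tau> = \<epsilon> / 4 is lost. This explains the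
  choice of \<tau>.\<close>

lemma near_sol_optimizer:
  assumes "near_sol m g x" "- \<tau> \<le> q\<^sub>1 P x" "q\<^sub>1 P x \<le> \<tau>"
  shows "approx_optimizer P \<epsilon> x"
proof (rule approx_optimizerI)
  have g: "0 \<le> g" "g \<le> \<zeta>" using assms by (auto simp: near_sol_def)
  show "x \<in> carrier_vec n" using assms by (simp add: near_sol_def)
  show "q\<^sub>1 P x \<le> \<epsilon>" using assms tau_bounds eps0 by linarith
  fix y assume y: "y \<in> carrier_vec n" "q\<^sub>1 P y \<le> 0"
  have "g * (- q\<^sub>1 P x) \<le> g * \<tau>" using assms g by (intro mult_left_mono) auto
  also have "\<dots> \<le> \<zeta> * \<tau>" using g tau_bounds by (intro mult_right_mono) auto
  finally have "g * (- q\<^sub>1 P x) \<le> \<epsilon> / 4" using tau_bounds by simp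
  moreover have "g * q\<^sub>1 P y \<le> 0" using g y by (simp add: mult_nonneg_nonpos)
  moreover have "q\<^sub>0 P x + g * q\<^sub>1 P x \<le> q\<^sub>0 P y + g * q\<^sub>1 P y + \<epsilon> / 100"
    using near_sol_q_at[OF assms(1) y(1)] by (simp add: q_at_def)
  ultimately show "q\<^sub>0 P x \<le> q\<^sub>0 P y + \<epsilon>" using eps0 by simp
qed

text \<open>q(\<open>\<gamma>h\<close>, x) is at least \<xi> |x|^2 - 4 \<zeta> |x| - 2 \<zeta>. If
  \<xi> |x| exceeded 5 \<zeta>, then |x| > 5 and this would be at least \<zeta> |x| - 2 \<zeta> > 3
  \<zeta>, too large.\<close>

lemma vnorm_le_if_q_at_gh_le:
  assumes x: "x \<in> carrier_vec n" and q: "q_at P \<gamma>h x \<le> 2 * \<zeta> + 1 / 100"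
  shows "vnorm x \<le> 5 * \<zeta> / \<xi>"
proof (rule ccontr)
  let ?X = "vnorm x"
  assume "\<not> ?thesis"
  then have big: "5 * \<zeta> < \<xi> * ?X" using xi0 by (simp add: field_simps)
  have "\<xi> * ?X \<le> 1 * ?X" using xi1 by (intro mult_right_mono) auto
  then have X5: "5 < ?X" using big zeta1 by linarith
  have "\<xi> * (x \<bullet> x) \<le> \<mu> \<gamma>h * (x \<bullet> x)"
    using mu_gh scalar_prod_self_nonneg by (intro mult_right_mono) auto
  also have "\<dots> \<le> x \<bullet> (A_at P \<gamma>h *\<^sub>v x)" by (rule mu_form_le[OF x])
  finally have 1: "\<xi> * (?X * ?X) \<le> x \<bullet> (A_at P \<gamma>h *\<^sub>v x)"
    by (simp add: vnorm_power2[symmetric] power2_eq_square)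
  have "\<bar>b_at P \<gamma>h \<bullet> x\<bar> \<le> vnorm (b_at P \<gamma>h) * ?X"
    using x by (intro abs_scalar_prod_le[of _ n]) auto
  also have "\<dots> \<le> 2 * \<zeta> * ?X"
    using b_at_vnorm_le[OF gh0 gh_le_zeta] by (intro mult_right_mono) auto
  finally have 2: "- (2 * \<zeta> * ?X) \<le> b_at P \<gamma>h \<bullet> x" by linarith
  have "\<bar>\<gamma>h * c\<^sub>1 P\<bar> \<le> \<zeta> * 1" unfolding abs_mult using gh0 gh_le_zeta nc1 zeta1 by (intro mult_mono) auto
  then have 3: "- (2 * \<zeta>) \<le> c\<^sub>0 P + \<gamma>h * c\<^sub>1 P" using nc0 zeta1 by linarith
  have "5 * \<zeta> * ?X \<le> \<xi> * ?X * ?X" using big by (intro mult_right_mono) auto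
  then have "\<zeta> * ?X \<le> 4 * \<zeta> + 1 / 100"
    using q 1 2 3 x by (simp add: q_at_quad quad_def algebra_simps)
  moreover have "\<zeta> * 5 \<le> \<zeta> * ?X" using X5 zeta1 by (intro mult_left_mono) auto
  ultimately show False using zeta1 by linarith
qed

text \<open>The sign \<open>\<sigma>\<close> is \<open>1\<close> for CRLeft and \<open>-1\<close> for CRRight. The norm of \<open>x\<close> is bounded independently of \<open>m\<close>
  because \<open>q(\<gamma>h, x) \<le> q(g, x)\<close>; this is what makes the correction \<open>\<alpha> w\<close> along the nearly
  singular direction cheap.\<close>

lemma not_regular_optimizer:
  assumes ns: "near_sol m' g x" and \<sigma>: "\<sigma> = 1 \<or> \<sigma> = -1"
    and q1x: "\<sigma> * q\<^sub>1 P x < 0" and side: "0 < \<sigma> * (\<gamma>h - g)"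
    and w: "w \<in> carrier_vec n" "vnorm w = 1" "w \<bullet> (A_at P g *\<^sub>v w) \<le> m"
    and m: "0 \<le> m" "m \<le> \<xi> / 2" "m \<le> \<epsilon> * \<xi> ^ 4 / (3200 * \<zeta> ^ 4)"
    and desc: "w \<bullet> (A_at P g *\<^sub>v x + b_at P g) \<le> 0"
    and \<alpha>: "\<alpha> = (SOME \<alpha>. 0 < \<alpha> \<and> q\<^sub>1 P (x + \<alpha> \<cdot>\<^sub>v w) = 0)"
  shows "approx_optimizer P \<epsilon> (x + \<alpha> \<cdot>\<^sub>v w)"
proof -
  have g: "0 \<le> g" "g \<le> \<zeta>" and x: "x \<in> carrier_vec n" using ns by (auto simp: near_sol_def)
  define a where "a = \<sigma> * (w \<bullet> (A\<^sub>1 P *\<^sub>v w))"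
  define b where "b = \<sigma> * (w \<bullet> (A\<^sub>1 P *\<^sub>v x + b\<^sub>1 P))"
  define c where "c = \<sigma> * q\<^sub>1 P x"
  have abs\<sigma>: "\<bar>\<sigma>\<bar> = 1" using \<sigma> by auto
  \<comment> \<open>The form of \<open>w\<close> is at least \<xi> at \<open>\<gamma>h\<close> and
    at most \<xi> / 2 at \<open>g\<close>. Being affine in the multiplier, it has a slope of known
    sign and of size at least \<xi> / (2 \<zeta>).\<close>
  have "\<xi> \<le> w \<bullet> (A_at P \<gamma>h *\<^sub>v w)" using mu_le_unit[of w \<gamma>h] mu_gh w by linarith
  then have "\<xi> / 2 \<le> (\<gamma>h - g) * (w \<bullet> (A\<^sub>1 P *\<^sub>v w))"
    using w m by (simp add: A_at_form algebra_simps)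
  also have "\<dots> = (\<sigma> * (\<gamma>h - g)) * a" using \<sigma> by (auto simp: a_def)
  finally have ge: "\<xi> / 2 \<le> (\<sigma> * (\<gamma>h - g)) * a" .
  have a0: "0 < a"
  proof (rule ccontr)
    assume "\<not> 0 < a"
    then have "(\<sigma> * (\<gamma>h - g)) * a \<le> 0" using side by (intro mult_nonneg_nonpos) auto
    then show False using ge xi0 by linarith
  qed
  have "\<sigma> * (\<gamma>h - g) \<le> \<zeta>" using \<sigma> g gh0 gh_le_zeta by auto
  then have "(\<sigma> * (\<gamma>h - g)) * a \<le> \<zeta> * a" using a0 by (intro mult_right_mono) auto
  then have a_ge: "\<xi> / 2 \<le> \<zeta> * a" using ge by simp
  have a1: "a \<le> 1"
    using A1_form_le[of w w] w \<sigma> by (auto simp: a_def abs_le_iff)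
  define X where "X = vnorm x"
  have "q_at P \<gamma>h x = q_at P g x + (\<sigma> * (\<gamma>h - g)) * (\<sigma> * q\<^sub>1 P x)"
    using q_at_diff[of \<gamma>h x g] \<sigma> by auto
  moreover have "(\<sigma> * (\<gamma>h - g)) * (\<sigma> * q\<^sub>1 P x) \<le> 0" by (rule mult_nonneg_nonpos) (use q1x side in auto)
  moreover have "q_at P g x \<le> q_at P g (0\<^sub>v n) + \<epsilon> / 100" by (rule near_sol_q_at[OF ns]) simp
  moreover have "q_at P g (0\<^sub>v n) = c\<^sub>0 P + g * c\<^sub>1 P" by (simp add: q_at_quad quad_def)
  moreover have "c\<^sub>0 P + g * c\<^sub>1 P \<le> 2 * \<zeta>"
  proof -
    have "\<bar>g * c\<^sub>1 P\<bar> \<le> \<zeta> * 1" unfolding abs_mult using g nc1 zeta1 by (intro mult_mono) auto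
    then show ?thesis using nc0 zeta1 by linarith
  qed
  ultimately have "X \<le> 5 * \<zeta> / \<xi>"
    unfolding X_def using eps1 by (intro vnorm_le_if_q_at_gh_le x) simp
  moreover have "1 \<le> \<zeta> / \<xi>" using xi0 xi1 zeta1 by (simp add: field_simps)
  ultimately have Y: "X + 1 \<le> 6 * \<zeta> / \<xi>" by simp
  have X0: "0 \<le> X" by (simp add: X_def)
  have h: "vnorm (A\<^sub>1 P *\<^sub>v x + b\<^sub>1 P) \<le> X + 1"
    using vnorm_triangle[of "A\<^sub>1 P *\<^sub>v x" n "b\<^sub>1 P"] A_vnorm_le(2)[OF x] nb1 x by (simp add: X_def)
  have "\<bar>w \<bullet> (A\<^sub>1 P *\<^sub>v x + b\<^sub>1 P)\<bar> \<le> X + 1"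
    using abs_scalar_prod_le[of w n "A\<^sub>1 P *\<^sub>v x + b\<^sub>1 P"] w x h by simp
  then have b: "\<bar>b\<bar> \<le> X + 1" using abs\<sigma> by (simp add: b_def abs_mult)
  have "\<bar>q\<^sub>1 P x\<bar> \<le> \<bar>x \<bullet> (A\<^sub>1 P *\<^sub>v x)\<bar> + 2 * \<bar>b\<^sub>1 P \<bullet> x\<bar> + \<bar>c\<^sub>1 P\<bar>"
    by (simp add: q\<^sub>1_def)
  also have "\<dots> \<le> X * X + 2 * (1 * X) + 1"
    using A1_form_le[OF x x] abs_scalar_prod_le[OF b1_carrier x] mult_right_mono[OF nb1 X0] nc1
    by (simp add: X_def)
  also have "\<dots> = (X + 1)\<^sup>2" by (simp add: power2_eq_square algebra_simps)
  finally have c: "\<bar>c\<bar> \<le> (X + 1)\<^sup>2" using abs\<sigma> by (simp add: c_def abs_mult)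
  have q1w: "\<sigma> * q\<^sub>1 P (x + t \<cdot>\<^sub>v w) = a * t\<^sup>2 + 2 * b * t + c" for t
    using quad_add_smult[OF sym1 b1_carrier x w(1), of "c\<^sub>1 P" t]
    by (simp add: q1_quad a_def b_def c_def algebra_simps)
  have q1w0: "q\<^sub>1 P (x + t \<cdot>\<^sub>v w) = 0 \<longleftrightarrow> a * t\<^sup>2 + 2 * b * t + c = 0" for t
    unfolding q1w[symmetric] using \<sigma> by auto
  \<comment> \<open>A negative value at 0 and a positive leading coefficient give a positive root.
    The estimate that follows holds for every positive root, so it applies to the one chosen by
    \<open>SOME\<close>.\<close>
  have "\<exists>t. 0 < t \<and> q\<^sub>1 P (x + t \<cdot>\<^sub>v w) = 0"
    unfolding q1w0 using quadratic_pos_root[of a c b] a0 q1x by (metis c_def)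
  then have "0 < \<alpha> \<and> q\<^sub>1 P (x + \<alpha> \<cdot>\<^sub>v w) = 0" unfolding \<alpha> by (rule someI_ex)
  then have \<alpha>': "0 < \<alpha>" "q\<^sub>1 P (x + \<alpha> \<cdot>\<^sub>v w) = 0" by auto
  have "a * \<alpha> \<le> 5 / 2 * (X + 1)"
    using a0 a1 \<alpha>' b c X0 by (intro quadratic_root_le[of _ _ b c]) (auto simp: q1w0)
  also have "\<dots> \<le> 5 / 2 * (6 * \<zeta> / \<xi>)" using Y by (intro mult_left_mono) auto
  finally have "a * \<alpha> \<le> 15 * \<zeta> / \<xi>" by simp
  then have "\<zeta> * (a * \<alpha>) \<le> \<zeta> * (15 * \<zeta> / \<xi>)"
    using zeta1 by (intro mult_left_mono) auto
  moreover have "\<xi> / 2 * \<alpha> \<le> \<zeta> * a * \<alpha>" using a_ge \<alpha>' by (intro mult_right_mono) auto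
  ultimately have "\<xi> / 2 * \<alpha> \<le> \<zeta> * (15 * \<zeta> / \<xi>)" unfolding mult.assoc by linarith
  then have "\<alpha> \<le> 30 * \<zeta>\<^sup>2 / \<xi>\<^sup>2" using xi0 by (simp add: field_simps power2_eq_square)
  then have "\<alpha>\<^sup>2 \<le> (30 * \<zeta>\<^sup>2 / \<xi>\<^sup>2)\<^sup>2" using \<alpha>' by (intro power_mono) auto
  also have "\<dots> = 900 * \<zeta> ^ 4 / \<xi> ^ 4" by (simp add: power_divide power_mult_distrib)
  \<comment> \<open>The constant 3200 and the fourth powers in the bound on \<open>m\<close> are
    made for this estimate: the bound on \<open>m\<close> cancels the bound on the square of
    \<alpha> up to a fraction of \<epsilon>.\<close>
  finally have "\<alpha>\<^sup>2 * m \<le> (900 * \<zeta> ^ 4 / \<xi> ^ 4) * (\<epsilon> * \<xi> ^ 4 / (3200 * \<zeta> ^ 4))"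
    using m zeta1 xi0 by (intro mult_mono) auto
  also have "\<dots> = 900 / 3200 * \<epsilon>" using xi0 zeta1 by simp
  finally have \<alpha>m: "\<alpha>\<^sup>2 * m \<le> 900 / 3200 * \<epsilon>" .
  let ?y = "x + \<alpha> \<cdot>\<^sub>v w"
  have yc: "?y \<in> carrier_vec n" using x w by simp
  have "q_at P g ?y = q_at P g x + 2 * \<alpha> * (w \<bullet> (A_at P g *\<^sub>v x + b_at P g)) + \<alpha>\<^sup>2 * (w \<bullet> (A_at P g *\<^sub>v w))"
    using quad_add_smult[OF symA b_carrier x w(1)] x yc by (simp add: q_at_quad)
  also have "\<dots> \<le> q_at P g x + 0 + \<alpha>\<^sup>2 * m"
    using desc \<alpha>' w by (intro add_mono mult_left_mono) (auto simp: mult_le_0_iff)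
  finally have qy: "q_at P g ?y \<le> q_at P g x + 900 / 3200 * \<epsilon>" using \<alpha>m by simp
  show ?thesis
  proof (rule approx_optimizerI[OF yc])
    show "q\<^sub>1 P ?y \<le> \<epsilon>" using \<alpha>' eps0 by simp
    fix y assume y: "y \<in> carrier_vec n" "q\<^sub>1 P y \<le> 0"
    have "g * q\<^sub>1 P y \<le> 0" using g y by (simp add: mult_nonneg_nonpos)
    then show "q\<^sub>0 P ?y \<le> q\<^sub>0 P y + \<epsilon>"
      using qy near_sol_q_at[OF ns y(1)] \<alpha>' eps0 by (simp add: q_at_def)
  qed
qed

text \<open>A computed value beyond \<tau> is farther from 0 than the error of ApproxNu, so it has
  the sign of \<nu>(g).\<close>

lemma gamma_star_ge: "near_sol m g x \<Longrightarrow> \<tau> < q\<^sub>1 P x \<Longrightarrow> g \<le> gamma_star P"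
  using near_sol_q1[of m g x] gamma_star_side[of g] zero_le_mult_iff[of "gamma_star P - g" "nu g"]
  by (auto simp: near_sol_def)

lemma gamma_star_le: "near_sol m g x \<Longrightarrow> q\<^sub>1 P x < - \<tau> \<Longrightarrow> gamma_star P \<le> g"
  using near_sol_q1[of m g x] gamma_star_side[of g] zero_le_mult_iff[of "gamma_star P - g" "nu g"]
  by (auto simp: near_sol_def)

text \<open>By quasiconcavity \<open>\<mu> g\<close> is at least the smaller of the values at
  \<open>gamma_star P\<close> and \<open>\<gamma>h\<close>; since
  \<open>\<mu> g < \<xi> \<le> \<mu> \<gamma>h\<close>, the smaller one is
  \<open>mu_star P\<close>.\<close>

lemma mu_star_le:
  assumes "gamma_star P \<le> g \<and> g \<le> \<gamma>h \<or> \<gamma>h \<le> g \<and> g \<le> gamma_star P" "\<mu> g < \<xi>"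
  shows "mu_star P \<le> \<mu> g"
  using assms mu_gh mu_quasiconcave[of "gamma_star P" g \<gamma>h] mu_quasiconcave[of \<gamma>h g "gamma_star P"]
  by (auto simp: mu_star_def)

end

section \<open>The subroutines\<close>

lemma fst_bind_timed [simp]: "fst (bind_timed m f) = fst (f (fst m))"
  and snd_bind_timed [simp]: "snd (bind_timed m f) = snd m + snd (f (fst m))"
  by (simp_all add: bind_timed_def)

lemma fst_cost [simp]: "fst (cost k a) = a" and snd_cost [simp]: "snd (cost k a) = k"
  by (simp_all add: cost_def)

lemma lg_ge_1: "1 \<le> lg x"
  by (simp add: lg_def)

text \<open>The argument 0 has to be covered because b(\<gamma>) may vanish; the logarithm has the
  default value 0 there, below the truncation.\<close>

lemma lg_mono: "0 \<le> x \<Longrightarrow> x \<le> y \<Longrightarrow> lg x \<le> lg y"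
proof (cases "x = 0")
  case False
  assume "0 \<le> x" "x \<le> y"
  with False have "log 2 x \<le> log 2 y" by simp
  then show ?thesis by (simp add: lg_def)
qed (simp add: lg_def log_def)

text \<open>The specification promises accuracy and running time on the good event only, so both
  belong to the predicate.\<close>

definition eig_good :: "'s eig_oracle \<Rightarrow> real \<Rightarrow> real mat \<Rightarrow> real \<Rightarrow> real \<Rightarrow> real \<Rightarrow> 's \<Rightarrow> bool" where
  "eig_good eig K A \<rho> \<delta> p s \<longleftrightarrow>
     (let x = fst (eig A \<rho> \<delta> p s); n = dim_row A in
        x \<in> carrier_vec n \<and> vnorm x = 1 \<and> x \<bullet> (A *\<^sub>v x) \<le> lambda_min A + \<delta> \<and>
        real (snd (eig A \<rho> \<delta> p s)) \<le> K * real (max n (nnz A)) * sqrt (\<rho> / \<delta>) * lg (real n / p))"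

text \<open>This follows the recursion of \<open>gamma_loop\<close>, so that only the calls that are actually made have to be good.\<close>

primrec loop_good ::
  "'s eig_oracle \<Rightarrow> gtrs \<Rightarrow> real \<Rightarrow> real \<Rightarrow> (nat \<times> nat \<Rightarrow> 's) \<Rightarrow>
    side \<Rightarrow> real \<Rightarrow> real \<Rightarrow> nat \<Rightarrow> nat \<Rightarrow> nat \<Rightarrow> real \<Rightarrow> real \<Rightarrow> bool"
where
  "loop_good eig P \<zeta> K \<omega> S m p'' t 0 s l r \<longleftrightarrow> True"
| "loop_good eig P \<zeta> K \<omega> S m p'' t (Suc k) s l r \<longleftrightarrow>
     (let g = (l + r) / 2; A = A_at P g; x = fst (eig A (2 * \<zeta>) (m / 8) p'' (\<omega> (t, s)));
          v = x \<bullet> (A *\<^sub>v x)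
      in eig_good eig K A (2 * \<zeta>) (m / 8) p'' (\<omega> (t, s)) \<and>
         (if v > m then
            (case S of LeftSide \<Rightarrow> loop_good eig P \<zeta> K \<omega> S m p'' t k (Suc s) l g
             | RightSide \<Rightarrow> loop_good eig P \<zeta> K \<omega> S m p'' t k (Suc s) g r)
          else if v < 5 / 8 * m then
            (case S of LeftSide \<Rightarrow> loop_good eig P \<zeta> K \<omega> S m p'' t k (Suc s) g r
             | RightSide \<Rightarrow> loop_good eig P \<zeta> K \<omega> S m p'' t k (Suc s) l g)
          else True))"

text \<open>\<open>Ke\<close> and \<open>Kc\<close> will be determined by the oracles alone; keeping
  them as parameters makes visible that the final constant depends on nothing else.\<close>

locale gtrs_run = gtrs_accuracy +
  fixes eig :: "'s eig_oracle" and cg :: cg_oracle and p Ke Kc :: real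
  assumes p0: "0 < p" and p1: "p < 1"
    and nnz_ge: "nnz (A\<^sub>0 P) + nnz (A\<^sub>1 P) \<ge> qdim P"
    and Ke1: "1 \<le> Ke" and Kc1: "1 \<le> Kc"
    and cg_spec: "\<And>n A b \<mu> \<rho> \<delta>. 0 < n \<Longrightarrow> sym_mat n A \<Longrightarrow> b \<in> carrier_vec n \<Longrightarrow> 0 < \<mu> \<Longrightarrow> 0 < \<delta> \<Longrightarrow>
      \<mu> \<cdot>\<^sub>m 1\<^sub>m n \<preceq>\<^sub>L A \<Longrightarrow> A \<preceq>\<^sub>L \<rho> \<cdot>\<^sub>m 1\<^sub>m n \<Longrightarrow>
      fst (cg A b \<mu> \<rho> \<delta>) \<in> carrier_vec n \<and> vnorm (fst (cg A b \<mu> \<rho> \<delta>) + mat_inv A *\<^sub>v b) \<le> \<delta> \<and>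
      real (snd (cg A b \<mu> \<rho> \<delta>)) \<le> Kc * real (nnz A) * sqrt (\<rho> / \<mu>) * lg (vnorm b / (\<mu> * \<delta>))"
begin

section \<open>Cost and accuracy of ApproxNu\<close>

definition N :: real where "N = real (nnz (A\<^sub>0 P) + nnz (A\<^sub>1 P))"

lemma N_ge_n: "real n \<le> N" and N_ge_1: "1 \<le> N" and nnz0_le: "real (nnz (A\<^sub>0 P)) + real (nnz (A\<^sub>1 P)) = N"
  using nnz_ge n_pos by (auto simp: N_def)

lemma nnz_A_at: "real (nnz (A_at P g)) \<le> N"
proof -
  let ?s = "\<lambda>A :: real mat. {(i, j). i < n \<and> j < n \<and> A $$ (i, j) \<noteq> 0}"
  have fin: "finite (?s A)" for A by (rule finite_subset[of _ "{..<n} \<times> {..<n}"]) auto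
  have "nnz (A_at P g) = card (?s (A_at P g))" using carrier_matD[OF A_carrier[of g]] by (simp only: nnz_def)
  also have "\<dots> \<le> card (?s (A\<^sub>0 P) \<union> ?s (A\<^sub>1 P))"
  proof (rule card_mono)
    have "A_at P g $$ (i, j) = A\<^sub>0 P $$ (i, j) + g * A\<^sub>1 P $$ (i, j)" if "i < n" "j < n" for i j
      using that carrier_matD[OF A0_carrier] carrier_matD[OF A1_carrier] by (simp add: A_at_def)
    then show "?s (A_at P g) \<subseteq> ?s (A\<^sub>0 P) \<union> ?s (A\<^sub>1 P)" by auto
  qed (use fin in simp)
  also have "\<dots> \<le> card (?s (A\<^sub>0 P)) + card (?s (A\<^sub>1 P))" by (rule card_Un_le)
  also have "\<dots> = nnz (A\<^sub>0 P) + nnz (A\<^sub>1 P)"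
    using carrier_matD[OF A0_carrier] carrier_matD[OF A1_carrier] by (simp only: nnz_def)
  finally show ?thesis by (simp add: N_def)
qed

definition nu_call :: "real \<Rightarrow> real \<Rightarrow> (real vec \<times> real) timed" where
  "nu_call m g = approx_nu cg P \<zeta> m \<tau> g"

text \<open>Everything but conjugate gradient costs at most 4 N + 6 N + 7 N. The argument of
  \<open>lg\<close> is 2 \<zeta> / (m d) for the accuracy d = m \<tau> / (10 \<zeta>), as |b(g)|
  \<le> 2 \<zeta>.\<close>

lemma
  assumes m: "0 < m" "m \<le> 1" "m \<le> \<mu> g" "0 \<le> g" "g \<le> \<zeta>"
  shows nu_call_near_sol: "near_sol m g (fst (fst (nu_call m g)))"
    and nu_call_value: "snd (fst (nu_call m g)) = q\<^sub>1 P (fst (fst (nu_call m g)))"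
    and nu_call_time: "real (snd (nu_call m g)) \<le>
      17 * N + Kc * N * sqrt (2 * \<zeta> / m) * lg (80 * \<zeta> ^ 3 / (m\<^sup>2 * \<epsilon>))"
proof -
  define d where "d = m * \<tau> / (10 * \<zeta>)"
  have d: "0 < d" using m tau_bounds zeta1 by (simp add: d_def)
  define c where "c = cg (A_at P g) (b_at P g) m (2 * \<zeta>) d"
  have cg: "fst c \<in> carrier_vec n" "vnorm (fst c + mat_inv (A_at P g) *\<^sub>v b_at P g) \<le> d"
    "real (snd c) \<le> Kc * real (nnz (A_at P g)) * sqrt (2 * \<zeta> / m) * lg (vnorm (b_at P g) / (m * d))"
    using cg_spec[OF n_pos symA[of g] b_carrier[of g] m(1) d _ A_at_le_scalar[of g]] m scalar_le_A_at[of m g]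
    by (auto simp: c_def)
  have fstc: "fst (fst (nu_call m g)) = fst c"
    by (simp add: nu_call_def approx_nu_def eval_A_def eval_b_def eval_q1_def c_def d_def)
  show "near_sol m g (fst (fst (nu_call m g)))"
    using m cg unfolding fstc by (simp add: near_sol_def d_def)
  show "snd (fst (nu_call m g)) = q\<^sub>1 P (fst (fst (nu_call m g)))"
    by (simp add: nu_call_def approx_nu_def eval_A_def eval_b_def eval_q1_def)
  have "snd (nu_call m g) = (nnz (A\<^sub>0 P) + 2 * nnz (A\<^sub>1 P)) + 2 * n + 1 + 3 + snd c + (2 * nnz (A\<^sub>1 P) + 4 * n + 3)"
    by (simp add: nu_call_def approx_nu_def eval_A_def eval_b_def eval_q1_def c_def d_def)
  then have "real (snd (nu_call m g)) = real (nnz (A\<^sub>0 P)) + 4 * real (nnz (A\<^sub>1 P)) + 6 * real n + 7 + real (snd c)"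
    by simp
  also have "\<dots> \<le> 17 * N + real (snd c)"
    using N_ge_n N_ge_1 nnz0_le of_nat_0_le_iff[of "nnz (A\<^sub>0 P)", where 'a = real] by linarith
  also have "real (snd c) \<le> Kc * N * sqrt (2 * \<zeta> / m) * lg (80 * \<zeta> ^ 3 / (m\<^sup>2 * \<epsilon>))"
  proof -
    have "vnorm (b_at P g) / (m * d) \<le> 2 * \<zeta> / (m * d)"
      using b_at_vnorm_le m d by (intro divide_right_mono) auto
    also have "\<dots> = 80 * \<zeta> ^ 3 / (m\<^sup>2 * \<epsilon>)"
      using zeta1 m eps0 by (simp add: d_def \<tau>_def field_simps power2_eq_square power3_eq_cube)
    finally have "lg (vnorm (b_at P g) / (m * d)) \<le> lg (80 * \<zeta> ^ 3 / (m\<^sup>2 * \<epsilon>))"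
      using m d by (intro lg_mono) auto
    then show ?thesis
      using nnz_A_at[of g] Kc1 zeta1 m lg_ge_1[of "vnorm (b_at P g) / (m * d)"] N_ge_1
      by (intro order_trans[OF cg(3)] mult_mono) auto
  qed
  finally show "real (snd (nu_call m g)) \<le>
      17 * N + Kc * N * sqrt (2 * \<zeta> / m) * lg (80 * \<zeta> ^ 3 / (m\<^sup>2 * \<epsilon>))" by simp
qed

section \<open>Bisection for a multiplier at a given level\<close>

definition step_time :: "real \<Rightarrow> real \<Rightarrow> real" where
  "step_time m p'' = 15 * N + Ke * N * sqrt (16 * \<zeta> / m) * lg (real n / p'')"

text \<open>A Rayleigh quotient in [5/8 m, m] that exceeds \<open>\<mu> g\<close> by at most m / 8
  puts \<open>\<mu> g\<close> into [m / 2, m]; this is what the threshold 5/8 is for.\<close>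

definition search_result :: "real \<Rightarrow> real \<Rightarrow> real \<Rightarrow> (real \<times> real vec) option \<Rightarrow> bool" where
  "search_result m l r res \<longleftrightarrow> (\<exists>g x. res = Some (g, x) \<and> l \<le> g \<and> g \<le> r \<and> x \<in> carrier_vec n \<and>
     vnorm x = 1 \<and> x \<bullet> (A_at P g *\<^sub>v x) \<le> m \<and> m / 2 \<le> \<mu> g \<and> \<mu> g \<le> m)"

lemma search_result_mono: "search_result m l r res \<Longrightarrow> l' \<le> l \<Longrightarrow> r \<le> r' \<Longrightarrow> search_result m l' r' res"
  by (fastforce simp: search_result_def)

text \<open>The interval always contains points with \<open>\<mu> < 5m/8\<close> and with \<open>\<mu> > 7m/8\<close>, so by the Lipschitz
  property of \<open>\<mu>\<close> its length stays above \<open>m/4\<close>.\<close>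

lemma gamma_loop_correct:
  assumes "loop_good eig P \<zeta> Ke \<omega> S m (p' / real T) t k s l r"
    and "0 < m" "0 < p' / real T" "0 \<le> l" "l \<le> r" "r \<le> \<zeta>" "r - l \<le> 2 ^ k * (m / 4)"
    and "case S of LeftSide \<Rightarrow> \<mu> l < 5 / 8 * m \<and> 7 / 8 * m < \<mu> r | RightSide \<Rightarrow> \<mu> r < 5 / 8 * m \<and> 7 / 8 * m < \<mu> l"
  shows "search_result m l r (fst (gamma_loop eig P \<zeta> \<omega> S m p' t T k s l r)) \<and>
    real (snd (gamma_loop eig P \<zeta> \<omega> S m p' t T k s l r)) \<le> real k * step_time m (p' / real T)"
  using assms
proof (induction k arbitrary: s l r)
  case 0
  \<comment> \<open>Exhaustion is impossible: over length at most m / 4 the function \<mu> cannot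
    change by more than m / 4 = 7/8 m - 5/8 m.\<close>
  have "\<bar>\<mu> l - \<mu> r\<bar> \<le> r - l" using mu_lipschitz[of l r] 0 by simp
  then show ?case using 0 by (cases S) auto
next
  case (Suc k)
  define g where "g = (l + r) / 2"
  define e where "e = eig (A_at P g) (2 * \<zeta>) (m / 8) (p' / real T) (\<omega> (t, s))"
  define x where "x = fst e"
  define v where "v = x \<bullet> (A_at P g *\<^sub>v x)"
  have lgr: "l \<le> g" "g \<le> r" "0 \<le> g" "g \<le> \<zeta>" using Suc.prems by (auto simp: g_def)
  have "r - g = (r - l) / 2" "g - l = (r - l) / 2" by (simp_all add: g_def field_simps)
  then have half: "r - g \<le> 2 ^ k * (m / 4)" "g - l \<le> 2 ^ k * (m / 4)" using Suc.prems(7)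
    unfolding power_Suc mult.assoc by linarith+
  have good: "eig_good eig Ke (A_at P g) (2 * \<zeta>) (m / 8) (p' / real T) (\<omega> (t, s))"
    using Suc.prems(1) by (simp add: Let_def g_def)
  have dim: "dim_row (A_at P g) = n" by (rule carrier_matD(1)[OF A_carrier])
  have x: "x \<in> carrier_vec n" "vnorm x = 1" and v_le: "v \<le> \<mu> g + m / 8"
    and e_time: "real (snd e) \<le> Ke * real (max n (nnz (A_at P g))) * sqrt (2 * \<zeta> / (m / 8)) * lg (real n / (p' / real T))"
    using good unfolding eig_good_def Let_def dim by (auto simp: x_def e_def v_def mu_at_def)
  have mu_le: "\<mu> g \<le> v" unfolding v_def using mu_le_unit[OF x] .
  have "real (snd e) \<le> Ke * N * sqrt (2 * \<zeta> / (m / 8)) * lg (real n / (p' / real T))"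
    using nnz_A_at[of g] N_ge_n Ke1 zeta1 \<open>0 < m\<close> lg_ge_1[of "real n / (p' / real T)"]
    by (intro order_trans[OF e_time] mult_right_mono mult_left_mono) auto
  then have e_time': "real (snd e) \<le> Ke * N * sqrt (16 * \<zeta> / m) * lg (real n / (p' / real T))"
    by (simp add: mult.commute)
  define c0 where "c0 = 2 + (nnz (A\<^sub>0 P) + 2 * nnz (A\<^sub>1 P)) + 1 + 1 + 1 + snd e + (2 * nnz (A_at P g) + n) + 2 * n + 1 + 2"
  have "real c0 = 8 + real (nnz (A\<^sub>0 P)) + 2 * real (nnz (A\<^sub>1 P)) + 2 * real (nnz (A_at P g)) + 3 * real n + real (snd e)"
    by (simp add: c0_def)
  \<comment> \<open>A step without its oracle call costs at most 8 N + 2 N + 2 N + 3 N, the summand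
    15 N of \<open>step_time\<close>.\<close>
  then have c0: "real c0 \<le> step_time m (p' / real T)"
    unfolding step_time_def
    using e_time' N_ge_n N_ge_1 nnz0_le nnz_A_at[of g] of_nat_0_le_iff[of "nnz (A\<^sub>0 P)", where 'a = real] by linarith
  let ?L = "\<lambda>l r. gamma_loop eig P \<zeta> \<omega> S m p' t T k (Suc s) l r"
  define nxt where "nxt = (if v > m then (case S of LeftSide \<Rightarrow> ?L l g | RightSide \<Rightarrow> ?L g r)
     else if v < 5 / 8 * m then (case S of LeftSide \<Rightarrow> ?L g r | RightSide \<Rightarrow> ?L l g)
     else cost 0 (Some (g, x)))"
  have unf: "fst (gamma_loop eig P \<zeta> \<omega> S m p' t T (Suc k) s l r) = fst nxt"
    "snd (gamma_loop eig P \<zeta> \<omega> S m p' t T (Suc k) s l r) = c0 + snd nxt"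
    using dim by (auto simp: nxt_def c0_def g_def[symmetric] e_def x_def v_def eval_A_def eval_mult_def eval_inner_def
        split: side.splits)
  have "search_result m l r (fst nxt) \<and> real (snd nxt) \<le> real k * step_time m (p' / real T)"
  proof (cases "v > m \<or> v < 5 / 8 * m")
    case False
    have "step_time m (p' / real T) \<ge> 0" using c0 of_nat_0_le_iff order_trans by blast
    then show ?thesis
      using False lgr x v_le mu_le by (auto simp: nxt_def search_result_def v_def)
  next
    case True
    \<comment> \<open>A value above \<open>m\<close> moves the end at which \<mu> is large, a value
      below \<open>5 / 8 * m\<close> the other one; the comparison with \<open>S\<close> tells which
      of \<open>l\<close> and \<open>r\<close> that is.\<close>
    define l' where "l' = (if (v > m) = (S = LeftSide) then l else g)"
    define r' where "r' = (if (v > m) = (S = LeftSide) then g else r)"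
    have nl: "nxt = ?L l' r'"
      using True by (cases S) (auto simp: nxt_def l'_def r'_def)
    \<comment> \<open>The oracle overestimates \<open>\<mu> g\<close> by at most m / 8, so a value
      above m certifies 7/8 m. A value below 5/8 m is itself an upper bound.\<close>
    have mup: "7 / 8 * m < \<mu> g" if "v > m" using v_le that by simp
    have mdown: "\<mu> g < 5 / 8 * m" if "\<not> v > m" using mu_le that True by simp
    have "search_result m l' r' (fst nxt) \<and> real (snd nxt) \<le> real k * step_time m (p' / real T)"
      unfolding nl
    proof (rule Suc.IH)
      show "loop_good eig P \<zeta> Ke \<omega> S m (p' / real T) t k (Suc s) l' r'"
        using Suc.prems(1) True
        by (cases S) (auto simp: Let_def g_def[symmetric] e_def[symmetric] x_def[symmetric] v_def[symmetric]
            l'_def r'_def split: if_splits)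
      show "case S of LeftSide \<Rightarrow> \<mu> l' < 5 / 8 * m \<and> 7 / 8 * m < \<mu> r' | RightSide \<Rightarrow> \<mu> r' < 5 / 8 * m \<and> 7 / 8 * m < \<mu> l'"
        using Suc.prems(8) mup mdown by (cases S) (auto simp: l'_def r'_def)
    qed (use Suc.prems lgr half in \<open>auto simp: l'_def r'_def\<close>)
    moreover have "l \<le> l'" "r' \<le> r" using lgr by (auto simp: l'_def r'_def)
    ultimately show ?thesis using search_result_mono by blast
  qed
  then show ?case using c0 unfolding unf by (simp add: algebra_simps)
qed

definition inner_T :: "real \<Rightarrow> nat" where "inner_T m = nat \<lceil>log 2 (5 * \<zeta> / m)\<rceil>"
definition left_end :: "side \<Rightarrow> real" where "left_end S = (case S of LeftSide \<Rightarrow> 0 | RightSide \<Rightarrow> \<gamma>h)"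
definition right_end :: "side \<Rightarrow> real" where "right_end S = (case S of LeftSide \<Rightarrow> \<gamma>h | RightSide \<Rightarrow> \<zeta>)"

lemma end_range: "0 \<le> left_end S" "left_end S \<le> right_end S" "right_end S \<le> \<zeta>"
  using gh0 gh_le_zeta zeta1 by (auto simp: left_end_def right_end_def split: side.split)

lemma le_two_power_ceil_log:
  assumes "0 < y" shows "y \<le> 2 ^ nat \<lceil>log 2 y\<rceil>"
proof -
  have "y = 2 powr log 2 y" using assms by simp
  also have "\<dots> \<le> 2 powr real (nat \<lceil>log 2 y\<rceil>)"
    by (intro powr_mono real_nat_ceiling_ge) auto
  finally show ?thesis by (simp add: powr_realpow)
qed

lemma inner_T_pos: "0 < m \<Longrightarrow> m \<le> 1 \<Longrightarrow> 0 < inner_T m"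
proof -
  assume m: "0 < m" "m \<le> 1"
  have "1 < 5 * \<zeta> / m" using m zeta1 by (simp add: field_simps)
  then show ?thesis by (simp add: inner_T_def)
qed

lemma approx_gamma_correct:
  assumes good: "loop_good eig P \<zeta> Ke \<omega> S m (p' / real (inner_T m)) t (inner_T m) 1 (left_end S) (right_end S)"
    and m: "0 < m" "m < \<xi>" and p': "0 < p'"
  shows "search_result m (left_end S) (right_end S) (fst (approx_gamma eig P \<zeta> \<gamma>h \<omega> S m p' t))"
    and "real (snd (approx_gamma eig P \<zeta> \<gamma>h \<omega> S m p' t)) \<le>
      3 + real (inner_T m) * (1 + step_time m (p' / real (inner_T m)))"
proof -
  let ?T = "inner_T m"
  let ?G = "gamma_loop eig P \<zeta> \<omega> S m p' t ?T ?T 1 (left_end S) (right_end S)"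
  have unf: "fst (approx_gamma eig P \<zeta> \<gamma>h \<omega> S m p' t) = fst ?G"
    "snd (approx_gamma eig P \<zeta> \<gamma>h \<omega> S m p' t) = 3 + ?T + snd ?G"
    by (cases S; simp add: approx_gamma_def eval_ceil_log_def Let_def inner_T_def left_end_def right_end_def)+
  have T: "0 < ?T" using m xi1 by (intro inner_T_pos) auto
  \<comment> \<open>The constant 5 in the number of steps yields length at most
    \<open>2 ^ ?T * (m / 5)\<close>, with slack against the m / 4 of the invariant.\<close>
  have "5 * \<zeta> / m \<le> 2 ^ ?T" unfolding inner_T_def using m zeta1 by (intro le_two_power_ceil_log) simp
  then have "\<zeta> \<le> 2 ^ ?T * (m / 5)" using m by (simp add: field_simps)
  also have "\<dots> \<le> 2 ^ ?T * (m / 4)" using m by (intro mult_left_mono) auto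
  finally have len: "right_end S - left_end S \<le> 2 ^ ?T * (m / 4)"
    using end_range[of S] by linarith
  have "search_result m (left_end S) (right_end S) (fst ?G) \<and> real (snd ?G) \<le> real ?T * step_time m (p' / real ?T)"
  proof (rule gamma_loop_correct[OF good])
    show "case S of LeftSide \<Rightarrow> \<mu> (left_end S) < 5 / 8 * m \<and> 7 / 8 * m < \<mu> (right_end S)
        | RightSide \<Rightarrow> \<mu> (right_end S) < 5 / 8 * m \<and> 7 / 8 * m < \<mu> (left_end S)"
      using mu_0_neg mu_zeta mu_gh m by (cases S) (auto simp: left_end_def right_end_def)
  qed (use m p' T end_range[of S] len in auto)
  then show "search_result m (left_end S) (right_end S) (fst (approx_gamma eig P \<zeta> \<gamma>h \<omega> S m p' t))"
    "real (snd (approx_gamma eig P \<zeta> \<gamma>h \<omega> S m p' t)) \<le> 3 + real ?T * (1 + step_time m (p' / real ?T))"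
    unfolding unf by (auto simp: algebra_simps)
qed

end

section \<open>Logarithmic factors\<close>

lemma mult_ge_factors:
  fixes a b c :: real
  assumes "1 \<le> a" "1 \<le> b" "1 \<le> c"
  shows "a \<le> a * b * c" "c \<le> a * b * c" "1 \<le> a * b * c"
proof -
  have "1 * 1 \<le> a * b" "1 * 1 \<le> b * c" using assms by (intro mult_mono; simp)+
  then have ab: "1 \<le> a * b" and bc: "1 \<le> b * c" by simp_all
  have "a * 1 \<le> a * (b * c)" "1 * c \<le> (a * b) * c"
    using assms ab bc by (auto intro!: mult_left_mono mult_right_mono)
  then show ac: "a \<le> a * b * c" "c \<le> a * b * c" by (simp_all add: mult.assoc)
  show "1 \<le> a * b * c" using ac assms by linarith
qed

context gtrs_run
begin

definition \<phi> :: real where "\<phi> = max (min (mu_star P) \<xi>) (\<epsilon> * \<xi> ^ 4 / \<zeta> ^ 4)"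
definition L1 :: real where "L1 = lg (1 / \<phi>)"
definition L2 :: real where "L2 = lg (real n / p)"
definition L3 :: real where "L3 = lg (\<zeta> / (\<epsilon> * \<xi>))"
definition LL :: real where "LL = lg L1 * lg L2 * lg L3"
text \<open>One iteration at level m costs a multiple of \<open>H / sqrt m\<close>; the claimed
  total is a multiple of \<open>H / sqrt \<phi>\<close>.\<close>

definition H :: real where "H = N * sqrt \<zeta> * L1 * L2 * L3 * LL"
definition outer_T :: nat where "outer_T = nat \<lceil>log 2 (3200 * \<zeta> ^ 4 / (\<epsilon> * \<xi> ^ 3))\<rceil>"
definition mt :: "nat \<Rightarrow> real" where "mt t = \<xi> / 2 ^ t"

lemma phi_pos: "0 < \<phi>"
  using eps0 xi0 zeta1 by (auto simp: \<phi>_def less_max_iff_disj)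

lemma phi_le_xi: "\<phi> \<le> \<xi>"
proof -
  have "\<epsilon> * \<xi> ^ 4 / \<zeta> ^ 4 \<le> 1 * \<xi> ^ 4 / 1"
    using eps0 eps1 xi0 zeta1 by (intro frac_le mult_right_mono) auto
  also have "\<dots> \<le> \<xi> ^ 1 / 1" unfolding mult_1 using xi0 xi1 by (intro divide_right_mono power_decreasing) auto
  finally show ?thesis by (simp add: \<phi>_def)
qed

lemma L_ge_1: "1 \<le> L1" "1 \<le> L2" "1 \<le> L3" "1 \<le> LL"
proof -
  show "1 \<le> LL" unfolding LL_def using mult_ge_factors(3)[OF lg_ge_1[of L1] lg_ge_1[of L2] lg_ge_1[of L3]] by linarith
qed (simp_all add: L1_def L2_def L3_def lg_ge_1)

lemma log_params:
  shows "0 \<le> log 2 \<zeta>" "0 \<le> log 2 (1 / \<epsilon>)" "0 \<le> log 2 (1 / \<xi>)" "0 \<le> log 2 (1 / \<phi>)"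
    and "log 2 \<zeta> + log 2 (1 / \<epsilon>) + log 2 (1 / \<xi>) \<le> L3" "log 2 (1 / \<phi>) \<le> L1"
proof -
  show "0 \<le> log 2 \<zeta>" "0 \<le> log 2 (1 / \<epsilon>)" "0 \<le> log 2 (1 / \<xi>)" "0 \<le> log 2 (1 / \<phi>)"
    using zeta1 eps0 eps1 xi0 xi1 phi_pos phi_le_xi by simp_all
  have "\<zeta> / (\<epsilon> * \<xi>) = \<zeta> * (1 / \<epsilon>) * (1 / \<xi>)" by simp
  then have "log 2 (\<zeta> / (\<epsilon> * \<xi>)) = log 2 \<zeta> + log 2 (1 / \<epsilon>) + log 2 (1 / \<xi>)"
    using zeta1 eps0 xi0 by (simp only: log_mult_pos mult_pos_pos zero_less_divide_1_iff less_le_trans[OF zero_less_one])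
  then show "log 2 \<zeta> + log 2 (1 / \<epsilon>) + log 2 (1 / \<xi>) \<le> L3" by (simp add: L3_def lg_def)
  show "log 2 (1 / \<phi>) \<le> L1" by (simp add: L1_def lg_def)
qed

lemma log_numeral_le: "0 < x \<Longrightarrow> x \<le> 2 ^ k \<Longrightarrow> log 2 x \<le> real k"
  using log_le_cancel_iff[of 2 x "2 ^ k"] by (simp add: log_pow_cancel)

lemma real_nat_ceiling_le: "0 \<le> x \<Longrightarrow> real (nat \<lceil>x\<rceil>) \<le> x + 1"
  by linarith

text \<open>The executed levels are not below \<phi> / 6400, which turns log (1 / m) into L1 up to
  an additive constant; 6400 \<le> 2 ^ 13.\<close>

lemma log_inverse_level:
  assumes "0 < m" "\<phi> \<le> 6400 * m"
  shows "log 2 (1 / m) \<le> 13 + L1"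
proof -
  have "1 / m \<le> 6400 * (1 / \<phi>)" using assms phi_pos by (simp add: field_simps)
  then have "log 2 (1 / m) \<le> log 2 (6400 * (1 / \<phi>))" using assms phi_pos by (subst log_le_cancel_iff) auto
  also have "\<dots> = log 2 6400 + log 2 (1 / \<phi>)" using phi_pos by (intro log_mult_pos) auto
  also have "log 2 6400 \<le> real 13" by (rule log_numeral_le) auto
  finally show ?thesis using log_params by simp
qed

lemma L13: "L1 \<le> L1 * L3" "L3 \<le> L1 * L3" "1 \<le> L1 * L3"
  using L_ge_1 mult_mono[of 1 L1 1 L3] by (auto simp: mult_le_cancel_left1 mult_le_cancel_right1)

lemma inner_T_le:
  assumes "0 < m" "m \<le> 1" "\<phi> \<le> 6400 * m"
  shows "real (inner_T m) \<le> 19 * (L1 * L3)"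
proof -
  have "log 2 (5 * \<zeta> / m) = log 2 (5 * \<zeta> * (1 / m))" by simp
  also have "\<dots> = log 2 5 + log 2 \<zeta> + log 2 (1 / m)"
    using assms zeta1 by (simp only: log_mult_pos mult_pos_pos zero_less_divide_1_iff less_le_trans[OF zero_less_one] zero_less_numeral)
  also have "log 2 5 \<le> real 3" by (rule log_numeral_le) auto
  finally have le: "log 2 (5 * \<zeta> / m) \<le> 16 + L3 + L1"
    using log_inverse_level[OF assms(1,3)] log_params by simp
  have "1 \<le> 5 * \<zeta> / m" using assms zeta1 by (simp add: field_simps)
  then have "real (inner_T m) \<le> log 2 (5 * \<zeta> / m) + 1"
    unfolding inner_T_def by (intro real_nat_ceiling_le) simp
  then show ?thesis using le L13 L_ge_1 by linarith
qed

text \<open>Rounding the number of iterations up at most doubles the power of 2. The lower bound on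
  the power makes the last level small enough for the final correction; the upper bound keeps all
  levels above a fixed fraction of \<epsilon> \<xi>^4 / \<zeta>^4.\<close>

lemma outer_T_le: "real outer_T \<le> 17 * L3" and outer_T_pos: "0 < outer_T"
  and two_pow_outer_T: "3200 * \<zeta> ^ 4 / (\<epsilon> * \<xi> ^ 3) \<le> 2 ^ outer_T" "2 ^ outer_T \<le> 6400 * \<zeta> ^ 4 / (\<epsilon> * \<xi> ^ 3)"
proof -
  let ?y = "3200 * \<zeta> ^ 4 / (\<epsilon> * \<xi> ^ 3)"
  have "\<epsilon> * \<xi> ^ 3 \<le> 1 * 1" using eps0 eps1 xi0 xi1 by (intro mult_mono power_le_one) auto
  moreover have "1 \<le> \<zeta> ^ 4" using zeta1 by simp
  ultimately have "3200 * 1 / 1 \<le> ?y" using eps0 xi0 by (intro frac_le) auto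
  then have y: "3200 \<le> ?y" by simp
  have pw: "log 2 ((1 / \<xi>) ^ 3) = 3 * log 2 (1 / \<xi>)" "log 2 (\<zeta> ^ 4) = 4 * log 2 \<zeta>"
    using xi0 zeta1 log_nat_power[of "1 / \<xi>" 2 3] log_nat_power[of \<zeta> 2 4] by auto
  have "?y = 3200 * \<zeta> ^ 4 * (1 / \<epsilon>) * (1 / \<xi>) ^ 3" by (simp add: power_divide)
  then have "log 2 ?y = log 2 3200 + log 2 (\<zeta> ^ 4) + log 2 (1 / \<epsilon>) + log 2 ((1 / \<xi>) ^ 3)"
    using zeta1 eps0 xi0
    by (simp only: log_mult_pos mult_pos_pos zero_less_divide_1_iff less_le_trans[OF zero_less_one]
        zero_less_numeral zero_less_power)
  also note pw(1)
  also note pw(2)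
  also have "log 2 3200 \<le> real 12" by (rule log_numeral_le) auto
  finally have le: "log 2 ?y \<le> 12 + 4 * L3" using log_params by simp
  have T: "real outer_T \<le> log 2 ?y + 1"
    unfolding outer_T_def using y by (intro real_nat_ceiling_le) simp
  show "real outer_T \<le> 17 * L3" using T le L_ge_1 by linarith
  have "0 < log 2 ?y" using y by simp
  then show "0 < outer_T" by (simp add: outer_T_def)
  show "?y \<le> 2 ^ outer_T" unfolding outer_T_def using y by (intro le_two_power_ceil_log) simp
  have "2 ^ outer_T = 2 powr real outer_T" by (simp add: powr_realpow)
  also have "\<dots> \<le> 2 powr (log 2 ?y + 1)" using T by (intro powr_mono) auto
  also have "\<dots> = 2 * ?y" using y by (simp add: powr_add)
  finally show "2 ^ outer_T \<le> 6400 * \<zeta> ^ 4 / (\<epsilon> * \<xi> ^ 3)" by simp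
qed

lemma lg_lg_ge: "log 2 L1 \<le> lg L1" "log 2 L3 \<le> lg L3"
  by (simp_all add: lg_def)

text \<open>Dividing p by both loop lengths adds their logarithms to log (n / p). The lengths are
  bounded by products of L1 and L3, so this contributes iterated logarithms, the only source of the
  factor \<open>LL\<close>.\<close>

lemma lg_eig_le:
  assumes "0 < m" "m \<le> 1" "\<phi> \<le> 6400 * m"
  shows "lg (real n / (p / real outer_T / real (inner_T m))) \<le> 14 * (L2 * LL)"
proof -
  let ?T = "real outer_T" and ?t = "real (inner_T m)"
  have pos: "0 < ?T" "0 < ?t" using outer_T_pos inner_T_pos[OF assms(1,2)] by auto
  have "log 2 (real n / (p / ?T / ?t)) = log 2 (real n / p * (?T * ?t))" using p0 pos by (simp add: field_simps)
  also have "\<dots> = log 2 (real n / p) + (log 2 ?T + log 2 ?t)"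
    using n_pos p0 pos by (subst log_mult_pos) (auto simp: log_mult_pos)
  also have "log 2 (real n / p) \<le> L2" by (simp add: L2_def lg_def)
  also have "log 2 ?T \<le> 5 + lg L3"
  proof -
    have "log 2 ?T \<le> log 2 (17 * L3)" using outer_T_le pos L_ge_1 by (subst log_le_cancel_iff) auto
    also have "\<dots> = log 2 17 + log 2 L3" using L_ge_1 by (intro log_mult_pos) auto
    also have "log 2 17 \<le> real 5" by (rule log_numeral_le) auto
    finally show ?thesis using lg_lg_ge by simp
  qed
  also have "log 2 ?t \<le> 5 + lg L1 + lg L3"
  proof -
    have "log 2 ?t \<le> log 2 (19 * (L1 * L3))" using inner_T_le[OF assms] pos L13 by (subst log_le_cancel_iff) auto
    also have "\<dots> = log 2 19 + (log 2 L1 + log 2 L3)" using L_ge_1 by (simp add: log_mult_pos)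
    also have "log 2 19 \<le> real 5" by (rule log_numeral_le) auto
    finally show ?thesis using lg_lg_ge by simp
  qed
  finally have le: "log 2 (real n / (p / ?T / ?t)) \<le> L2 + 10 + lg L1 + 2 * lg L3" by simp
  have "L2 * 1 \<le> L2 * LL" "1 * LL \<le> L2 * LL"
    using L_ge_1 by (auto intro!: mult_left_mono mult_right_mono)
  moreover have "lg L1 \<le> LL" "lg L3 \<le> LL"
    unfolding LL_def by (rule mult_ge_factors; rule lg_ge_1)+
  ultimately have "L2 + 10 + lg L1 + 2 * lg L3 \<le> 14 * (L2 * LL)" using L_ge_1 by linarith
  moreover have "1 \<le> 14 * (L2 * LL)" using \<open>L2 * 1 \<le> L2 * LL\<close> L_ge_1 by linarith
  ultimately show ?thesis using le by (simp add: lg_def)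
qed

text \<open>The argument is polynomial in \<zeta>, 1 / \<epsilon> and 1 / m', so its logarithm is at
  most a constant plus multiples of L3 and L1. As both are at least 1, the sum is absorbed into
  their product.\<close>

lemma lg_nu_le:
  assumes "0 < m" "\<phi> \<le> 6400 * m" "m / 4 \<le> m'"
  shows "lg (80 * \<zeta> ^ 3 / (m'\<^sup>2 * \<epsilon>)) \<le> 42 * (L1 * L3)"
proof -
  have m': "0 < m'" using assms by simp
  have "(m / 4)\<^sup>2 \<le> m'\<^sup>2" using assms by (intro power_mono) auto
  then have "80 * \<zeta> ^ 3 / (m'\<^sup>2 * \<epsilon>) \<le> 80 * \<zeta> ^ 3 / ((m / 4)\<^sup>2 * \<epsilon>)"
    using assms zeta1 eps0 by (intro divide_left_mono mult_right_mono mult_pos_pos) auto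
  also have "\<dots> = 1280 * \<zeta> ^ 3 * (1 / \<epsilon>) * (1 / m)\<^sup>2" by (simp add: power_divide field_simps)
  finally have "log 2 (80 * \<zeta> ^ 3 / (m'\<^sup>2 * \<epsilon>)) \<le> log 2 (1280 * \<zeta> ^ 3 * (1 / \<epsilon>) * (1 / m)\<^sup>2)"
    using m' assms zeta1 eps0 by (subst log_le_cancel_iff) auto
  also have "\<dots> = log 2 1280 + log 2 (\<zeta> ^ 3) + log 2 (1 / \<epsilon>) + log 2 ((1 / m)\<^sup>2)"
    using zeta1 eps0 assms
    by (simp only: log_mult_pos mult_pos_pos zero_less_divide_1_iff less_le_trans[OF zero_less_one]
        zero_less_numeral zero_less_power)
  also have "log 2 ((1 / m)\<^sup>2) = 2 * log 2 (1 / m)"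
    using assms log_nat_power[of "1 / m" 2 2] by auto
  also have "log 2 (\<zeta> ^ 3) = 3 * log 2 \<zeta>" using zeta1 log_nat_power[of \<zeta> 2 3] by auto
  also have "log 2 1280 \<le> real 11" by (rule log_numeral_le) auto
  finally have "log 2 (80 * \<zeta> ^ 3 / (m'\<^sup>2 * \<epsilon>)) \<le> 37 + 3 * L3 + 2 * L1"
    using log_inverse_level[OF assms(1,2)] log_params by simp
  then show ?thesis using L13 by (simp add: lg_def)
qed

lemma H_ge:
  assumes "0 < m" "m \<le> 1"
  shows "N * sqrt (\<zeta> / m) * (L1 * L3) * (L2 * LL) = H / sqrt m"
    and "N * sqrt (\<zeta> / m) * (L1 * L3) \<le> H / sqrt m"
    and "N * (L1 * L3) \<le> H / sqrt m" and "N \<le> H / sqrt m" and "1 \<le> H / sqrt m" and "L1 * L3 \<le> H / sqrt m"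
proof -
  let ?D = "sqrt (\<zeta> / m)"
  have D: "1 \<le> ?D" using assms zeta1 by (simp add: field_simps)
  have b: "1 \<le> L2 * LL" using L_ge_1 mult_mono[of 1 L2 1 LL] by simp
  show eq: "N * ?D * (L1 * L3) * (L2 * LL) = H / sqrt m"
    by (simp add: H_def real_sqrt_divide)
  have "N * ?D * (L1 * L3) * 1 \<le> N * ?D * (L1 * L3) * (L2 * LL)"
    using b N_ge_1 D L_ge_1 by (intro mult_left_mono mult_nonneg_nonneg[OF _ mult_nonneg_nonneg] mult_nonneg_nonneg[OF mult_nonneg_nonneg]) auto
  then show 1: "N * ?D * (L1 * L3) \<le> H / sqrt m" using eq by simp
  have "N * 1 * (L1 * L3) \<le> N * ?D * (L1 * L3)"
    using N_ge_1 D L13 by (intro mult_left_mono mult_right_mono) auto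
  with 1 show 2: "N * (L1 * L3) \<le> H / sqrt m" by simp
  have "N * 1 \<le> N * (L1 * L3)" "1 * (L1 * L3) \<le> N * (L1 * L3)"
    using N_ge_1 L13 by (intro mult_left_mono mult_right_mono; linarith)+
  with 2 N_ge_1 show "N \<le> H / sqrt m" "1 \<le> H / sqrt m" "L1 * L3 \<le> H / sqrt m" by linarith+
qed

text \<open>Covers the calls at m, m / 2 and m / 4, all of them charged to level m.\<close>

lemma nu_call_time_le:
  assumes m: "0 < m" "\<phi> \<le> 6400 * m" "m \<le> 1" and m': "m / 4 \<le> m'" "m' \<le> 1"
    and g: "m' \<le> \<mu> g" "0 \<le> g" "g \<le> \<zeta>"
  shows "real (snd (nu_call m' g)) \<le> (17 + 126 * Kc) * (H / sqrt m)"
proof -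
  have m'0: "0 < m'" using m m' by simp
  have "2 * \<zeta> / m' \<le> 2 * \<zeta> / (m / 4)" using m m' zeta1 by (intro divide_left_mono) auto
  then have "sqrt (2 * \<zeta> / m') \<le> sqrt (8 * (\<zeta> / m))" by simp
  \<comment> \<open>Enlarging 8 to 9 gives a rational root.\<close>
  also have "\<dots> \<le> sqrt (9 * (\<zeta> / m))"
    using m zeta1 by (intro real_sqrt_le_mono mult_right_mono) auto
  also have "\<dots> = 3 * sqrt (\<zeta> / m)" by (simp only: real_sqrt_mult) simp
  finally have s: "sqrt (2 * \<zeta> / m') \<le> 3 * sqrt (\<zeta> / m)" .
  have "Kc * N * sqrt (2 * \<zeta> / m') * lg (80 * \<zeta> ^ 3 / (m'\<^sup>2 * \<epsilon>)) \<le> Kc * N * (3 * sqrt (\<zeta> / m)) * (42 * (L1 * L3))"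
    using s lg_nu_le[OF m(1,2) m'(1)] Kc1 N_ge_1 m zeta1 lg_ge_1[of "80 * \<zeta> ^ 3 / (m'\<^sup>2 * \<epsilon>)"]
    by (intro mult_mono mult_left_mono) auto
  also have "\<dots> = 126 * Kc * (N * sqrt (\<zeta> / m) * (L1 * L3))" by simp
  also have "\<dots> \<le> 126 * Kc * (H / sqrt m)" using H_ge(2)[OF m(1,3)] Kc1 by (intro mult_left_mono) auto
  finally show ?thesis
    using nu_call_time[OF m'0 m'(2) g] H_ge(4)[OF m(1,3)] unfolding distrib_right by linarith
qed

lemma search_time_le:
  assumes m: "0 < m" "\<phi> \<le> 6400 * m" "m \<le> 1"
  shows "3 + real (inner_T m) * (1 + step_time m (p / real outer_T / real (inner_T m))) \<le> (307 + 1064 * Ke) * (H / sqrt m)"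
proof -
  let ?D = "sqrt (\<zeta> / m)"
  have D0: "0 \<le> ?D" using m zeta1 by simp
  have s: "sqrt (16 * \<zeta> / m) = 4 * ?D" by (simp add: real_sqrt_mult real_sqrt_divide)
  have "Ke * N * sqrt (16 * \<zeta> / m) * lg (real n / (p / real outer_T / real (inner_T m))) \<le> Ke * N * (4 * ?D) * (14 * (L2 * LL))"
    unfolding s using lg_eig_le[OF m(1,3,2)] Ke1 N_ge_1 D0 by (intro mult_left_mono) auto
  then have st: "step_time m (p / real outer_T / real (inner_T m)) \<le> 15 * N + 56 * Ke * (N * ?D * (L2 * LL))"
    by (simp add: step_time_def mult_ac)
  have z: "0 \<le> N * ?D * (L2 * LL)" using N_ge_1 D0 L_ge_1 by (intro mult_nonneg_nonneg) auto
  have "real (inner_T m) * (1 + step_time m (p / real outer_T / real (inner_T m))) \<le>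
      real (inner_T m) * (16 * N + 56 * Ke * (N * ?D * (L2 * LL)))"
    using st N_ge_1 by (intro mult_left_mono) auto
  also have "\<dots> \<le> 19 * (L1 * L3) * (16 * N + 56 * Ke * (N * ?D * (L2 * LL)))"
    using inner_T_le[OF m(1,3,2)] N_ge_1 mult_nonneg_nonneg[OF _ z, of "56 * Ke"] Ke1 by (intro mult_right_mono) auto
  also have "\<dots> = 304 * (N * (L1 * L3)) + 1064 * Ke * (N * ?D * (L1 * L3) * (L2 * LL))"
    by (simp add: algebra_simps)
  also have "\<dots> \<le> 304 * (H / sqrt m) + 1064 * Ke * (H / sqrt m)"
    using H_ge(3)[OF m(1,3)] Ke1 unfolding H_ge(1)[OF m(1,3)] by (intro add_mono mult_left_mono) auto
  finally show ?thesis using H_ge(5)[OF m(1,3)] unfolding distrib_right by linarith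
qed

end

section \<open>The main loop\<close>

context gtrs_run
begin

definition star_side :: "side \<Rightarrow> bool" where
  "star_side S \<longleftrightarrow> (case S of LeftSide \<Rightarrow> gamma_star P \<le> \<gamma>h | RightSide \<Rightarrow> \<gamma>h \<le> gamma_star P)"

text \<open>What iteration t leaves behind when it did not return: the sign of q1 still places
  \<open>gamma_star P\<close> beyond g. It serves twice, to bound \<open>mu_star P\<close> for the
  next iteration and to supply \<open>cr_end\<close> after the last one.\<close>

definition prev_ok :: "side \<Rightarrow> nat \<Rightarrow> real \<Rightarrow> real vec \<Rightarrow> real vec \<Rightarrow> bool" where
  "prev_ok S t g v x \<longleftrightarrow> near_sol (mt t / 2) g x \<and> side_sign S * q\<^sub>1 P x < - \<tau> \<and>
     v \<in> carrier_vec n \<and> vnorm v = 1 \<and> v \<bullet> (A_at P g *\<^sub>v v) \<le> mt t \<and>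
     left_end S \<le> g \<and> g \<le> right_end S \<and> \<mu> g \<le> mt t"

text \<open>Every search restarts from the same interval, so the condition can be stated in advance
  for all iterations, wherever the loop stops.\<close>

definition search_good :: "(nat \<times> nat \<Rightarrow> 's) \<Rightarrow> side \<Rightarrow> bool" where
  "search_good \<omega> S \<longleftrightarrow> (\<forall>t\<in>{1..outer_T}. loop_good eig P \<zeta> Ke \<omega> S (mt t)
     (p / real outer_T / real (inner_T (mt t))) t (inner_T (mt t)) 1 (left_end S) (right_end S))"

lemma mt_pos: "0 < mt t" and mt_Suc: "mt (Suc t) = mt t / 2" and mt_le: "1 \<le> t \<Longrightarrow> mt t \<le> \<xi> / 2"
proof -
  show "0 < mt t" "mt (Suc t) = mt t / 2" using xi0 by (auto simp: mt_def)
  assume t: "1 \<le> t"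
  have "(2 :: real) ^ 1 \<le> 2 ^ t" using t by (intro power_increasing) auto
  then show "mt t \<le> \<xi> / 2" unfolding mt_def using xi0 by (intro divide_left_mono) auto
qed

lemma side_sign_cases: "side_sign S = 1 \<or> side_sign S = - 1"
  by (cases S) auto

text \<open>Since \<mu> is negative at 0, the Lipschitz bound pushes g above m / 2. A shift by m / 4
  therefore stays nonnegative and leaves \<mu> at least m / 4.\<close>

lemma near_level:
  assumes "0 < m" "0 \<le> g" "m / 2 \<le> \<mu> g" "\<bar>g' - g\<bar> \<le> m / 4"
  shows "0 \<le> g'" "g' \<le> \<zeta>" "m / 4 \<le> \<mu> g'"
proof -
  have "m / 2 < g" using mu_lower[of g 0] mu_0_neg assms by simp
  then show 0: "0 \<le> g'" using assms by linarith
  show 1: "m / 4 \<le> \<mu> g'" using mu_lower[of g g'] assms by (simp add: abs_minus_commute)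
  show "g' \<le> \<zeta>" using le_zeta[OF 0] 1 assms by simp
qed

text \<open>The 1/8 in the success condition is the 1/4 of the output times the 1/2 of the last
  hypothesis, which reflects that the level before m was 2 m.\<close>

lemma regular_succeeds:
  assumes ns: "near_sol m' g x" and q: "\<tau> < side_sign S * q\<^sub>1 P x" and S: "star_side S"
    and m: "m / 4 \<le> m'" "0 < m" "m \<le> \<xi>" "min (mu_star P) \<xi> \<le> 2 * m"
  shows "succeeds P \<xi> \<epsilon> (regular_output \<gamma>h S g (m / 4))"
proof -
  have "m / 4 \<le> \<mu> g" using ns m by (simp add: near_sol_def)
  moreover have "m / 4 \<le> \<mu> \<gamma>h" using mu_gh m by linarith
  moreover have "case S of LeftSide \<Rightarrow> g \<le> gamma_star P | RightSide \<Rightarrow> gamma_star P \<le> g"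
    using gamma_star_ge[OF ns] gamma_star_le[OF ns] q by (cases S) auto
  ultimately show ?thesis
    using S m by (cases S) (auto simp: regular_output_def star_side_def)
qed

text \<open>The sign of q1 places \<open>gamma_star P\<close> on the side of g away from
  \<open>\<gamma>h\<close>, and \<mu> is already below \<xi> at g; quasiconcavity does the
  rest.\<close>

lemma prev_ok_mu_star:
  assumes "prev_ok S t g v x" "1 \<le> t"
  shows "mu_star P \<le> mt t"
proof -
  have ns: "near_sol (mt t / 2) g x" using assms by (simp add: prev_ok_def)
  have "gamma_star P \<le> g \<and> g \<le> \<gamma>h \<or> \<gamma>h \<le> g \<and> g \<le> gamma_star P"
    using assms gamma_star_ge[OF ns] gamma_star_le[OF ns]
    by (cases S) (auto simp: prev_ok_def left_end_def right_end_def)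
  moreover have "\<mu> g < \<xi>" using assms mt_le[OF assms(2)] xi0 by (simp add: prev_ok_def)
  ultimately show ?thesis using mu_star_le[of g] assms by (simp add: prev_ok_def)
qed

lemma mt_outer_T: "mt outer_T \<le> \<epsilon> * \<xi> ^ 4 / (3200 * \<zeta> ^ 4)"
  and mt_ge: "t \<le> outer_T \<Longrightarrow> \<epsilon> * \<xi> ^ 4 / \<zeta> ^ 4 \<le> 6400 * mt t"
proof -
  have pos: "0 < 3200 * \<zeta> ^ 4 / (\<epsilon> * \<xi> ^ 3)" using zeta1 eps0 xi0 by simp
  have "mt outer_T \<le> \<xi> / (3200 * \<zeta> ^ 4 / (\<epsilon> * \<xi> ^ 3))"
    unfolding mt_def using two_pow_outer_T(1) xi0 by (intro divide_left_mono mult_pos_pos pos) auto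
  also have "\<dots> = \<epsilon> * \<xi> ^ 4 / (3200 * \<zeta> ^ 4)" by (simp add: power_numeral_reduce)
  finally show "mt outer_T \<le> \<epsilon> * \<xi> ^ 4 / (3200 * \<zeta> ^ 4)" .
  assume t: "t \<le> outer_T"
  have "\<epsilon> * \<xi> ^ 4 / \<zeta> ^ 4 = 6400 * (\<xi> / (6400 * \<zeta> ^ 4 / (\<epsilon> * \<xi> ^ 3)))" by (simp add: power_numeral_reduce)
  also have "\<dots> \<le> 6400 * (\<xi> / 2 ^ outer_T)"
    using two_pow_outer_T(2) xi0 pos by (intro mult_left_mono divide_left_mono mult_pos_pos) auto
  also have "\<dots> \<le> 6400 * mt t"
    unfolding mt_def using t xi0 by (intro mult_left_mono divide_left_mono power_increasing) auto
  finally show "\<epsilon> * \<xi> ^ 4 / \<zeta> ^ 4 \<le> 6400 * mt t" .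
qed

lemma cr_end_correct:
  assumes ok: "prev_ok S outer_T g v x"
  shows "succeeds P \<xi> \<epsilon> (fst (cr_end P g v x))" and "real (snd (cr_end P g v x)) \<le> 50 * N"
proof -
  let ?m = "mt outer_T"
  have ns: "near_sol (?m / 2) g x" and q1: "side_sign S * q\<^sub>1 P x < - \<tau>"
    and v: "v \<in> carrier_vec n" "vnorm v = 1" "v \<bullet> (A_at P g *\<^sub>v v) \<le> ?m"
    and g: "left_end S \<le> g" "g \<le> right_end S" "\<mu> g \<le> ?m"
    using ok by (auto simp: prev_ok_def)
  have x: "x \<in> carrier_vec n" using ns by (simp add: near_sol_def)
  have m: "?m \<le> \<xi> / 2" using outer_T_pos by (intro mt_le) simp
  define w where "w = (if v \<bullet> (A_at P g *\<^sub>v x + b_at P g) \<le> 0 then v else - v)"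
  have w: "w \<in> carrier_vec n" using v by (simp add: w_def)
  have gx: "A_at P g *\<^sub>v x + b_at P g \<in> carrier_vec n" using x by simp
  have wn: "vnorm w = 1" using v by (simp add: w_def vnorm_def)
  have wA: "w \<bullet> (A_at P g *\<^sub>v w) \<le> ?m"
  proof -
    have "(- v) \<bullet> (- y) = v \<bullet> y" if "y \<in> carrier_vec n" for y using v(1) that by simp
    from this[OF mult_carrier(3)[OF v(1), of g]] show ?thesis
      using v mult_mat_vec_uminus[OF A_carrier[of g] v(1)] by (simp add: w_def)
  qed
  have wd: "w \<bullet> (A_at P g *\<^sub>v x + b_at P g) \<le> 0"
  proof -
    have "(- v) \<bullet> y = - (v \<bullet> y)" if "y \<in> carrier_vec n" for y using v(1) that by simp
    from this[OF gx] show ?thesis by (auto simp: w_def)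
  qed
  \<comment> \<open>\<open>\<mu> g\<close> is at most \<xi> / 2, whereas
    \<open>\<mu> \<gamma>h\<close> is at least \<xi>.\<close>
  have "g \<noteq> \<gamma>h" using g m mu_gh xi0 by auto
  then have side: "0 < side_sign S * (\<gamma>h - g)" using g by (cases S) (auto simp: left_end_def right_end_def)
  let ?\<alpha> = "SOME \<alpha>. 0 < \<alpha> \<and> q\<^sub>1 P (x + \<alpha> \<cdot>\<^sub>v w) = 0"
  have out: "fst (cr_end P g v x) = NotRegular (x + ?\<alpha> \<cdot>\<^sub>v w)"
    by (simp add: cr_end_def eval_A_def eval_b_def eval_mult_def eval_add_def eval_inner_def eval_q1_def
        eval_smult_def w_def)
  show "succeeds P \<xi> \<epsilon> (fst (cr_end P g v x))"
    unfolding out succeeds.simps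
    using q1 tau_bounds mt_pos[of outer_T] m mt_outer_T
    by (intro not_regular_optimizer[OF ns side_sign_cases _ side w wn wA _ _ _ wd refl]) auto
  have dims: "dim_row (A_at P g) = n" "dim_row (A\<^sub>1 P) = n" "dim_vec x = n" "dim_vec v = n" "dim_vec (b_at P g) = n"
    "dim_vec (b\<^sub>1 P) = n"
    using carrier_matD[OF A_carrier[of g]] carrier_matD[OF A1_carrier] x v
      carrier_vecD[OF b_carrier[of g]] carrier_vecD[OF b1_carrier] by auto
  have "snd (cr_end P g v x) \<le> (nnz (A\<^sub>0 P) + 2 * nnz (A\<^sub>1 P)) + 2 * n + (2 * nnz (A_at P g) + n) + n + 2 * n + (1 + n)
    + (2 * nnz (A\<^sub>1 P) + n) + 2 * n + (2 * nnz (A\<^sub>1 P) + n) + n + 2 * n + (2 * nnz (A\<^sub>1 P) + 4 * n + 3) + 10 + n + n"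
    by (simp add: cr_end_def eval_A_def eval_b_def eval_mult_def eval_add_def eval_inner_def eval_q1_def
        eval_smult_def dims)
  then have "real (snd (cr_end P g v x)) \<le> real ((nnz (A\<^sub>0 P) + 2 * nnz (A\<^sub>1 P)) + 2 * n + (2 * nnz (A_at P g) + n) + n + 2 * n + (1 + n)
    + (2 * nnz (A\<^sub>1 P) + n) + 2 * n + (2 * nnz (A\<^sub>1 P) + n) + n + 2 * n + (2 * nnz (A\<^sub>1 P) + 4 * n + 3) + 10 + n + n)"
    by (simp only: of_nat_le_iff)
  also have "\<dots> = real (nnz (A\<^sub>0 P)) + 8 * real (nnz (A\<^sub>1 P)) + 2 * real (nnz (A_at P g)) + 20 * real n + 14"
    by simp
  also have "\<dots> \<le> 50 * N"
    using nnz_A_at[of g] N_ge_n N_ge_1 nnz0_le of_nat_0_le_iff[of "nnz (A\<^sub>0 P)", where 'a = real] by linarith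
  finally show "real (snd (cr_end P g v x)) \<le> 50 * N" .
qed

section \<open>Time accounting for the main loop\<close>

definition iter_const :: real where "iter_const = 357 + 1064 * Ke + 252 * Kc"

text \<open>At the executed levels 1 / sqrt m is at most 80 / sqrt \<phi>. The choice of 300 gives
  3/2 * 80 = 2/5 * 300, so that the remaining budget of the loop is still nonnegative one level
  further down.\<close>

definition level_bound :: real where "level_bound = 300 / sqrt \<phi>"

lemma level_bound_ge:
  assumes "\<phi> \<le> 6400 * m" "0 < m"
  shows "300 / 80 * (1 / sqrt m) \<le> level_bound"
proof -
  have "sqrt \<phi> \<le> sqrt (6400 * m)" using assms by simp
  also have "\<dots> = 80 * sqrt m" by (simp add: real_sqrt_mult)
  finally have "300 / (80 * sqrt m) \<le> 300 / sqrt \<phi>" using assms phi_pos by (intro divide_left_mono) auto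
  then show ?thesis by (simp add: level_bound_def)
qed

text \<open>Rational bounds around sqrt 2. The lower one satisfies 5/2 * (7/5 - 1) = 1, which
  releases one unit of cost per iteration.\<close>

lemma sqrt_mt_Suc:
  "7 / 5 * (1 / sqrt (mt t)) \<le> 1 / sqrt (mt (Suc t))" "1 / sqrt (mt (Suc t)) \<le> 3 / 2 * (1 / sqrt (mt t))"
proof -
  have eq: "1 / sqrt (mt (Suc t)) = sqrt 2 * (1 / sqrt (mt t))"
    using mt_pos[of t] by (simp add: mt_Suc real_sqrt_divide)
  have "7 / 5 \<le> sqrt (2 :: real)" by (rule real_le_rsqrt) (simp add: power2_eq_square)
  moreover have "sqrt (2 :: real) \<le> 3 / 2" by (rule real_le_lsqrt) (auto simp: power2_eq_square)
  ultimately show "7 / 5 * (1 / sqrt (mt t)) \<le> 1 / sqrt (mt (Suc t))" "1 / sqrt (mt (Suc t)) \<le> 3 / 2 * (1 / sqrt (mt t))"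
    unfolding eq using mt_pos[of t] by (intro mult_right_mono; simp)+
qed

text \<open>The running time bound telescopes: one iteration at level \<open>mt t\<close> costs at most a multiple of
  \<open>1 / sqrt (mt t)\<close>, which is at most \<open>5/2\<close> times the increase of this quantity in the next iteration.\<close>

lemma cr_loop_correct:
  assumes good: "search_good \<omega> S" and S: "star_side S"
    and "t + k = Suc outer_T" "1 \<le> t" "t = 1 \<and> 0 < k \<or> 2 \<le> t \<and> prev_ok S (t - 1) g v x"
    and "1 / sqrt (mt t) \<le> 2 / 5 * level_bound"
  shows "succeeds P \<xi> \<epsilon> (fst (cr_loop eig cg P \<xi> \<zeta> \<gamma>h p \<omega> S \<tau> outer_T k t g v x)) \<and>
    real (snd (cr_loop eig cg P \<xi> \<zeta> \<gamma>h p \<omega> S \<tau> outer_T k t g v x)) \<le>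
      iter_const * H * (level_bound - 5 / 2 * (1 / sqrt (mt t))) + 50 * N"
  using assms(3-)
proof (induction k arbitrary: t g v x)
  case 0
  then have ok: "prev_ok S outer_T g v x" by auto
  have "0 \<le> iter_const * H * (level_bound - 5 / 2 * (1 / sqrt (mt t)))"
    using 0(4) Ke1 Kc1 N_ge_1 zeta1 L_ge_1 by (intro mult_nonneg_nonneg) (auto simp: iter_const_def H_def)
  then show ?case using cr_end_correct[OF ok] by simp
next
  case (Suc k)
  define m where "m = mt t"
  have tT: "t \<in> {1..outer_T}" using Suc.prems by auto
  have m: "0 < m" "m \<le> \<xi> / 2" using mt_pos mt_le Suc.prems by (auto simp: m_def)
  then have m1: "m \<le> 1" "m < \<xi>" using xi0 xi1 by auto
  \<comment> \<open>At t = 1 the bound is \<xi> = 2 m itself; later 2 m is the previous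
    level.\<close>
  have min2: "min (mu_star P) \<xi> \<le> 2 * m"
  proof (cases "t = 1")
    case True
    then show ?thesis by (simp add: m_def mt_def)
  next
    case False
    then have "mu_star P \<le> mt (t - 1)" using Suc.prems by (intro prev_ok_mu_star) auto
    also have "mt (t - 1) = 2 * m" using False Suc.prems mt_Suc[of "t - 1"] by (simp add: m_def)
    finally show ?thesis by simp
  qed
  have phi: "\<phi> \<le> 6400 * m"
    using min2 mt_ge[of t] tT m by (simp add: \<phi>_def m_def)
  define p' where "p' = p / real outer_T"
  have p': "0 < p'" using p0 outer_T_pos by (simp add: p'_def)
  define ag where "ag = approx_gamma eig P \<zeta> \<gamma>h \<omega> S m p' t"
  have lg: "loop_good eig P \<zeta> Ke \<omega> S m (p' / real (inner_T m)) t (inner_T m) 1 (left_end S) (right_end S)"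
    using good tT by (simp add: search_good_def m_def p'_def)
  have ag_res: "search_result m (left_end S) (right_end S) (fst ag)"
    unfolding ag_def by (rule approx_gamma_correct(1)[OF lg m(1) m1(2) p'])
  have ag_time: "real (snd ag) \<le> (307 + 1064 * Ke) * (H / sqrt m)"
    using order_trans[OF approx_gamma_correct(2)[OF lg m(1) m1(2) p'] search_time_le[OF m(1) phi m1(1), folded p'_def]]
    by (simp add: ag_def)
  obtain g1 v1 where ag_eq: "fst ag = Some (g1, v1)" and g1: "left_end S \<le> g1" "g1 \<le> right_end S"
    and v1: "v1 \<in> carrier_vec n" "vnorm v1 = 1" "v1 \<bullet> (A_at P g1 *\<^sub>v v1) \<le> m" and mu1: "m / 2 \<le> \<mu> g1" "\<mu> g1 \<le> m"
    using ag_res by (auto simp: search_result_def)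
  have g1r: "0 \<le> g1" "g1 \<le> \<zeta>" using g1 end_range[of S] by auto
  define nc where "nc = nu_call (m / 2) g1"
  define x1 where "x1 = fst (fst nc)"
  have mh: "0 < m / 2" "m / 2 \<le> 1" "m / 4 \<le> m / 2" using m m1 by auto
  have ns: "near_sol (m / 2) g1 x1" and nv: "snd (fst nc) = q\<^sub>1 P x1"
    using nu_call_near_sol[OF mh(1,2) mu1(1) g1r] nu_call_value[OF mh(1,2) mu1(1) g1r] by (simp_all add: nc_def x1_def)
  have nt: "real (snd nc) \<le> (17 + 126 * Kc) * (H / sqrt m)"
    unfolding nc_def by (rule nu_call_time_le[OF m(1) phi m1(1) mh(3,2) mu1(1) g1r])
  define g2 where "g2 = g1 - side_sign S * (m / 4)"
  have "\<bar>g2 - g1\<bar> \<le> m / 4" using m by (cases S) (auto simp: g2_def)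
  note g2 = near_level[OF m(1) g1r(1) mu1(1) this]
  \<comment> \<open>Named before it is known whether the branch is reached; its contract holds in
    any case, since the shifted multiplier stays in range.\<close>
  define nc' where "nc' = nu_call (m / 4) g2"
  have mq: "0 < m / 4" "m / 4 \<le> 1" "m / 4 \<le> m / 4" using m m1 by auto
  have ns': "near_sol (m / 4) g2 (fst (fst nc'))" and nv': "snd (fst nc') = q\<^sub>1 P (fst (fst nc'))"
    using nu_call_near_sol[OF mq(1,2) g2(3,1,2)] nu_call_value[OF mq(1,2) g2(3,1,2)] by (simp_all add: nc'_def)
  have nt': "real (snd nc') \<le> (17 + 126 * Kc) * (H / sqrt m)"
    unfolding nc'_def by (rule nu_call_time_le[OF m(1) phi m1(1) mq(3,2) g2(3,1,2)])
  have H1: "1 \<le> H / sqrt m" by (rule H_ge(5)[OF m(1) m1(1)])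
  let ?\<nu> = "q\<^sub>1 P x1"
  let ?R = "cr_loop eig cg P \<xi> \<zeta> \<gamma>h p \<omega> S \<tau> outer_T (Suc k) t g v x"
  let ?R' = "cr_loop eig cg P \<xi> \<zeta> \<gamma>h p \<omega> S \<tau> outer_T k (Suc t) g1 v1 x1"
  define c where "c = 9 + snd ag + snd nc"
  define inner where "inner = (if side_sign S * ?\<nu> - \<tau> > 0 then cost 1 (regular_output \<gamma>h S g1 (m / 4))
     else if - \<tau> \<le> ?\<nu> \<and> ?\<nu> \<le> \<tau> then
       (if side_sign S * snd (fst nc') - \<tau> > 0 then cost (7 + snd nc') (regular_output \<gamma>h S g2 (m / 4))
        else cost (6 + snd nc') (MaybeRegular x1))
     else ?R')"
  have g2': "g1 - side_sign S * m / 4 = g2" by (simp add: g2_def)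
  have unf: "fst ?R = fst inner" "snd ?R = c + snd inner"
    by (simp_all add: ag_def[unfolded m_def p'_def, symmetric] ag_eq inner_def c_def nc_def[unfolded nu_call_def, symmetric]
        nc'_def[unfolded nu_call_def, symmetric] m_def[symmetric] mt_def[of t, symmetric] split_beta nv x1_def[symmetric] g2'
        p'_def[symmetric] ag_def[symmetric])
  have c: "real c \<le> (9 + (307 + 1064 * Ke) + (17 + 126 * Kc)) * (H / sqrt m)"
    using ag_time nt H1 unfolding c_def distrib_right by simp
  have const: "iter_const * (H / sqrt m) = (9 + (307 + 1064 * Ke) + (17 + 126 * Kc)) * (H / sqrt m) +
      (17 + 126 * Kc) * (H / sqrt m) + 7 * (H / sqrt m)"
    by (simp add: iter_const_def algebra_simps add_divide_distrib)
  have B0: "0 \<le> iter_const * H"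
    using Ke1 Kc1 N_ge_1 zeta1 L_ge_1 by (intro mult_nonneg_nonneg) (auto simp: iter_const_def H_def)
  have lb: "300 / 80 * (1 / sqrt m) \<le> level_bound" by (rule level_bound_ge[OF phi m(1)])
  have Kc0: "0 \<le> (17 + 126 * Kc) * (H / sqrt m)" using nt of_nat_0_le_iff order_trans by blast
  show ?case
  proof (cases "side_sign S * ?\<nu> - \<tau> > 0 \<or> - \<tau> \<le> ?\<nu> \<and> ?\<nu> \<le> \<tau>")
    case True
    have "succeeds P \<xi> \<epsilon> (fst inner)"
      using True regular_succeeds[OF ns _ S mh(3) m(1) _ min2] regular_succeeds[OF ns' _ S mq(3) m(1) _ min2] m1
        near_sol_optimizer[OF ns]
      by (auto simp: inner_def nv')
    moreover have "real (snd inner) \<le> (17 + 126 * Kc) * (H / sqrt m) + 7 * (H / sqrt m)"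
      using True nt' H1 Kc0 by (auto simp: inner_def)
    then have "real (snd ?R) \<le> iter_const * (H / sqrt m)"
      unfolding unf const using c by simp
    \<comment> \<open>A last iteration is paid for by the remaining budget, as 300/80 \<ge> 1 +
      5/2.\<close>
    moreover have "iter_const * H * (1 / sqrt m) \<le> iter_const * H * (level_bound - 5 / 2 * (1 / sqrt m))"
      using lb B0 m by (intro mult_left_mono) (auto simp: field_simps)
    ultimately show ?thesis unfolding unf m_def[symmetric] using N_ge_1 by simp
  next
    case False
    then have inner: "inner = ?R'" by (auto simp: inner_def)
    \<comment> \<open>Neither beyond nor near leaves only the opposite sign by more than \<tau>, for
      both values of \<open>side_sign S\<close>.\<close>
    have q: "side_sign S * ?\<nu> < - \<tau>" using False by (cases S) auto
    have r: "1 / sqrt (mt (Suc t)) \<le> 2 / 5 * level_bound"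
      using sqrt_mt_Suc(2)[of t] lb by (simp add: m_def)
    have "prev_ok S (Suc t - 1) g1 v1 x1"
      using ns q v1 g1 mu1 by (simp add: prev_ok_def m_def)
    then have IH: "succeeds P \<xi> \<epsilon> (fst ?R')" "real (snd ?R') \<le>
        iter_const * H * (level_bound - 5 / 2 * (1 / sqrt (mt (Suc t)))) + 50 * N"
      using Suc.IH[of "Suc t" g1 v1 x1] Suc.prems r by auto
    have "iter_const * H * (1 / sqrt m + (level_bound - 5 / 2 * (1 / sqrt (mt (Suc t)))))
        \<le> iter_const * H * (level_bound - 5 / 2 * (1 / sqrt m))"
      using sqrt_mt_Suc(1)[of t] B0 by (intro mult_left_mono) (auto simp: m_def)
    moreover have "real c \<le> iter_const * (H / sqrt m)" using c Kc0 H1 unfolding const by linarith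
    ultimately show ?thesis unfolding unf inner m_def[symmetric] using IH by (simp add: algebra_simps)
  qed
qed

section \<open>The three branches and the whole algorithm\<close>

lemma cr_side_correct:
  assumes good: "search_good \<omega> S" and S: "star_side S"
  shows "succeeds P \<xi> \<epsilon> (fst (cr_side eig cg P \<xi> \<zeta> \<gamma>h \<epsilon> p \<omega> S \<tau>))"
    and "real (snd (cr_side eig cg P \<xi> \<zeta> \<gamma>h \<epsilon> p \<omega> S \<tau>)) \<le> 10 + 17 * L3 + iter_const * H * level_bound + 50 * N"
proof -
  let ?R = "cr_loop eig cg P \<xi> \<zeta> \<gamma>h p \<omega> S \<tau> outer_T outer_T 1 \<gamma>h (0\<^sub>v n) (0\<^sub>v n)"
  have unf: "fst (cr_side eig cg P \<xi> \<zeta> \<gamma>h \<epsilon> p \<omega> S \<tau>) = fst ?R"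
    "snd (cr_side eig cg P \<xi> \<zeta> \<gamma>h \<epsilon> p \<omega> S \<tau>) = 10 + outer_T + snd ?R"
    by (simp_all add: cr_side_def eval_ceil_log_def Let_def outer_T_def)
  \<comment> \<open>The level before the loop is \<xi> \<ge> \<phi>; one halving gives the budget
    condition at t = 1.\<close>
  have m0: "1 / sqrt (mt 0) \<le> 80 / 300 * level_bound"
    using level_bound_ge[of "mt 0"] phi_le_xi xi0 by (simp add: mt_def)
  have m1: "1 / sqrt (mt 1) \<le> 2 / 5 * level_bound"
    using sqrt_mt_Suc(2)[of 0] m0 by simp
  have R: "succeeds P \<xi> \<epsilon> (fst ?R)" "real (snd ?R) \<le> iter_const * H * (level_bound - 5 / 2 * (1 / sqrt (mt 1))) + 50 * N"
    using cr_loop_correct[OF good S, of 1 outer_T] outer_T_pos m1 by auto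
  show "succeeds P \<xi> \<epsilon> (fst (cr_side eig cg P \<xi> \<zeta> \<gamma>h \<epsilon> p \<omega> S \<tau>))" using R unf by simp
  have "0 \<le> iter_const * H"
    using Ke1 Kc1 N_ge_1 zeta1 L_ge_1 by (intro mult_nonneg_nonneg) (auto simp: iter_const_def H_def)
  then have "iter_const * H * (level_bound - 5 / 2 * (1 / sqrt (mt 1))) \<le> iter_const * H * level_bound"
    using mt_pos[of 1] by (intro mult_left_mono) auto
  then show "real (snd (cr_side eig cg P \<xi> \<zeta> \<gamma>h \<epsilon> p \<omega> S \<tau>)) \<le> 10 + 17 * L3 + iter_const * H * level_bound + 50 * N"
    unfolding unf using R(2) outer_T_le by simp
qed

text \<open>Shifts by \<xi> / 2 leave \<mu> at least \<xi> / 2, and certified opposite signs at the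
  two shifted points enclose \<open>gamma_star P\<close>. Otherwise \<open>x0\<close> is returned,
  and its small value of q1 makes it nearly optimal by weak duality.\<close>

lemma cr_mid_correct:
  assumes ns: "near_sol \<xi> \<gamma>h x0" and q: "- \<tau> \<le> q\<^sub>1 P x0" "q\<^sub>1 P x0 \<le> \<tau>"
  shows "succeeds P \<xi> \<epsilon> (fst (cr_mid cg P \<xi> \<zeta> \<gamma>h \<tau> x0))"
    and "real (snd (cr_mid cg P \<xi> \<zeta> \<gamma>h \<tau> x0)) \<le> 9 + 2 * (17 + 126 * Kc) * (H / sqrt \<xi>)"
proof -
  have phi: "\<phi> \<le> 6400 * \<xi>" using phi_le_xi xi0 by simp
  have xh: "0 < \<xi> / 2" "\<xi> / 2 \<le> 1" "\<xi> / 4 \<le> \<xi> / 2" using xi0 xi1 by auto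
  have mu: "\<xi> / 2 \<le> \<mu> (\<gamma>h - \<xi> / 2)" "\<xi> / 2 \<le> \<mu> (\<gamma>h + \<xi> / 2)"
    using mu_lower[of \<gamma>h "\<gamma>h - \<xi> / 2"] mu_lower[of \<gamma>h "\<gamma>h + \<xi> / 2"] mu_gh xi0 by auto
  have r1: "0 \<le> \<gamma>h - \<xi> / 2" "\<gamma>h - \<xi> / 2 \<le> \<zeta>" using mu_pos_range[of "\<gamma>h - \<xi> / 2"] mu xi0 by auto
  have r2: "0 \<le> \<gamma>h + \<xi> / 2" "\<gamma>h + \<xi> / 2 \<le> \<zeta>" using mu_pos_range[of "\<gamma>h + \<xi> / 2"] mu xi0 by auto
  define n1 where "n1 = nu_call (\<xi> / 2) (\<gamma>h - \<xi> / 2)"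
  define n2 where "n2 = nu_call (\<xi> / 2) (\<gamma>h + \<xi> / 2)"
  note ns1 = nu_call_near_sol[OF xh(1,2) mu(1) r1, folded n1_def] and v1 = nu_call_value[OF xh(1,2) mu(1) r1, folded n1_def]
  note ns2 = nu_call_near_sol[OF xh(1,2) mu(2) r2, folded n2_def] and v2 = nu_call_value[OF xh(1,2) mu(2) r2, folded n2_def]
  have t1: "real (snd n1) \<le> (17 + 126 * Kc) * (H / sqrt \<xi>)"
    unfolding n1_def by (rule nu_call_time_le[OF xi0 phi xi1 xh(3,2) mu(1) r1])
  have t2: "real (snd n2) \<le> (17 + 126 * Kc) * (H / sqrt \<xi>)"
    unfolding n2_def by (rule nu_call_time_le[OF xi0 phi xi1 xh(3,2) mu(2) r2])
  have unf: "fst (cr_mid cg P \<xi> \<zeta> \<gamma>h \<tau> x0) = (if snd (fst n1) - \<tau> > 0 \<and> 0 > snd (fst n2) + \<tau>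
      then Regular (\<gamma>h - \<xi> / 2) (\<gamma>h + \<xi> / 2) (\<xi> / 2) else MaybeRegular x0)"
    "snd (cr_mid cg P \<xi> \<zeta> \<gamma>h \<tau> x0) \<le> 9 + snd n1 + snd n2"
    by (simp_all add: cr_mid_def n1_def[unfolded nu_call_def, symmetric] n2_def[unfolded nu_call_def, symmetric] split_beta)
  show "real (snd (cr_mid cg P \<xi> \<zeta> \<gamma>h \<tau> x0)) \<le> 9 + 2 * (17 + 126 * Kc) * (H / sqrt \<xi>)"
    using unf(2) t1 t2 by linarith
  show "succeeds P \<xi> \<epsilon> (fst (cr_mid cg P \<xi> \<zeta> \<gamma>h \<tau> x0))"
    using near_sol_optimizer[OF ns q] gamma_star_ge[OF ns1] gamma_star_le[OF ns2] mu xi0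
    by (auto simp: unf(1) v1 v2)
qed

definition total_const :: real where "total_const = 500 + 600 * iter_const + 1000 * Kc"

text \<open>Determined by the deterministic first call, hence fixed before the seeds: only one side
  has to be good, and the failure probability is not doubled.\<close>

definition start_side :: side where
  "start_side = (if q\<^sub>1 P (fst (fst (nu_call \<xi> \<gamma>h))) + \<tau> < 0 then LeftSide else RightSide)"

lemma construct_reform_correct:
  assumes good: "search_good \<omega> start_side"
  shows "succeeds P \<xi> \<epsilon> (fst (construct_reform eig cg P \<xi> \<zeta> \<gamma>h \<epsilon> p \<omega>))"
    and "real (snd (construct_reform eig cg P \<xi> \<zeta> \<gamma>h \<epsilon> p \<omega>)) \<le> total_const * (H / sqrt \<phi>)"
proof -
  define nc where "nc = nu_call \<xi> \<gamma>h"
  define x0 where "x0 = fst (fst nc)"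
  have ns: "near_sol \<xi> \<gamma>h x0" and nv: "snd (fst nc) = q\<^sub>1 P x0"
    using nu_call_near_sol[OF xi0 xi1 mu_gh gh0 gh_le_zeta] nu_call_value[OF xi0 xi1 mu_gh gh0 gh_le_zeta]
    by (simp_all add: nc_def x0_def)
  have phi: "\<phi> \<le> 6400 * \<xi>" using phi_le_xi xi0 by simp
  have nt: "real (snd nc) \<le> (17 + 126 * Kc) * (H / sqrt \<xi>)"
    unfolding nc_def using xi0 by (intro nu_call_time_le[OF xi0 phi xi1 _ xi1 mu_gh gh0 gh_le_zeta]) simp
  define rest where "rest = (if q\<^sub>1 P x0 + \<tau> < 0 then cr_side eig cg P \<xi> \<zeta> \<gamma>h \<epsilon> p \<omega> LeftSide \<tau>
    else if q\<^sub>1 P x0 - \<tau> > 0 then cr_side eig cg P \<xi> \<zeta> \<gamma>h \<epsilon> p \<omega> RightSide \<tau>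
    else cr_mid cg P \<xi> \<zeta> \<gamma>h \<tau> x0)"
  have unf: "fst (construct_reform eig cg P \<xi> \<zeta> \<gamma>h \<epsilon> p \<omega>) = fst rest"
    "snd (construct_reform eig cg P \<xi> \<zeta> \<gamma>h \<epsilon> p \<omega>) = 6 + snd nc + snd rest"
    by (simp_all add: construct_reform_def \<tau>_def[symmetric] nc_def[unfolded nu_call_def, symmetric] split_beta nv
        x0_def[symmetric] rest_def)
  have goodL: "search_good \<omega> LeftSide" if "q\<^sub>1 P x0 + \<tau> < 0"
    using good that by (simp add: start_side_def x0_def nc_def)
  have goodR: "search_good \<omega> RightSide" if "\<not> q\<^sub>1 P x0 + \<tau> < 0"
    using good that by (simp add: start_side_def x0_def nc_def)
  have left: "star_side LeftSide" if "q\<^sub>1 P x0 + \<tau> < 0" using gamma_star_le[OF ns] that by (simp add: star_side_def)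
  have right: "star_side RightSide" if "q\<^sub>1 P x0 - \<tau> > 0" using gamma_star_ge[OF ns] that by (simp add: star_side_def)
  show "succeeds P \<xi> \<epsilon> (fst (construct_reform eig cg P \<xi> \<zeta> \<gamma>h \<epsilon> p \<omega>))"
    unfolding unf rest_def
    using cr_side_correct(1)[OF goodL left] cr_side_correct(1)[OF goodR right] cr_mid_correct(1)[OF ns] by auto
  let ?h = "H / sqrt \<phi>"
  have phi1: "\<phi> \<le> 1" using phi_le_xi xi1 by simp
  have h: "1 \<le> ?h" "N \<le> ?h" "L1 * L3 \<le> ?h" using H_ge[OF phi_pos phi1] by auto
  then have L3h: "L3 \<le> ?h" using L13 by linarith
  have H0: "0 \<le> H" using N_ge_1 zeta1 L_ge_1 by (auto simp: H_def)
  have hx: "H / sqrt \<xi> \<le> ?h" using phi_le_xi phi_pos xi0 H0 by (intro divide_left_mono) auto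
  have ic: "0 \<le> iter_const" using Ke1 Kc1 by (simp add: iter_const_def)
  have lb: "iter_const * H * level_bound = 300 * (iter_const * ?h)" by (simp add: level_bound_def)
  have Kh: "(17 + 126 * Kc) * (H / sqrt \<xi>) \<le> (17 + 126 * Kc) * ?h" using hx Kc1 by (intro mult_left_mono) auto
  have ich: "0 \<le> iter_const * ?h" "0 \<le> Kc * ?h" using ic h Kc1 by (intro mult_nonneg_nonneg; linarith)+
  have "real (snd rest) \<le> 77 * ?h + 300 * (iter_const * ?h) + 2 * ((17 + 126 * Kc) * ?h)"
  proof -
    have "real (snd rest) \<le> 10 + 17 * L3 + iter_const * H * level_bound + 50 * N \<or>
        real (snd rest) \<le> 9 + 2 * (17 + 126 * Kc) * (H / sqrt \<xi>)"
      unfolding rest_def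
      using cr_side_correct(2)[OF goodL left] cr_side_correct(2)[OF goodR right] cr_mid_correct(2)[OF ns] by auto
    moreover have "0 \<le> (17 + 126 * Kc) * ?h" using h Kc1 by (intro mult_nonneg_nonneg) auto
    ultimately show ?thesis using h L3h ich Kh using lb unfolding mult.assoc by (elim disjE) linarith+
  qed
  then have "real (snd (construct_reform eig cg P \<xi> \<zeta> \<gamma>h \<epsilon> p \<omega>)) \<le>
      6 * ?h + 77 * ?h + 300 * (iter_const * ?h) + 3 * ((17 + 126 * Kc) * ?h)"
    unfolding unf using nt Kh h by simp
  also have "\<dots> = 134 * ?h + 300 * (iter_const * ?h) + 378 * (Kc * ?h)" by (simp add: algebra_simps)
  also have "\<dots> \<le> 500 * ?h + 600 * (iter_const * ?h) + 1000 * (Kc * ?h)"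
    using h ich by (intro add_mono mult_right_mono) auto
  also have "\<dots> = total_const * ?h" by (simp add: total_const_def algebra_simps)
  finally show "real (snd (construct_reform eig cg P \<xi> \<zeta> \<gamma>h \<epsilon> p \<omega>)) \<le> total_const * (H / sqrt \<phi>)" .
qed

end

section \<open>The probability of a good run\<close>

text \<open>The coordinates of a product space are independent; grouping them into
  \<open>{i}\<close> and \<open>J\<close> gives an independent pair. \<open>J\<close> may be
  infinite, as are the sets of later seeds of a search.\<close>

lemma (in prob_space) seeds_indep:
  fixes i :: "nat \<times> nat"
  assumes i: "i \<notin> J" and X: "X \<in> sets M" and H: "H \<in> sets (\<Pi>\<^sub>M j\<in>J. M)"
  shows "measure (seeds M) {\<omega> \<in> space (seeds M). \<omega> i \<in> X \<and> restrict \<omega> J \<in> H} =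
    measure M X * measure (seeds M) {\<omega> \<in> space (seeds M). restrict \<omega> J \<in> H}"
proof -
  interpret S: prob_space "seeds M"
    unfolding seeds_def by (intro prob_space_PiM prob_space_axioms)
  interpret PP: product_prob_space "\<lambda>_ :: nat \<times> nat. M" UNIV
    by unfold_locales
  have comp: "distr (seeds M) M (\<lambda>\<omega>. \<omega> j) = M" for j
    unfolding seeds_def by (rule PP.PiM_component) simp
  have "S.indep_vars (\<lambda>_. M) (\<lambda>j \<omega>. \<omega> j) UNIV"
  proof (subst S.indep_vars_iff_distr_eq_PiM')
    show "distr (seeds M) (\<Pi>\<^sub>M j\<in>UNIV. M) (\<lambda>x. \<lambda>j\<in>UNIV. x j) = (\<Pi>\<^sub>M j\<in>UNIV. distr (seeds M) M (\<lambda>\<omega>. \<omega> j))"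
      unfolding comp by (simp add: seeds_def distr_id2 restrict_def cong: PiM_cong)
  qed (auto simp: seeds_def)
  then have "S.indep_var (\<Pi>\<^sub>M j\<in>{i}. M) (\<lambda>\<omega>. restrict (\<lambda>j. \<omega> j) {i}) (\<Pi>\<^sub>M j\<in>J. M) (\<lambda>\<omega>. restrict (\<lambda>j. \<omega> j) J)"
    by (rule S.indep_var_restrict) (use i in auto)
  from S.indep_varD[OF this, of "(\<lambda>f. f i) -` X \<inter> space (\<Pi>\<^sub>M j\<in>{i}. M)" H] H X
  have eq: "measure (seeds M) ((\<lambda>\<omega>. (restrict \<omega> {i}, restrict \<omega> J)) -`
        (((\<lambda>f. f i) -` X \<inter> space (\<Pi>\<^sub>M j\<in>{i}. M)) \<times> H) \<inter> space (seeds M)) =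
      measure (seeds M) ((\<lambda>\<omega>. restrict \<omega> {i}) -` ((\<lambda>f. f i) -` X \<inter> space (\<Pi>\<^sub>M j\<in>{i}. M)) \<inter> space (seeds M)) *
      measure (seeds M) ((\<lambda>\<omega>. restrict \<omega> J) -` H \<inter> space (seeds M))"
    by (simp add: measurable_sets[OF measurable_component_singleton])
  have sp: "restrict \<omega> {i} \<in> space (\<Pi>\<^sub>M j\<in>{i}. M)" if "\<omega> \<in> space (seeds M)" for \<omega>
    using that by (cases i) (auto simp: seeds_def space_PiM PiE_iff)
  have "measure M X = measure (distr (seeds M) M (\<lambda>\<omega>. \<omega> i)) X" by (simp add: comp)
  also have "\<dots> = measure (seeds M) ((\<lambda>\<omega>. \<omega> i) -` X \<inter> space (seeds M))"
    using X by (intro measure_distr) (auto simp: seeds_def)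
  finally have mX: "measure M X = measure (seeds M) ((\<lambda>\<omega>. \<omega> i) -` X \<inter> space (seeds M))" .
  have "(\<lambda>\<omega>. restrict \<omega> {i}) -` ((\<lambda>f. f i) -` X \<inter> space (\<Pi>\<^sub>M j\<in>{i}. M)) \<inter> space (seeds M) = (\<lambda>\<omega>. \<omega> i) -` X \<inter> space (seeds M)"
    using sp by auto
  moreover have "(\<lambda>\<omega>. (restrict \<omega> {i}, restrict \<omega> J)) -` (((\<lambda>f. f i) -` X \<inter> space (\<Pi>\<^sub>M j\<in>{i}. M)) \<times> H) \<inter> space (seeds M) =
      {\<omega> \<in> space (seeds M). \<omega> i \<in> X \<and> restrict \<omega> J \<in> H}"
    using sp by auto
  moreover have "(\<lambda>\<omega>. restrict \<omega> J) -` H \<inter> space (seeds M) = {\<omega> \<in> space (seeds M). restrict \<omega> J \<in> H}" by auto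
  ultimately show ?thesis using eq mX by simp
qed

text \<open>\<open>L\<close> itself need not be measurable, so a measurable \<open>H\<close> inside
  it carries the probability bound. Letting \<open>H\<close> depend on the seeds in \<open>J\<close>
  only is what allows the product rule with a seed outside \<open>J\<close>.\<close>

definition seed_event :: "'s measure \<Rightarrow> (nat \<times> nat) set \<Rightarrow> real \<Rightarrow> ((nat \<times> nat \<Rightarrow> 's) \<Rightarrow> bool) \<Rightarrow> bool" where
  "seed_event M J q L \<longleftrightarrow> (\<exists>H\<in>sets (\<Pi>\<^sub>M j\<in>J. M). q \<le> measure (seeds M) {\<omega> \<in> space (seeds M). restrict \<omega> J \<in> H} \<and>
     (\<forall>\<omega>\<in>space (seeds M). restrict \<omega> J \<in> H \<longrightarrow> L \<omega>))"

text \<open>The event required of the later seeds depends on the value of \<open>\<omega> i\<close>; this is how the search chooses its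
  next matrix adaptively.\<close>

lemma (in prob_space) seed_event_branch:
  assumes i: "i \<notin> J" and sets: "U \<in> sets M" "V \<in> sets M" "W \<in> sets M"
    and disj: "U \<inter> V = {}" "U \<inter> W = {}" "V \<inter> W = {}"
    and q: "0 \<le> q" "q \<le> 1" and L1: "seed_event M J q L1" and L2: "seed_event M J q L2"
  shows "seed_event M (insert i J) (measure M (U \<union> V \<union> W) * q)
    (\<lambda>\<omega>. \<omega> i \<in> U \<and> L1 \<omega> \<or> \<omega> i \<in> V \<and> L2 \<omega> \<or> \<omega> i \<in> W)"
proof -
  interpret S: prob_space "seeds M"
    unfolding seeds_def by (intro prob_space_PiM prob_space_axioms)
  obtain H1 where H1: "H1 \<in> sets (\<Pi>\<^sub>M j\<in>J. M)" "q \<le> measure (seeds M) {\<omega> \<in> space (seeds M). restrict \<omega> J \<in> H1}"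
    "\<And>\<omega>. \<omega> \<in> space (seeds M) \<Longrightarrow> restrict \<omega> J \<in> H1 \<Longrightarrow> L1 \<omega>"
    using L1 by (auto simp: seed_event_def)
  obtain H2 where H2: "H2 \<in> sets (\<Pi>\<^sub>M j\<in>J. M)" "q \<le> measure (seeds M) {\<omega> \<in> space (seeds M). restrict \<omega> J \<in> H2}"
    "\<And>\<omega>. \<omega> \<in> space (seeds M) \<Longrightarrow> restrict \<omega> J \<in> H2 \<Longrightarrow> L2 \<omega>"
    using L2 by (auto simp: seed_event_def)
  \<comment> \<open>A seed in \<open>W\<close> ends the search, so nothing is asked of the later
    seeds.\<close>
  let ?H3 = "space (\<Pi>\<^sub>M j\<in>J. M)"
  have spJ: "restrict \<omega> K \<in> space (\<Pi>\<^sub>M j\<in>K. M)" if "\<omega> \<in> space (seeds M)" for \<omega> K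
    using that by (auto simp: seeds_def space_PiM PiE_iff)
  have H3: "q \<le> measure (seeds M) {\<omega> \<in> space (seeds M). restrict \<omega> J \<in> ?H3}"
    using q S.prob_space spJ by (simp add: Collect_conj_eq Collect_mem_eq cong: conj_cong)
  let ?P = "\<lambda>X H. {\<omega> \<in> space (seeds M). \<omega> i \<in> X \<and> restrict \<omega> J \<in> H}"
  have [measurable]: "(\<lambda>\<omega>. \<omega> i) \<in> measurable (seeds M) M" by (simp add: seeds_def)
  have restr [measurable]: "(\<lambda>\<omega>. restrict \<omega> K) \<in> measurable (seeds M) (\<Pi>\<^sub>M j\<in>K. M)" for K
    unfolding seeds_def by (rule measurable_restrict_subset) simp
  have mP: "?P X H \<in> sets (seeds M)" if [measurable]: "X \<in> sets M" "H \<in> sets (\<Pi>\<^sub>M j\<in>J. M)" for X H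
    by measurable
  define H where "H = {f \<in> space (\<Pi>\<^sub>M j\<in>insert i J. M). f i \<in> U \<and> restrict f J \<in> H1 \<or> f i \<in> V \<and> restrict f J \<in> H2 \<or> f i \<in> W}"
  have [measurable]: "(\<lambda>f. f i) \<in> measurable (\<Pi>\<^sub>M j\<in>insert i J. M) M" by (rule measurable_component_singleton) simp
  have [measurable]: "(\<lambda>f. restrict f J) \<in> measurable (\<Pi>\<^sub>M j\<in>insert i J. M) (\<Pi>\<^sub>M j\<in>J. M)"
    by (rule measurable_restrict_subset) auto
  note [measurable] = sets H1(1) H2(1)
  have Hm: "H \<in> sets (\<Pi>\<^sub>M j\<in>insert i J. M)" unfolding H_def by measurable
  have mem: "restrict \<omega> (insert i J) \<in> H \<longleftrightarrow> \<omega> i \<in> U \<and> restrict \<omega> J \<in> H1 \<or> \<omega> i \<in> V \<and> restrict \<omega> J \<in> H2 \<or> \<omega> i \<in> W"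
    if "\<omega> \<in> space (seeds M)" for \<omega>
  proof -
    have "restrict (restrict \<omega> (insert i J)) J = restrict \<omega> J" by auto
    then show ?thesis using spJ[OF that] by (simp add: H_def)
  qed
  have eq: "{\<omega> \<in> space (seeds M). restrict \<omega> (insert i J) \<in> H} = ?P U H1 \<union> ?P V H2 \<union> ?P W ?H3"
    using mem spJ by auto
  have "measure M (U \<union> V \<union> W) = measure M U + measure M V + measure M W"
  proof -
    have "measure M (U \<union> V \<union> W) = measure M (U \<union> V) + measure M W"
      using sets disj by (intro finite_measure_Union) auto
    also have "measure M (U \<union> V) = measure M U + measure M V"
      using sets disj by (intro finite_measure_Union) auto
    finally show ?thesis .
  qed
  then have "measure M (U \<union> V \<union> W) * q = measure M U * q + measure M V * q + measure M W * q"
    by (simp add: distrib_right)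
  \<comment> \<open>By independence each branch contributes its own probability times at least
    \<open>q\<close>, although the event for the later seeds differs between branches.\<close>
  also have "\<dots> \<le> measure (seeds M) (?P U H1) + measure (seeds M) (?P V H2) + measure (seeds M) (?P W ?H3)"
    using H1 H2 H3 sets by (intro add_mono) (auto simp: seeds_indep[OF i] intro!: mult_left_mono)
  also have "\<dots> = measure (seeds M) (?P U H1 \<union> ?P V H2) + measure (seeds M) (?P W ?H3)"
    using disj mP[OF sets(1) H1(1)] mP[OF sets(2) H2(1)] by (subst S.finite_measure_Union) auto
  also have "\<dots> = measure (seeds M) (?P U H1 \<union> ?P V H2 \<union> ?P W ?H3)"
    using disj mP[OF sets(1) H1(1)] mP[OF sets(2) H2(1)] mP[OF sets(3), of ?H3]
    by (subst S.finite_measure_Union) auto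
  finally have "measure M (U \<union> V \<union> W) * q \<le> measure (seeds M) {\<omega> \<in> space (seeds M). restrict \<omega> (insert i J) \<in> H}"
    unfolding eq .
  moreover have "\<forall>\<omega>\<in>space (seeds M). restrict \<omega> (insert i J) \<in> H \<longrightarrow> \<omega> i \<in> U \<and> L1 \<omega> \<or> \<omega> i \<in> V \<and> L2 \<omega> \<or> \<omega> i \<in> W"
    using H1(3) H2(3) mem by blast
  ultimately show ?thesis unfolding seed_event_def by (intro bexI[OF _ Hm] conjI)
qed

lemma seed_event_mono:
  assumes "seed_event M J q L" "q' \<le> q" "\<And>\<omega>. \<omega> \<in> space (seeds M) \<Longrightarrow> L \<omega> \<Longrightarrow> L' \<omega>"
  shows "seed_event M J q' L'"
proof -
  obtain H where "H \<in> sets (\<Pi>\<^sub>M j\<in>J. M)" "q \<le> measure (seeds M) {\<omega> \<in> space (seeds M). restrict \<omega> J \<in> H}"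
    "\<forall>\<omega>\<in>space (seeds M). restrict \<omega> J \<in> H \<longrightarrow> L \<omega>"
    using assms(1) unfolding seed_event_def by (elim bexE conjE)
  then show ?thesis using assms(2,3) unfolding seed_event_def by (intro bexI[of _ H]) auto
qed

lemma (in prob_space) seed_event_trivial:
  assumes "q \<le> 0" shows "seed_event M J q L"
  unfolding seed_event_def using assms by (intro bexI[of _ "{}"]) auto

lemma (in prob_space) seed_event_True:
  assumes "q \<le> 1" shows "seed_event M J q (\<lambda>_. True)"
proof -
  interpret S: prob_space "seeds M"
    unfolding seeds_def by (intro prob_space_PiM prob_space_axioms)
  have "{\<omega> \<in> space (seeds M). restrict \<omega> J \<in> space (\<Pi>\<^sub>M j\<in>J. M)} = space (seeds M)"
    by (auto simp: seeds_def space_PiM PiE_iff)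
  then show ?thesis
    unfolding seed_event_def using assms S.prob_space by (intro bexI[of _ "space (\<Pi>\<^sub>M j\<in>J. M)"]) auto
qed

lemma quad_form_measurable:
  fixes A :: "real mat"
  assumes A: "A \<in> carrier_mat n n" and x: "\<And>s. s \<in> space M \<Longrightarrow> x s \<in> carrier_vec n"
    and meas: "\<And>i. i < n \<Longrightarrow> (\<lambda>s. vec_index (x s) i) \<in> borel_measurable M"
  shows "(\<lambda>s. x s \<bullet> (A *\<^sub>v x s)) \<in> borel_measurable M"
proof -
  have "x s \<bullet> (A *\<^sub>v x s) = (\<Sum>i\<in>{0..<n}. x s $ i * (\<Sum>j\<in>{0..<n}. A $$ (i, j) * x s $ j))" if "s \<in> space M" for s
    using A x[OF that] by (auto simp: scalar_prod_def intro!: sum.cong)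
  moreover have "(\<lambda>s. \<Sum>i\<in>{0..<n}. x s $ i * (\<Sum>j\<in>{0..<n}. A $$ (i, j) * x s $ j)) \<in> borel_measurable M"
    using meas by (intro borel_measurable_sum borel_measurable_times) auto
  ultimately show ?thesis by (subst measurable_cong) auto
qed

locale gtrs_random = gtrs_run P \<xi> \<zeta> \<gamma>h \<epsilon> eig cg p Ke Kc + prob_space M
  for P \<xi> \<zeta> \<gamma>h \<epsilon> and eig :: "'s eig_oracle" and cg p Ke Kc and M :: "'s measure" +
  assumes eig_spec: "\<And>n A \<rho> \<delta> p. 0 < n \<Longrightarrow> sym_mat n A \<Longrightarrow> spectral_norm A \<le> \<rho> \<Longrightarrow> 0 < \<delta> \<Longrightarrow> \<delta> \<le> \<rho> \<Longrightarrow>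
      0 < p \<Longrightarrow> p < 1 \<Longrightarrow>
       (\<forall>\<omega>\<in>space M. fst (eig A \<rho> \<delta> p \<omega>) \<in> carrier_vec n) \<and>
       (\<forall>i<n. (\<lambda>\<omega>. vec_index (fst (eig A \<rho> \<delta> p \<omega>)) i) \<in> borel_measurable M) \<and>
       (\<exists>E\<in>sets M. measure M E \<ge> 1 - p \<and> (\<forall>\<omega>\<in>E. eig_good eig Ke A \<rho> \<delta> p \<omega>))"
begin

text \<open>For fixed l and r the next matrix is fixed; only the continuation depends on the seed.
  One step is good with probability at least 1 - p'', and (1 - p'') (1 - k p'') \<ge> 1 - (k + 1)
  p''.\<close>

lemma loop_good_event:
  assumes m: "0 < m" "m \<le> 1" and p'': "0 < p''" "p'' < 1" and "0 \<le> l" "l \<le> r" "r \<le> \<zeta>"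
  shows "seed_event M ({t} \<times> {s..}) (1 - real k * p'') (\<lambda>\<omega>. loop_good eig P \<zeta> Ke \<omega> S m p'' t k s l r)"
  using assms(5-)
proof (induction k arbitrary: s l r)
  case 0
  then show ?case using seed_event_True[of 1] by simp
next
  case (Suc k)
  define g where "g = (l + r) / 2"
  have g: "l \<le> g" "g \<le> r" "0 \<le> g" "g \<le> \<zeta>" using Suc.prems by (auto simp: g_def)
  define x where "x u = fst (eig (A_at P g) (2 * \<zeta>) (m / 8) p'' u)" for u
  define v where "v u = x u \<bullet> (A_at P g *\<^sub>v x u)" for u
  have "m / 8 \<le> 2 * \<zeta>" using m zeta1 by simp
  note spec = eig_spec[OF n_pos symA spectral_norm_A_at[OF g(3,4)] _ this p'']
  \<comment> \<open>The branches must be events; they are, because the Rayleigh quotient is a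
    polynomial in the measurable coordinates of the output.\<close>
  have v_meas [measurable]: "v \<in> borel_measurable M"
    unfolding v_def x_def using spec m by (intro quad_form_measurable[OF A_carrier]) auto
  obtain E where E [measurable]: "E \<in> sets M" and PE: "1 - p'' \<le> measure M E"
    and good: "\<And>u. u \<in> E \<Longrightarrow> eig_good eig Ke (A_at P g) (2 * \<zeta>) (m / 8) p'' u"
    using spec m by auto
  have Esp: "u \<in> space M" if "u \<in> E" for u using sets.sets_into_space[OF E] that by auto
  define U where "U = {u \<in> space M. u \<in> E \<and> v u > m}"
  define V where "V = {u \<in> space M. u \<in> E \<and> \<not> v u > m \<and> v u < 5 / 8 * m}"
  define W where "W = {u \<in> space M. u \<in> E \<and> \<not> v u > m \<and> \<not> v u < 5 / 8 * m}"
  have sets: "U \<in> sets M" "V \<in> sets M" "W \<in> sets M" unfolding U_def V_def W_def by measurable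
  have UVW: "U \<union> V \<union> W = E" using Esp by (auto simp: U_def V_def W_def)
  let ?G = "\<lambda>l r \<omega>. loop_good eig P \<zeta> Ke \<omega> S m p'' t k (Suc s) l r"
  let ?J = "{t} \<times> {Suc s..}"
  let ?q = "1 - real k * p''"
  show ?case
  proof (cases "0 \<le> ?q")
    \<comment> \<open>A negative \<open>?q\<close> would reverse the product estimate of the other
      case; the claimed probability is then at most 0.\<close>
    case False
    then have "1 - real (Suc k) * p'' \<le> 0" using p'' by (simp add: algebra_simps)
    then show ?thesis by (rule seed_event_trivial)
  next
    case True
    have "seed_event M (insert (t, s) ?J) (measure M (U \<union> V \<union> W) * ?q)
        (\<lambda>\<omega>. \<omega> (t, s) \<in> U \<and> (case S of LeftSide \<Rightarrow> ?G l g \<omega> | RightSide \<Rightarrow> ?G g r \<omega>) \<or>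
          \<omega> (t, s) \<in> V \<and> (case S of LeftSide \<Rightarrow> ?G g r \<omega> | RightSide \<Rightarrow> ?G l g \<omega>) \<or> \<omega> (t, s) \<in> W)"
    proof (rule seed_event_branch[OF _ sets])
      show "seed_event M ?J ?q (\<lambda>\<omega>. case S of LeftSide \<Rightarrow> ?G l g \<omega> | RightSide \<Rightarrow> ?G g r \<omega>)"
        "seed_event M ?J ?q (\<lambda>\<omega>. case S of LeftSide \<Rightarrow> ?G g r \<omega> | RightSide \<Rightarrow> ?G l g \<omega>)"
        using Suc.IH[of l g "Suc s"] Suc.IH[of g r "Suc s"] g Suc.prems by (cases S; simp)+
    qed (use True p'' in \<open>auto simp: U_def V_def W_def\<close>)
    then have "seed_event M ({t} \<times> {s..}) (measure M (U \<union> V \<union> W) * ?q)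
        (\<lambda>\<omega>. \<omega> (t, s) \<in> U \<and> (case S of LeftSide \<Rightarrow> ?G l g \<omega> | RightSide \<Rightarrow> ?G g r \<omega>) \<or>
          \<omega> (t, s) \<in> V \<and> (case S of LeftSide \<Rightarrow> ?G g r \<omega> | RightSide \<Rightarrow> ?G l g \<omega>) \<or> \<omega> (t, s) \<in> W)"
      by (rule back_subst[of "\<lambda>J. seed_event M J _ _"]) (auto simp: Suc_le_eq le_less)
    then show ?thesis
    proof (rule seed_event_mono)
      show "1 - real (Suc k) * p'' \<le> measure M (U \<union> V \<union> W) * ?q"
    proof -
      have "1 - real (Suc k) * p'' \<le> (1 - p'') * ?q" using p'' by (simp add: algebra_simps)
      also have "\<dots> \<le> measure M E * ?q" using PE True by (intro mult_right_mono) auto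
      finally show ?thesis by (simp add: UVW)
    qed
      show "loop_good eig P \<zeta> Ke \<omega> S m p'' t (Suc k) s l r"
        if "\<omega> (t, s) \<in> U \<and> (case S of LeftSide \<Rightarrow> ?G l g \<omega> | RightSide \<Rightarrow> ?G g r \<omega>) \<or>
          \<omega> (t, s) \<in> V \<and> (case S of LeftSide \<Rightarrow> ?G g r \<omega> | RightSide \<Rightarrow> ?G l g \<omega>) \<or> \<omega> (t, s) \<in> W" for \<omega>
        using that good[of "\<omega> (t, s)"] unfolding loop_good.simps Let_def g_def[symmetric] x_def[symmetric] v_def[symmetric]
        by (auto simp: U_def V_def W_def)
    qed
  qed
qed

text \<open>Each search spends p / T, split evenly over its steps, and a union bound over the T
  iterations adds this up to p. The bad set is built from the measurable sets \<open>G t\<close>,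
  since \<open>search_good\<close> need not define one.\<close>

lemma search_good_event:
  "\<exists>E\<in>sets (seeds M). 1 - p \<le> measure (seeds M) E \<and> (\<forall>\<omega>\<in>E. search_good \<omega> S)"
proof -
  interpret S: prob_space "seeds M"
    unfolding seeds_def by (intro prob_space_PiM prob_space_axioms)
  let ?T = "real outer_T"
  define L where "L t \<omega> \<longleftrightarrow> loop_good eig P \<zeta> Ke \<omega> S (mt t)
     (p / ?T / real (inner_T (mt t))) t (inner_T (mt t)) 1 (left_end S) (right_end S)" for t \<omega>
  have "\<exists>G\<in>sets (seeds M). 1 - p / ?T \<le> measure (seeds M) G \<and> (\<forall>\<omega>\<in>G. L t \<omega>)" if t: "t \<in> {1..outer_T}" for t
  proof -
    have m: "0 < mt t" "mt t \<le> 1" using mt_pos mt_le[of t] xi1 xi0 t by auto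
    note T = inner_T_pos[OF m]
    have T1: "1 \<le> ?T" "1 \<le> real (inner_T (mt t))" using outer_T_pos T by auto
    have "1 * 1 \<le> ?T * real (inner_T (mt t))" using T1 by (intro mult_mono) auto
    then have p'': "0 < p / ?T / real (inner_T (mt t))" "p / ?T / real (inner_T (mt t)) < 1"
      using p0 p1 T1 by (auto simp: field_simps)
    have "seed_event M ({t} \<times> {1..}) (1 - real (inner_T (mt t)) * (p / ?T / real (inner_T (mt t)))) (L t)"
      unfolding L_def by (rule loop_good_event[OF m p'' end_range])
    then have "seed_event M ({t} \<times> {1..}) (1 - p / ?T) (L t)" using T by simp
    then obtain H where H: "H \<in> sets (\<Pi>\<^sub>M j\<in>{t} \<times> {1..}. M)"
      "1 - p / ?T \<le> measure (seeds M) {\<omega> \<in> space (seeds M). restrict \<omega> ({t} \<times> {1..}) \<in> H}"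
      "\<forall>\<omega>\<in>space (seeds M). restrict \<omega> ({t} \<times> {1..}) \<in> H \<longrightarrow> L t \<omega>"
      by (auto simp: seed_event_def)
    have "(\<lambda>\<omega>. restrict \<omega> ({t} \<times> {1..})) \<in> measurable (seeds M) (\<Pi>\<^sub>M j\<in>{t} \<times> {1..}. M)"
      unfolding seeds_def by (rule measurable_restrict_subset) simp
    from measurable_sets[OF this H(1)]
    have "{\<omega> \<in> space (seeds M). restrict \<omega> ({t} \<times> {1..}) \<in> H} \<in> sets (seeds M)"
      by (simp add: vimage_def Int_def conj_commute)
    then show ?thesis using H by blast
  qed
  then obtain G where G: "\<And>t. t \<in> {1..outer_T} \<Longrightarrow> G t \<in> sets (seeds M)"
    "\<And>t. t \<in> {1..outer_T} \<Longrightarrow> 1 - p / ?T \<le> measure (seeds M) (G t)"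
    "\<And>t \<omega>. t \<in> {1..outer_T} \<Longrightarrow> \<omega> \<in> G t \<Longrightarrow> L t \<omega>"
    by metis
  define B where "B = (\<Union>t\<in>{1..outer_T}. space (seeds M) - G t)"
  have B: "B \<in> sets (seeds M)" unfolding B_def using G(1) by (intro sets.finite_UN sets.Diff) auto
  have "measure (seeds M) B \<le> (\<Sum>t\<in>{1..outer_T}. measure (seeds M) (space (seeds M) - G t))"
    unfolding B_def using G(1) by (intro S.finite_measure_subadditive_finite) auto
  also have "\<dots> \<le> (\<Sum>t\<in>{1..outer_T}. p / ?T)"
    using G(1,2) by (intro sum_mono) (simp add: S.prob_compl algebra_simps)
  also have "\<dots> = p" using outer_T_pos by simp
  finally have "1 - p \<le> measure (seeds M) (space (seeds M) - B)"
    using S.prob_compl[OF B] by simp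
  moreover have "search_good \<omega> S" if "\<omega> \<in> space (seeds M) - B" for \<omega>
    using that G(3) unfolding search_good_def L_def B_def by auto
  ultimately show ?thesis using B by blast
qed

end

section \<open>From the oracle specifications to the uniform bound\<close>

theorem proposition1:
  fixes M :: "'s measure" and eig :: "'s eig_oracle" and cg :: cg_oracle
  assumes "prob_space M"
    and "approx_eig_spec M eig"
    and "conj_grad_spec cg"
  shows "\<exists>(C::real) (k::nat). \<forall>(P::gtrs) (\<xi>::real) (\<zeta>::real) (\<gamma>h::real) (\<epsilon>::real) (p::real).
     wf_gtrs P \<and>
     (\<exists>l<0. eigenvalue (A\<^sub>0 P) l) \<and> (\<exists>l<0. eigenvalue (A\<^sub>1 P) l) \<and>
     spectral_norm (A\<^sub>0 P) \<le> 1 \<and> vnorm (b\<^sub>0 P) \<le> 1 \<and> \<bar>c\<^sub>0 P\<bar> \<le> 1 \<and>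
     spectral_norm (A\<^sub>1 P) \<le> 1 \<and> vnorm (b\<^sub>1 P) \<le> 1 \<and> \<bar>c\<^sub>1 P\<bar> \<le> 1 \<and>
     nnz (A\<^sub>0 P) + nnz (A\<^sub>1 P) \<ge> qdim P \<and>
     0 \<le> \<gamma>h \<and> gamma_plus P \<le> \<zeta> \<and> \<xi> \<cdot>\<^sub>m 1\<^sub>m (qdim P) \<preceq>\<^sub>L A_at P \<gamma>h \<and>
     0 < \<xi> \<and> \<xi> \<le> 1 \<and> 1 \<le> \<zeta> \<and>
     0 < \<epsilon> \<and> \<epsilon> < 1 \<and> 0 < p \<and> p < 1
     \<longrightarrow>
     (\<exists>E\<in>sets (seeds M). measure (seeds M) E \<ge> 1 - p \<and> (\<forall>\<omega>\<in>E.
        let (out, time) = construct_reform eig cg P \<xi> \<zeta> \<gamma>h \<epsilon> p \<omega>;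
            N = real (nnz (A\<^sub>0 P) + nnz (A\<^sub>1 P));
            \<phi> = max (min (mu_star P) \<xi>) (\<epsilon> * \<xi> ^ 4 / \<zeta> ^ 4);
            L1 = lg (1 / \<phi>); L2 = lg (real (qdim P) / p); L3 = lg (\<zeta> / (\<epsilon> * \<xi>))
        in succeeds P \<xi> \<epsilon> out \<and>
           real time \<le> C * (N * sqrt \<zeta> / sqrt \<phi> * L1 * L2 * L3) * (lg L1 * lg L2 * lg L3) ^ k))"
proof -
  obtain K where K: "\<And>n A \<rho> \<delta> p. 0 < n \<and> sym_mat n A \<and> spectral_norm A \<le> \<rho> \<and> 0 < \<delta> \<and> \<delta> \<le> \<rho> \<and> 0 < p \<and> p < 1 \<Longrightarrow>
       (\<forall>\<omega>\<in>space M. fst (eig A \<rho> \<delta> p \<omega>) \<in> carrier_vec n) \<and>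
       (\<forall>i<n. (\<lambda>\<omega>. vec_index (fst (eig A \<rho> \<delta> p \<omega>)) i) \<in> borel_measurable M) \<and>
       (\<exists>E\<in>sets M. measure M E \<ge> 1 - p \<and> (\<forall>\<omega>\<in>E.
          let (x, time) = eig A \<rho> \<delta> p \<omega> in
            vnorm x = 1 \<and> x \<bullet> (A *\<^sub>v x) \<le> lambda_min A + \<delta> \<and>
            real time \<le> K * real (max n (nnz A)) * sqrt (\<rho> / \<delta>) * lg (real n / p)))"
    using assms(2) unfolding approx_eig_spec_def by blast
  obtain K' where K': "\<And>n A b \<mu> \<rho> \<delta>. 0 < n \<and> sym_mat n A \<and> b \<in> carrier_vec n \<and> 0 < \<mu> \<and> 0 < \<delta> \<and>
     \<mu> \<cdot>\<^sub>m 1\<^sub>m n \<preceq>\<^sub>L A \<and> A \<preceq>\<^sub>L \<rho> \<cdot>\<^sub>m 1\<^sub>m n \<Longrightarrow>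
       (let (x, time) = cg A b \<mu> \<rho> \<delta> in
          x \<in> carrier_vec n \<and> vnorm (x + mat_inv A *\<^sub>v b) \<le> \<delta> \<and>
          real time \<le> K' * real (nnz A) * sqrt (\<rho> / \<mu>) * lg (vnorm b / (\<mu> * \<delta>)))"
    using assms(3) unfolding conj_grad_spec_def by blast
  \<comment> \<open>The constants of the specifications may be negative; enlarging them keeps the
    bounds valid, as the remaining factors are nonnegative.\<close>
  define Ke where "Ke = max 1 K"
  define Kc where "Kc = max 1 K'"
  have lg0: "0 \<le> lg x" for x using lg_ge_1[of x] by simp
  have mono: "K * real a * sqrt (\<rho> / \<delta>) * lg y \<le> Ke * real a * sqrt (\<rho> / \<delta>) * lg y"
    if "0 < \<delta>" "\<delta> \<le> \<rho>" for a \<rho> \<delta> y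
    using that lg0 by (intro mult_right_mono) (auto simp: Ke_def)
  have eig: "(\<forall>\<omega>\<in>space M. fst (eig A \<rho> \<delta> p \<omega>) \<in> carrier_vec n) \<and>
       (\<forall>i<n. (\<lambda>\<omega>. vec_index (fst (eig A \<rho> \<delta> p \<omega>)) i) \<in> borel_measurable M) \<and>
       (\<exists>E\<in>sets M. measure M E \<ge> 1 - p \<and> (\<forall>\<omega>\<in>E. eig_good eig Ke A \<rho> \<delta> p \<omega>))"
    if "0 < n" "sym_mat n A" "spectral_norm A \<le> \<rho>" "0 < \<delta>" "\<delta> \<le> \<rho>" "0 < p" "p < 1" for n A \<rho> \<delta> p
  proof -
    have hyps: "0 < n \<and> sym_mat n A \<and> spectral_norm A \<le> \<rho> \<and> 0 < \<delta> \<and> \<delta> \<le> \<rho> \<and> 0 < p \<and> p < 1" using that by simp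
    note spec1 = conjunct1[OF K[OF hyps]] and spec2 = conjunct1[OF conjunct2[OF K[OF hyps]]]
      and spec3 = conjunct2[OF conjunct2[OF K[OF hyps]]]
    have dim: "dim_row A = n" using that(2) by (auto simp: sym_mat_def)
    obtain E where E: "E \<in> sets M" "measure M E \<ge> 1 - p" "\<forall>\<omega>\<in>E.
          let (x, time) = eig A \<rho> \<delta> p \<omega> in
            vnorm x = 1 \<and> x \<bullet> (A *\<^sub>v x) \<le> lambda_min A + \<delta> \<and>
            real time \<le> K * real (max n (nnz A)) * sqrt (\<rho> / \<delta>) * lg (real n / p)"
      using spec3 by (elim bexE conjE)
    have "eig_good eig Ke A \<rho> \<delta> p \<omega>" if "\<omega> \<in> E" for \<omega>
    proof -
      have "\<omega> \<in> space M" using sets.sets_into_space[OF E(1)] that by auto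
      then have "fst (eig A \<rho> \<delta> p \<omega>) \<in> carrier_vec n"
        using spec1 by simp
      then show ?thesis
        using E(3) that mono[OF \<open>0 < \<delta>\<close> \<open>\<delta> \<le> \<rho>\<close>, of "max n (nnz A)" "real n / p"]
        unfolding eig_good_def dim by (force simp: split_beta Let_def)
    qed
    then show ?thesis using spec1 spec2 E(1,2) by blast
  qed
  have cg: "fst (cg A b \<mu> \<rho> \<delta>) \<in> carrier_vec n \<and> vnorm (fst (cg A b \<mu> \<rho> \<delta>) + mat_inv A *\<^sub>v b) \<le> \<delta> \<and>
      real (snd (cg A b \<mu> \<rho> \<delta>)) \<le> Kc * real (nnz A) * sqrt (\<rho> / \<mu>) * lg (vnorm b / (\<mu> * \<delta>))"
    if "0 < n" "sym_mat n A" "b \<in> carrier_vec n" "0 < \<mu>" "0 < \<delta>" "\<mu> \<cdot>\<^sub>m 1\<^sub>m n \<preceq>\<^sub>L A" "A \<preceq>\<^sub>L \<rho> \<cdot>\<^sub>m 1\<^sub>m n" for n A b \<mu> \<rho> \<delta>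
  proof -
    \<comment> \<open>Both Loewner bounds tested on a unit vector; so \<rho> / \<mu> is positive and
      its root a nonnegative factor.\<close>
    have "\<mu> \<le> \<rho>"
    proof -
      let ?u = "unit_vec n 0 :: real vec"
      have u: "?u \<in> carrier_vec n" "?u \<bullet> ?u = 1" using that(1) by auto
      have "\<mu> * (?u \<bullet> ?u) \<le> ?u \<bullet> (A *\<^sub>v ?u)" "?u \<bullet> (A *\<^sub>v ?u) \<le> \<rho> * (?u \<bullet> ?u)"
        using that(6,7) u(1) sym_mat_carrier[OF that(2)]
        by (auto simp: loewner_le_iff[of _ n] scalar_mat_quad_form)
      then show ?thesis using u by simp
    qed
    then have "K' * real (nnz A) * sqrt (\<rho> / \<mu>) * lg (vnorm b / (\<mu> * \<delta>)) \<le> Kc * real (nnz A) * sqrt (\<rho> / \<mu>) * lg (vnorm b / (\<mu> * \<delta>))"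
      using that lg0 by (intro mult_right_mono) (auto simp: Kc_def)
    then show ?thesis using K'[of n A b \<mu> \<delta> \<rho>] that by (force simp: split_beta Let_def)
  qed
  \<comment> \<open>The constant depends on \<open>Ke\<close> and \<open>Kc\<close> alone, hence not
    on the instance; one power of the product of the iterated logarithms suffices.\<close>
  show ?thesis
  proof (rule exI[of _ "500 + 600 * (357 + 1064 * Ke + 252 * Kc) + 1000 * Kc"], rule exI[of _ 1],
      intro allI impI, elim conjE)
    fix P :: gtrs and \<xi> \<zeta> \<gamma>h \<epsilon> p :: real
    assume a: "wf_gtrs P" "\<exists>l<0. eigenvalue (A\<^sub>0 P) l" "\<exists>l<0. eigenvalue (A\<^sub>1 P) l"
      "spectral_norm (A\<^sub>0 P) \<le> 1" "vnorm (b\<^sub>0 P) \<le> 1" "\<bar>c\<^sub>0 P\<bar> \<le> 1"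
      "spectral_norm (A\<^sub>1 P) \<le> 1" "vnorm (b\<^sub>1 P) \<le> 1" "\<bar>c\<^sub>1 P\<bar> \<le> 1"
      "nnz (A\<^sub>0 P) + nnz (A\<^sub>1 P) \<ge> qdim P"
      "0 \<le> \<gamma>h" "gamma_plus P \<le> \<zeta>" "\<xi> \<cdot>\<^sub>m 1\<^sub>m (qdim P) \<preceq>\<^sub>L A_at P \<gamma>h"
      "0 < \<xi>" "\<xi> \<le> 1" "1 \<le> \<zeta>" "0 < \<epsilon>" "\<epsilon> < 1" "0 < p" "p < 1"
    interpret gtrs_run P \<xi> \<zeta> \<gamma>h \<epsilon> eig cg p Ke Kc
      by unfold_locales (use a cg in \<open>auto simp: Ke_def Kc_def\<close>)
    interpret prob_space M by (rule assms(1))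
    interpret gtrs_random P \<xi> \<zeta> \<gamma>h \<epsilon> eig cg p Ke Kc M
      by unfold_locales (use eig in blast)
    obtain E where E: "E \<in> sets (seeds M)" "1 - p \<le> measure (seeds M) E" "\<And>\<omega>. \<omega> \<in> E \<Longrightarrow> search_good \<omega> start_side"
      using search_good_event[of start_side] by blast
    show "\<exists>E\<in>sets (seeds M). measure (seeds M) E \<ge> 1 - p \<and> (\<forall>\<omega>\<in>E.
        let (out, time) = construct_reform eig cg P \<xi> \<zeta> \<gamma>h \<epsilon> p \<omega>;
            N = real (nnz (A\<^sub>0 P) + nnz (A\<^sub>1 P));
            \<phi> = max (min (mu_star P) \<xi>) (\<epsilon> * \<xi> ^ 4 / \<zeta> ^ 4);
            L1 = lg (1 / \<phi>); L2 = lg (real (qdim P) / p); L3 = lg (\<zeta> / (\<epsilon> * \<xi>))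
        in succeeds P \<xi> \<epsilon> out \<and>
           real time \<le> (500 + 600 * (357 + 1064 * Ke + 252 * Kc) + 1000 * Kc) *
             (N * sqrt \<zeta> / sqrt \<phi> * L1 * L2 * L3) * (lg L1 * lg L2 * lg L3) ^ 1)"
    proof (intro bexI[of _ E] conjI ballI)
      fix \<omega> assume "\<omega> \<in> E"
      note good = construct_reform_correct[OF E(3)[OF this]]
      have eq: "total_const * (H / sqrt \<phi>) = (500 + 600 * (357 + 1064 * Ke + 252 * Kc) + 1000 * Kc) *
             (N * sqrt \<zeta> / sqrt \<phi> * L1 * L2 * L3) * (lg L1 * lg L2 * lg L3)"
        by (simp add: total_const_def iter_const_def H_def LL_def)
      show "let (out, time) = construct_reform eig cg P \<xi> \<zeta> \<gamma>h \<epsilon> p \<omega>;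
            N = real (nnz (A\<^sub>0 P) + nnz (A\<^sub>1 P));
            \<phi> = max (min (mu_star P) \<xi>) (\<epsilon> * \<xi> ^ 4 / \<zeta> ^ 4);
            L1 = lg (1 / \<phi>); L2 = lg (real (qdim P) / p); L3 = lg (\<zeta> / (\<epsilon> * \<xi>))
        in succeeds P \<xi> \<epsilon> out \<and>
           real time \<le> (500 + 600 * (357 + 1064 * Ke + 252 * Kc) + 1000 * Kc) *
             (N * sqrt \<zeta> / sqrt \<phi> * L1 * L2 * L3) * (lg L1 * lg L2 * lg L3) ^ 1"
        using good(1) good(2)[unfolded eq]
        unfolding N_def \<phi>_def L1_def L2_def L3_def power_one_right Let_def split_beta by (rule conjI)
    qed (use E in auto)
  qed
qed

end
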